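(* For every $t>0$, the operator $\exp(-t\mathbb G)$ on $L^2(\mathbb R^d)$ is an integral operator with kernel $$p_t(x,y)=(2\pi t)^{-D/2}\int_{\mathbb R^{d''}}e^{\frac{i}{t}(x''-y'')\cdot\xi''}\exp\Big(-\frac{|\xi''|}{4t}\big(|x'+y'|^2\tanh|\xi''|+|x'-y'|^2\coth|\xi''|\big)\Big)\Big(\frac{|\xi''|}{\sinh2|\xi''|}\Big)^{d'/2}d\xi'',$$ where $D=d'+2d''$; that is, for every $f\in L^2(\mathbb R^d)$, $$\exp(-t\mathbb G)f(x)=\int_{\mathbb R^d}p_t(x,y)f(y)\,dy$$ for almost every $x\in\mathbb R^d$.
   Context: Let $d',d''\ge1$ be integers, $d=d'+d''$, and write $x=(x',x'')\in\mathbb R^d=\mathbb R^{d'}\times\mathbb R^{d''}$, and similarly for $y$. Put $\mathbb R^{d''}_0=\mathbb R^{d''}\setminus\{0\}$, $\mathbb N=\{0,1,2,\dots\}$, and $|k|=k_1+\dots+k_{d'}$ for $k\in\mathbb N^{d'}$. Hermite functions: $h_n(u)=(2^n n!\sqrt\pi)^{-1/2}H_n(u)e^{-u^2/2}$ on $\mathbb R$ ($H_n$ the Hermite polynomials), $h_k(x')=\prod_{j=1}^{d'}h_{k_j}(x'_j)$ for $k\in\mathbb N^{d'}$, and $h_{k,\tau}(x')=\tau^{d'/4}h_k(\tau^{1/2}x')$ for $\tau>0$; for each $\tau>0$ the family $\{h_{k,\tau}\}_k$ is an orthonormal basis of $L^2(\mathbb R^{d'})$. For $\xi''\in\mathbb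 R^{d''}_0$ and $g\in L^2(\mathbb R^{d'})$, $\mathcal H^{sc}_{\xi''}g(k)=\langle g,h_{k,|\xi''|}\rangle_{L^2(\mathbb R^{d'})}$. $\mathcal F''$ is the unitary Fourier transform on $L^2(\mathbb R^{d''})$, given for integrable functions by $\mathcal F''g(\xi'')=(2\pi)^{-d''/2}\int g(x'')e^{-i\xi''\cdot x''}dx''$. $L^2(\Gamma)=L^2(\mathbb N^{d'}\times\mathbb R^{d''})$ with respect to counting measure times Lebesgue measure. For $f\in L^2(\mathbb R^d)$, with $f_{x'}=f(x',\cdot)$, $\mathcal Gf(k,\xi'')=\mathcal H^{sc}_{\xi''}[x'\mapsto\mathcal F''f_{x'}(\xi'')](k)$. The map $\mathcal G:L^2(\mathbb R^d)\to L^2(\Gamma)$ is a unitary bijection with inverse $\mathcal G^{-1}$. Let $\Theta(k,\xi'')=(2|k|+d')|\xi''|$ on $\mathbb N^{d'}\times\mathbb R^{d''}_0$, and let $\mathbb M_\Theta F=\Theta F$ with domain $\{F\in L^2(\Gamma):\Theta F\in L^2(\Gamma)\}$. Define $\mathrm{Dom}\,\mathbb G=\{f\in L^2(\mathbb R^d):\Theta\,\mathcal Gf\in L^2(\Gamma)\}$ and $\mathbb G=\mathcal G^{-1}\circ\mathbb M_\Theta\circ\mathcal G$; this is a nonnegative self-adjoint extension of the Grushin operator $-\Delta_{x'}-|x'|^2\Delta_{x''}$ with domain $C_c^\infty(\mathbb R^d)$. For $t>0$, $\exp(-t\mathbb G)$ is given by the functional calculus: $\exp(-t\mathbb G)=\mathcal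 G^{-1}\circ M_{e^{-t\Theta}}\circ\mathcal G$, where $M_{e^{-t\Theta}}$ is multiplication by $e^{-t\Theta(k,\xi'')}$ on $L^2(\Gamma)$. *)

theory Defs
  imports "HOL-Analysis.Analysis"
begin

text \<open>
  \<open>\<real>\<^sup>d\<close> is the product type \<open>(real^'m) \<times> (real^'n)\<close>, with \<open>d' = CARD('m)\<close> and \<open>d'' = CARD('n)\<close>;
  its \<open>lborel\<close> is the product Lebesgue measure. Elements of \<open>L\<^sup>2\<close> are handled through representing
  functions, so operators on \<open>L\<^sup>2\<close> send functions to functions, and the value is determined
  only up to equality almost everywhere.
\<close>

section \<open>Square-integrable functions\<close>

definition L2 :: "'a measure \<Rightarrow> ('a \<Rightarrow> complex) set" where
  "L2 M = {f \<in> borel_measurable M. integrable M (\<lambda>x. (cmod (f x))\<^sup>2)}"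

definition L2_inner :: "'a measure \<Rightarrow> ('a \<Rightarrow> complex) \<Rightarrow> ('a \<Rightarrow> complex) \<Rightarrow> complex" where
  "L2_inner M f g = (LINT x|M. f x * cnj (g x))"

definition L2_tendsto ::
  "'a measure \<Rightarrow> (nat \<Rightarrow> 'a \<Rightarrow> complex) \<Rightarrow> ('a \<Rightarrow> complex) \<Rightarrow> bool" where
  "L2_tendsto M u g \<longleftrightarrow>
     (\<lambda>j. \<integral>\<^sup>+x. ennreal ((cmod (u j x - g x))\<^sup>2) \<partial>M) \<longlonglongrightarrow> 0"


section \<open>Hermite functions\<close>

text \<open>The physicists' Hermite polynomials, orthogonal with respect to \<open>exp (- u\<^sup>2)\<close>.\<close>

fun Hermite_poly :: "nat \<Rightarrow> real \<Rightarrow> real" where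
  "Hermite_poly 0 u = 1"
| "Hermite_poly (Suc 0) u = 2 * u"
| "Hermite_poly (Suc (Suc n)) u =
     2 * u * Hermite_poly (Suc n) u - 2 * real (Suc n) * Hermite_poly n u"

definition hermite_fun :: "nat \<Rightarrow> real \<Rightarrow> real" where
  "hermite_fun n u =
     (2 ^ n * fact n * sqrt pi) powr (- 1 / 2) * Hermite_poly n u * exp (- u\<^sup>2 / 2)"

definition hermite_fun_vec :: "nat^'m \<Rightarrow> real^'m \<Rightarrow> real" where
  "hermite_fun_vec k x = (\<Prod>j\<in>UNIV. hermite_fun (k $ j) (x $ j))"

definition scaled_hermite_fun :: "nat^'m \<Rightarrow> real \<Rightarrow> real^'m \<Rightarrow> real" where
  "scaled_hermite_fun k \<tau> x =
     \<tau> powr (real CARD('m) / 4) * hermite_fun_vec k (\<tau> powr (1 / 2) *\<^sub>R x)"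

definition scaled_hermite_transform ::
  "real^'n \<Rightarrow> (real^'m \<Rightarrow> complex) \<Rightarrow> nat^'m \<Rightarrow> complex" where
  "scaled_hermite_transform \<xi> g k =
     L2_inner lborel g (\<lambda>x. complex_of_real (scaled_hermite_fun k (norm \<xi>) x))"


section \<open>The unitary Fourier transform\<close>

definition fourier_integral :: "(real^'n \<Rightarrow> complex) \<Rightarrow> real^'n \<Rightarrow> complex" where
  "fourier_integral g \<xi> =
     complex_of_real ((2 * pi) powr (- real CARD('n) / 2)) *
     (LINT x|lborel. g x * exp (- \<i> * complex_of_real (\<xi> \<bullet> x)))"

text \<open>
  The extension to \<open>L\<^sup>2\<close> by density and continuity: the \<open>L\<^sup>2\<close> limit of the Fourier integrals of
  functions \<open>u j \<in> L\<^sup>1 \<inter> L\<^sup>2\<close> that converge to \<open>g\<close> in \<open>L\<^sup>2\<close>. By Plancherel's theorem it exists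
  and, up to null sets, does not depend on \<open>u\<close>.
\<close>

definition fourier_L2 :: "(real^'n \<Rightarrow> complex) \<Rightarrow> real^'n \<Rightarrow> complex" where
  "fourier_L2 g =
     (SOME h. h \<in> L2 lborel \<and>
        (\<exists>u. (\<forall>j. u j \<in> L2 lborel \<and> integrable lborel (u j)) \<and>
             L2_tendsto lborel u g \<and>
             L2_tendsto lborel (\<lambda>j. fourier_integral (u j)) h))"

text \<open>
  The Fourier transform in the second variable, applied to the slices \<open>f\<^sub>x'\<close>. Each
  \<open>fourier_L2 f\<^sub>x'\<close> is determined only up to a null set depending on \<open>x'\<close>, so a jointly
  measurable representative is selected.
\<close>

definition partial_fourier ::
  "((real^'m) \<times> (real^'n) \<Rightarrow> complex) \<Rightarrow> (real^'m) \<times> (real^'n) \<Rightarrow> complex" where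
  "partial_fourier f =
     (SOME h. h \<in> L2 lborel \<and>
        (AE x' in lborel. AE \<xi> in lborel. h (x', \<xi>) = fourier_L2 (\<lambda>x''. f (x', x'')) \<xi>))"


section \<open>The operator \<open>\<G>\<close> and the functional calculus\<close>

definition Gamma_measure :: "((nat^'m) \<times> (real^'n)) measure" where
  "Gamma_measure = count_space UNIV \<Otimes>\<^sub>M lborel"

definition grushin_transform ::
  "((real^'m) \<times> (real^'n) \<Rightarrow> complex) \<Rightarrow> (nat^'m) \<times> (real^'n) \<Rightarrow> complex" where
  "grushin_transform f = (\<lambda>(k, \<xi>).
     scaled_hermite_transform \<xi> (\<lambda>x'. partial_fourier f (x', \<xi>)) k)"

definition inv_grushin_transform ::
  "((nat^'m) \<times> (real^'n) \<Rightarrow> complex) \<Rightarrow> (real^'m) \<times> (real^'n) \<Rightarrow> complex" where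
  "inv_grushin_transform F =
     (SOME f. f \<in> L2 lborel \<and> (AE \<gamma> in Gamma_measure. grushin_transform f \<gamma> = F \<gamma>))"

definition Theta :: "(nat^'m) \<times> (real^'n) \<Rightarrow> real" where
  "Theta = (\<lambda>(k, \<xi>). real (2 * (\<Sum>j\<in>UNIV. k $ j) + CARD('m)) * norm \<xi>)"

text \<open>The operator \<open>\<phi>(\<bbbG>) = \<G>\<^sup>-\<^sup>1 \<circ> M \<circ> \<G>\<close>, where \<open>M\<close> is multiplication by \<open>\<phi> \<circ> \<Theta>\<close>.\<close>

definition grushin_calculus ::
  "(real \<Rightarrow> real) \<Rightarrow> ((real^'m) \<times> (real^'n) \<Rightarrow> complex) \<Rightarrow> (real^'m) \<times> (real^'n) \<Rightarrow> complex" where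
  "grushin_calculus \<phi> f =
     inv_grushin_transform (\<lambda>\<gamma>. complex_of_real (\<phi> (Theta \<gamma>)) * grushin_transform f \<gamma>)"

definition grushin_domain :: "((real^'m) \<times> (real^'n) \<Rightarrow> complex) set" where
  "grushin_domain = {f \<in> L2 lborel.
     (\<lambda>\<gamma>. complex_of_real (Theta \<gamma>) * grushin_transform f \<gamma>) \<in> L2 Gamma_measure}"

text \<open>The operator \<open>\<bbbG>\<close>; only its values on \<^const>\<open>grushin_domain\<close> are meaningful.\<close>

definition grushin_operator ::
  "((real^'m) \<times> (real^'n) \<Rightarrow> complex) \<Rightarrow> (real^'m) \<times> (real^'n) \<Rightarrow> complex" where
  "grushin_operator = grushin_calculus (\<lambda>s. s)"

definition grushin_semigroup ::
  "real \<Rightarrow> ((real^'m) \<times> (real^'n) \<Rightarrow> complex) \<Rightarrow> (real^'m) \<times> (real^'n) \<Rightarrow> complex" where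
  "grushin_semigroup t = grushin_calculus (\<lambda>s. exp (- t * s))"


section \<open>The heat kernel\<close>

definition coth :: "real \<Rightarrow> real" where
  "coth r = cosh r / sinh r"

text \<open>At \<open>\<xi> = 0\<close> the integrand takes a junk value (division by zero), on a null set.\<close>

definition heat_kernel_integrand ::
  "real \<Rightarrow> (real^'m) \<times> (real^'n) \<Rightarrow> (real^'m) \<times> (real^'n) \<Rightarrow> real^'n \<Rightarrow> complex" where
  "heat_kernel_integrand t = (\<lambda>(x', x'') (y', y'') \<xi>.
     exp (\<i> / complex_of_real t * complex_of_real ((x'' - y'') \<bullet> \<xi>)) *
     complex_of_real
       (exp (- (norm \<xi> / (4 * t)) *
             ((norm (x' + y'))\<^sup>2 * tanh (norm \<xi>) + (norm (x' - y'))\<^sup>2 * coth (norm \<xi>))) *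
        (norm \<xi> / sinh (2 * norm \<xi>)) powr (real CARD('m) / 2)))"

definition heat_kernel ::
  "real \<Rightarrow> (real^'m) \<times> (real^'n) \<Rightarrow> (real^'m) \<times> (real^'n) \<Rightarrow> complex" where
  "heat_kernel t x y =
     complex_of_real ((2 * pi * t) powr (- real (CARD('m) + 2 * CARD('n)) / 2)) *
     (LINT \<xi>|lborel. heat_kernel_integrand t x y \<xi>)"

end

theory Submission
  imports Defs "HOL-Probability.Probability"
begin

text \<open>
  Under the partial Fourier transform in \<open>x''\<close> the semigroup acts on the fibre over \<open>\<xi>\<close> as the Hermite
  semigroup, whose kernel is Mehler's. Let \<open>F(x', \<cdot>)\<close> be the inverse Fourier transform of
  \<open>g(x', \<xi>) = \<integral> mehler t |\<xi>| x' y' P(y', \<xi>) dy'\<close>, where \<open>P\<close> is the partial Fourier transform of \<open>f\<close>.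
  The multiplication formula \<open>\<integral> (\<F>g) v = \<integral> g (\<F>v)\<close> shows that \<open>F\<close> is the integral of \<open>f\<close> against the heat kernel.
  The Mehler expansion is not needed: it suffices that Hermite functions are eigenfunctions of Mehler's
  kernel, so that \<open>\<G>F = exp(-t\<Theta>)\<G>f\<close>, and that \<open>\<G>\<close> is injective, which follows from the completeness
  of the Hermite functions and the injectivity of the Fourier transform.
\<close>

section \<open>Square-integrable functions\<close>

text \<open>The transforms in the definitions are chosen by \<open>SOME\<close>, so each is known
  only through a property for which a witness must be exhibited. For \<open>partial_fourier\<close>
  the witness has to be jointly measurable although its slices are L2 limits. Truncating f at
  suitably chosen radii gives explicit transforms that converge so fast that one pointwise limit
  works on the whole product and on almost every slice. For the inverse of \<G> the witness is the
  explicit solution itself, and injectivity identifies the chosen value with it.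

  The Fourier theory rests on Gaussians: Plancherel's inequality is proved with Gaussian damping,
  which Fatou's lemma removes, and modulated Gaussians are enough to separate L2 functions.

  Integrability on the heat side comes from one estimate. Replacing \<xi> by t \<xi> turns the
  integrand of the heat kernel into Mehler's kernel, which is dominated by a Gaussian in x' - y'
  times an exponential in |\<xi>|.\<close>

abbreviation nsq :: "complex \<Rightarrow> ennreal" where
  "nsq z \<equiv> ennreal ((cmod z)\<^sup>2)"

abbreviation osc :: "real \<Rightarrow> complex" where
  "osc a \<equiv> exp (- \<i> * complex_of_real a)"

lemma L2_iff_nn_integral:
  "f \<in> L2 M \<longleftrightarrow> f \<in> borel_measurable M \<and> (\<integral>\<^sup>+x. nsq (f x) \<partial>M) < \<infinity>"
  by (auto simp: L2_def integrable_iff_bounded)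

lemma L2_borel_measurable: "f \<in> L2 M \<Longrightarrow> f \<in> borel_measurable M"
  by (simp add: L2_def)

lemma L2_integrable_sq: "f \<in> L2 M \<Longrightarrow> integrable M (\<lambda>x. (cmod (f x))\<^sup>2)"
  by (simp add: L2_def)

lemma L2_bound:
  assumes "g \<in> L2 M" "f \<in> borel_measurable M" "AE x in M. cmod (f x) \<le> C * cmod (g x)"
  shows "f \<in> L2 M"
proof -
  have "integrable M (\<lambda>x. C\<^sup>2 * (cmod (g x))\<^sup>2)"
    using L2_integrable_sq[OF assms(1)] by simp
  moreover have "AE x in M. norm ((cmod (f x))\<^sup>2) \<le> norm (C\<^sup>2 * (cmod (g x))\<^sup>2)"
    using assms(3)
  proof eventually_elim
    case (elim x)
    then have "(cmod (f x))\<^sup>2 \<le> (C * cmod (g x))\<^sup>2"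
      by (intro power_mono) auto
    then show ?case by (simp add: power_mult_distrib)
  qed
  ultimately have "integrable M (\<lambda>x. (cmod (f x))\<^sup>2)"
    using assms(2) by (elim Bochner_Integration.integrable_bound) measurable
  then show ?thesis
    unfolding L2_def using assms(2) by simp
qed

lemma L2_add:
  assumes "f \<in> L2 M" "g \<in> L2 M"
  shows "(\<lambda>x. f x + g x) \<in> L2 M"
proof -
  note [measurable] = L2_borel_measurable[OF assms(1)] L2_borel_measurable[OF assms(2)]
  have "integrable M (\<lambda>x. 2 * (cmod (f x))\<^sup>2 + 2 * (cmod (g x))\<^sup>2)"
    using L2_integrable_sq[OF assms(1)] L2_integrable_sq[OF assms(2)] by simp
  moreover have "norm ((cmod (f x + g x))\<^sup>2) \<le> norm (2 * (cmod (f x))\<^sup>2 + 2 * (cmod (g x))\<^sup>2)" for x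
  proof -
    have "(cmod (f x + g x))\<^sup>2 \<le> (cmod (f x) + cmod (g x))\<^sup>2"
      by (intro power_mono norm_triangle_ineq) auto
    also have "\<dots> \<le> 2 * (cmod (f x))\<^sup>2 + 2 * (cmod (g x))\<^sup>2"
      using sum_squares_bound[of "cmod (f x)" "cmod (g x)"] by (simp add: power2_sum)
    finally show ?thesis by simp
  qed
  ultimately show ?thesis
    unfolding L2_def by (auto intro: Bochner_Integration.integrable_bound)
qed

lemma L2_cmult:
  assumes "f \<in> L2 M" shows "(\<lambda>x. c * f x) \<in> L2 M"
  using L2_borel_measurable[OF assms]
  by (intro L2_bound[OF assms, where C="cmod c"]) (auto simp: norm_mult)

lemma L2_diff:
  assumes "f \<in> L2 M" "g \<in> L2 M"
  shows "(\<lambda>x. f x - g x) \<in> L2 M"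
  using L2_add[OF assms(1) L2_cmult[OF assms(2), of "-1"]] by simp

lemma L2_mult_integrable:
  assumes "f \<in> L2 M" "g \<in> L2 M"
  shows "integrable M (\<lambda>x. f x * g x)"
proof (rule Bochner_Integration.integrable_bound)
  note [measurable] = L2_borel_measurable[OF assms(1)] L2_borel_measurable[OF assms(2)]
  show "integrable M (\<lambda>x. (cmod (f x))\<^sup>2 + (cmod (g x))\<^sup>2)"
    using L2_integrable_sq[OF assms(1)] L2_integrable_sq[OF assms(2)] by simp
  have "cmod (f x) * cmod (g x) \<le> (cmod (f x))\<^sup>2 + (cmod (g x))\<^sup>2" for x
    using sum_squares_bound[of "cmod (f x)" "cmod (g x)"]
      mult_nonneg_nonneg[OF norm_ge_zero[of "f x"] norm_ge_zero[of "g x"]] by linarith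
  then show "AE x in M. norm (f x * g x) \<le> norm ((cmod (f x))\<^sup>2 + (cmod (g x))\<^sup>2)"
    by (auto simp: norm_mult)
  show "(\<lambda>x. f x * g x) \<in> borel_measurable M" by measurable
qed

lemma norm_mult_le_half_sum_squares:
  fixes a b :: complex
  shows "cmod (a * b) \<le> ((cmod a)\<^sup>2 + (cmod b)\<^sup>2) / 2"
  using sum_squares_bound[of "cmod a" "cmod b"] by (simp add: norm_mult)

text \<open>Cauchy-Schwarz in the extended nonnegative reals. When the product is not integrable,
  its Bochner integral is 0 by convention and the bound is trivial.\<close>

lemma norm_integral_mult_le:
  fixes f g :: "'a \<Rightarrow> complex"
  assumes [measurable]: "f \<in> borel_measurable M" "g \<in> borel_measurable M"
  shows "nsq (LINT x|M. f x * g x) \<le>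
    (\<integral>\<^sup>+x. nsq (f x) \<partial>M) * (\<integral>\<^sup>+x. nsq (g x) \<partial>M)"
proof (cases "integrable M (\<lambda>x. f x * g x)")
  case True
  have "nsq (LINT x|M. f x * g x) = (ennreal (cmod (LINT x|M. f x * g x)))\<^sup>2"
    by (simp add: ennreal_power)
  also have "\<dots> \<le> (\<integral>\<^sup>+x. ennreal (cmod (f x * g x)) \<partial>M)\<^sup>2"
    by (intro power_mono integral_norm_bound_ennreal True) auto
  also have "\<dots> = (\<integral>\<^sup>+x. ennreal (cmod (f x)) * ennreal (cmod (g x)) \<partial>M)\<^sup>2"
    by (simp add: norm_mult ennreal_mult)
  also have "\<dots> \<le> (\<integral>\<^sup>+x. (ennreal (cmod (f x)))\<^sup>2 \<partial>M) * (\<integral>\<^sup>+x. (ennreal (cmod (g x)))\<^sup>2 \<partial>M)"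
    by (intro Cauchy_Schwarz_nn_integral) auto
  finally show ?thesis by (simp add: ennreal_power)
qed (simp add: not_integrable_integral_eq)

text \<open>Norm convergence implies weak convergence, by Cauchy-Schwarz applied to the difference.
  This is how the multiplication formula passes to L2 limits.\<close>

lemma L2_tendsto_integral:
  assumes "L2_tendsto M u g" "\<And>j. u j \<in> L2 M" "g \<in> L2 M" "v \<in> L2 M"
  shows "(\<lambda>j. LINT x|M. u j x * v x) \<longlonglongrightarrow> (LINT x|M. g x * v x)"
proof -
  note [measurable] = L2_borel_measurable[OF assms(2)] L2_borel_measurable[OF assms(3)]
    L2_borel_measurable[OF assms(4)]
  let ?N = "\<integral>\<^sup>+x. nsq (v x) \<partial>M"
  have diff: "(LINT x|M. u j x * v x) - (LINT x|M. g x * v x) = (LINT x|M. (u j x - g x) * v x)" for j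
    using L2_mult_integrable[OF assms(2)[of j] assms(4)] L2_mult_integrable[OF assms(3,4)]
    by (subst Bochner_Integration.integral_diff[symmetric]) (auto simp: algebra_simps)
  have N: "?N < \<infinity>" using assms(4) by (simp add: L2_iff_nn_integral)
  have "(\<lambda>j. (\<integral>\<^sup>+x. nsq (u j x - g x) \<partial>M) * ?N) \<longlonglongrightarrow> 0 * ?N"
    using assms(1) N unfolding L2_tendsto_def
    by (intro tendsto_mult_ennreal tendsto_const) auto
  then have lim0: "(\<lambda>j. (\<integral>\<^sup>+x. nsq (u j x - g x) \<partial>M) * ?N) \<longlonglongrightarrow> 0" by simp
  have "(\<lambda>j. nsq (LINT x|M. (u j x - g x) * v x)) \<longlonglongrightarrow> 0"
    by (rule tendsto_sandwich[OF _ _ tendsto_const lim0])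
       (auto intro!: always_eventually norm_integral_mult_le)
  then have "(\<lambda>j. (cmod (LINT x|M. (u j x - g x) * v x))\<^sup>2) \<longlonglongrightarrow> 0"
    by (simp add: ennreal_0[symmetric] tendsto_ennreal_iff del: ennreal_0)
  then have "(\<lambda>j. sqrt ((cmod (LINT x|M. (u j x - g x) * v x))\<^sup>2)) \<longlonglongrightarrow> sqrt 0"
    by (rule tendsto_real_sqrt)
  then have "(\<lambda>j. (LINT x|M. u j x * v x) - (LINT x|M. g x * v x)) \<longlonglongrightarrow> 0"
    by (simp add: diff tendsto_norm_zero_iff)
  then show ?thesis by (rule LIM_zero_cancel)
qed

text \<open>Downward induction from K: each use of (a + b)^2 \<le> 2 a^2 + 2 b^2 doubles the tail,
  and the weight 2^j absorbs the doubling.\<close>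

lemma weighted_telescope_bound:
  fixes u :: "nat \<Rightarrow> complex"
  assumes "N \<le> K"
  shows "(cmod (u K - u N))\<^sup>2 \<le> 2 / 2 ^ N * (\<Sum>j=N..<K. 2 ^ j * (cmod (u (Suc j) - u j))\<^sup>2)"
  using assms
proof (induction rule: inc_induct)
  case base
  then show ?case by simp
next
  case (step n)
  let ?a = "cmod (u (Suc n) - u n)" and ?b = "cmod (u K - u (Suc n))"
  let ?S = "\<Sum>j=Suc n..<K. 2 ^ j * (cmod (u (Suc j) - u j))\<^sup>2"
  have "cmod (u K - u n) \<le> ?a + ?b"
    using norm_triangle_ineq[of "u (Suc n) - u n" "u K - u (Suc n)"] by simp
  then have "(cmod (u K - u n))\<^sup>2 \<le> (?a + ?b)\<^sup>2" by (intro power_mono) auto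
  also have "\<dots> \<le> 2 * ?a\<^sup>2 + 2 * ?b\<^sup>2"
    using sum_squares_bound[of ?a ?b] by (simp add: power2_sum)
  also have "\<dots> \<le> 2 * ?a\<^sup>2 + 2 * (2 / 2 ^ Suc n * ?S)"
    using step.IH by simp
  also have "\<dots> = 2 / 2 ^ n * (2 ^ n * ?a\<^sup>2 + ?S)"
    by (simp add: field_simps)
  also have "2 ^ n * ?a\<^sup>2 + ?S = (\<Sum>j=n..<K. 2 ^ j * (cmod (u (Suc j) - u j))\<^sup>2)"
    using step.hyps by (simp add: sum.atLeast_Suc_lessThan)
  finally show ?case .
qed

text \<open>The weights \<open>2 ^ j\<close> make the
  pointwise bound \<open>weighted_telescope_bound\<close> summable without Minkowski's inequality.\<close>

lemma rapid_Cauchy_L2_limit: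
  fixes u :: "nat \<Rightarrow> 'a \<Rightarrow> complex"
  assumes [measurable]: "\<And>j. u j \<in> borel_measurable M"
    and fin: "(\<Sum>j. \<integral>\<^sup>+x. ennreal (2 ^ j * (cmod (u (Suc j) x - u j x))\<^sup>2) \<partial>M) < \<infinity>"
  shows "L2_tendsto M u (\<lambda>x. lim (\<lambda>j. u j x))"
proof -
  define S where "S x = (\<Sum>j. ennreal (2 ^ j * (cmod (u (Suc j) x - u j x))\<^sup>2))" for x
  have S_meas[measurable]: "S \<in> borel_measurable M" unfolding S_def by measurable
  have intS: "(\<integral>\<^sup>+x. S x \<partial>M) < \<infinity>"
    unfolding S_def using fin by (subst nn_integral_suminf) auto
  then have aeS: "AE x in M. S x \<noteq> \<infinity>"
    by (intro nn_integral_PInf_AE) auto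
  \<comment> \<open>One null set serves all N: where the weighted sum S x is finite, its tails force
    pointwise convergence and also give the rate.\<close>
  have bound: "AE x in M. \<forall>N. nsq (u N x - lim (\<lambda>j. u j x)) \<le> ennreal (2 / 2 ^ N) * S x"
    using aeS
  proof eventually_elim
    case (elim x)
    have le: "nsq (u K x - u N x) \<le> ennreal (2 / 2 ^ N) * S x" if "N \<le> K" for N K
    proof -
      have "nsq (u K x - u N x)
          \<le> ennreal (2 / 2 ^ N * (\<Sum>j=N..<K. 2 ^ j * (cmod (u (Suc j) x - u j x))\<^sup>2))"
        using weighted_telescope_bound[OF that, of "\<lambda>j. u j x"] by (rule ennreal_leI)
      also have "\<dots> = ennreal (2 / 2 ^ N) * (\<Sum>j=N..<K. ennreal (2 ^ j * (cmod (u (Suc j) x - u j x))\<^sup>2))"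
        by (subst ennreal_mult) (auto intro!: sum_nonneg simp: sum_ennreal)
      also have "\<dots> \<le> ennreal (2 / 2 ^ N) * S x"
        unfolding S_def by (intro mult_left_mono sum_le_suminf) auto
      finally show ?thesis .
    qed
    obtain s where s: "S x = ennreal s" "0 \<le> s" using elim by (cases "S x") auto
    have le': "(cmod (u K x - u N x))\<^sup>2 \<le> 2 / 2 ^ N * s" if "N \<le> K" for N K
      using le[OF that] s by (simp add: ennreal_mult[symmetric])
    have "Cauchy (\<lambda>j. u j x)"
      unfolding Cauchy_altdef2
    proof (intro allI impI)
      fix e :: real assume e: "0 < e"
      have "(\<lambda>N. 2 * s * (1 / 2) ^ N) \<longlonglongrightarrow> 2 * s * 0"
        by (intro tendsto_intros LIMSEQ_power_zero) auto
      then have "\<forall>\<^sub>F N in sequentially. 2 * s * (1 / 2) ^ N < e\<^sup>2"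
        using e by (intro order_tendstoD(2)) auto
      then obtain N where N: "2 * s * (1 / 2) ^ N < e\<^sup>2" by (auto simp: eventually_sequentially)
      have "dist (u n x) (u N x) < e" if "N \<le> n" for n
      proof -
        have "(cmod (u n x - u N x))\<^sup>2 < e\<^sup>2"
          by (rule le_less_trans[OF le'[OF that]]) (use N in \<open>simp add: power_one_over\<close>)
        then show ?thesis using e by (simp add: dist_norm power2_less_imp_less)
      qed
      then show "\<exists>N. \<forall>n\<ge>N. dist (u n x) (u N x) < e" by blast
    qed
    then have lim: "(\<lambda>j. u j x) \<longlonglongrightarrow> lim (\<lambda>j. u j x)"
      by (simp add: Cauchy_convergent_iff convergent_LIMSEQ_iff)
    show ?case
    proof
      fix N
      \<comment> \<open>With N fixed, K tends to infinity in \<open>le'\<close>.\<close>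
      have "(\<lambda>K. (cmod (u K x - u N x))\<^sup>2) \<longlonglongrightarrow> (cmod (lim (\<lambda>j. u j x) - u N x))\<^sup>2"
        by (intro tendsto_intros lim)
      then have "(cmod (lim (\<lambda>j. u j x) - u N x))\<^sup>2 \<le> 2 / 2 ^ N * s"
        by (rule LIMSEQ_le_const2) (use le' in blast)
      then show "nsq (u N x - lim (\<lambda>j. u j x)) \<le> ennreal (2 / 2 ^ N) * S x"
        using s by (simp add: norm_minus_commute ennreal_mult[symmetric])
    qed
  qed
  have le: "(\<integral>\<^sup>+x. nsq (u N x - lim (\<lambda>j. u j x)) \<partial>M) \<le> ennreal (2 / 2 ^ N) * (\<integral>\<^sup>+x. S x \<partial>M)" for N
    using bound by (subst nn_integral_cmult[symmetric]) (auto intro!: nn_integral_mono_AE)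
  have "(\<lambda>N. 2 * (1/2) ^ N) \<longlonglongrightarrow> 2 * (0::real)"
    by (intro tendsto_intros LIMSEQ_power_zero) auto
  then have "(\<lambda>N. ennreal (2 / 2 ^ N)) \<longlonglongrightarrow> 0"
    by (simp add: power_one_over field_simps ennreal_0[symmetric] tendsto_ennreal_iff del: ennreal_0)
  then have "(\<lambda>N. ennreal (2 / 2 ^ N) * (\<integral>\<^sup>+x. S x \<partial>M)) \<longlonglongrightarrow> 0 * (\<integral>\<^sup>+x. S x \<partial>M)"
    using intS by (intro tendsto_mult_ennreal tendsto_const) auto
  then have lim0: "(\<lambda>N. ennreal (2 / 2 ^ N) * (\<integral>\<^sup>+x. S x \<partial>M)) \<longlonglongrightarrow> 0" by simp
  show ?thesis
    unfolding L2_tendsto_def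
    by (rule tendsto_sandwich[OF _ _ tendsto_const lim0]) (auto intro!: always_eventually le)
qed

text \<open>Once the distance to the limit is finite for some j, g is the difference of the L2
  functions u j and u j - g.\<close>

lemma L2_tendsto_L2:
  assumes "L2_tendsto M u g" "\<And>j. u j \<in> L2 M" and [measurable]: "g \<in> borel_measurable M"
  shows "g \<in> L2 M"
proof -
  note [measurable] = L2_borel_measurable[OF assms(2)]
  have "\<forall>\<^sub>F j in sequentially. (\<integral>\<^sup>+x. nsq (u j x - g x) \<partial>M) < \<infinity>"
    using assms(1) unfolding L2_tendsto_def by (intro order_tendstoD(2)) auto
  then obtain j where "(\<integral>\<^sup>+x. nsq (u j x - g x) \<partial>M) < \<infinity>"
    by (auto simp: eventually_sequentially)
  then have "(\<lambda>x. u j x - g x) \<in> L2 M" by (simp add: L2_iff_nn_integral)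
  from L2_diff[OF assms(2)[of j] this] show ?thesis by simp
qed

section \<open>Lebesgue integrals on \<open>\<real>\<^sup>n\<close>\<close>

text \<open>Lebesgue measure on \<open>real^'n\<close> is the image of the product measure indexed
  by \<open>Basis\<close>, so everything follows from the product formulas once the factors are
  indexed by basis vectors instead of coordinates.\<close>

lemma
  fixes f :: "'n::finite \<Rightarrow> real \<Rightarrow> 'a :: {real_normed_field, banach, second_countable_topology}"
  assumes f: "\<And>j. integrable lborel (f j)"
  shows integrable_lborel_vec_prod: "integrable lborel (\<lambda>x :: real^'n. \<Prod>j\<in>UNIV. f j (x $ j))"
    and integral_lborel_vec_prod:
      "(LINT x|lborel. (\<Prod>j\<in>UNIV. f j ((x :: real^'n) $ j))) = (\<Prod>j\<in>UNIV. LINT s|lborel. f j s)"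
proof -
  define ax where "ax j = (axis j 1 :: real^'n)" for j
  \<comment> \<open>\<open>ax\<close> is a bijection from the coordinates onto the basis; F carries
    the factor of a coordinate to its basis vector.\<close>
  define F where "F b = f (inv ax b)" for b
  have inj: "inj ax" by (auto simp: ax_def inj_def axis_eq_axis)
  have Basis: "Basis = range ax" by (auto simp: ax_def Basis_vec_def)
  have F_ax[simp]: "F (ax j) = f j" for j using inj by (simp add: F_def)
  have FI: "integrable lborel (F b)" for b unfolding F_def by (rule f)
  interpret product_sigma_finite "\<lambda>b :: real^'n. lborel :: real measure" ..
  have prod_eq: "(\<Prod>j\<in>UNIV. f j (x $ j)) = (\<Prod>b\<in>Basis. F b (x \<bullet> b))" for x :: "real^'n"
    unfolding Basis by (subst prod.reindex[OF inj]) (simp add: ax_def inner_axis F_ax[unfolded ax_def])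
  have sum_inner: "(\<Sum>b'\<in>Basis. g b' *\<^sub>R b') \<bullet> b = g b" if "b \<in> Basis" for g :: "real^'n \<Rightarrow> real" and b
    using that by simp
  have meas[measurable]: "(\<lambda>x :: real^'n. \<Prod>b\<in>Basis. F b (x \<bullet> b)) \<in> borel_measurable borel"
  proof -
    have [measurable]: "F b \<in> borel_measurable borel" for b
      using borel_measurable_integrable[OF FI[of b]] by simp
    show ?thesis by measurable
  qed
  have T[measurable]: "(\<lambda>g. \<Sum>b\<in>Basis. g b *\<^sub>R b) \<in> (\<Pi>\<^sub>M b\<in>(Basis::(real^'n) set). lborel) \<rightarrow>\<^sub>M borel"
    by measurable
  have "integrable (\<Pi>\<^sub>M b\<in>(Basis::(real^'n) set). lborel) (\<lambda>g. \<Prod>b\<in>Basis. F b (g b))"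
    by (intro product_integrable_prod FI finite_Basis)
  then show "integrable lborel (\<lambda>x :: real^'n. \<Prod>j\<in>UNIV. f j (x $ j))"
    unfolding prod_eq
    by (subst lborel_eq) (simp add: integrable_distr_eq sum_inner cong: prod.cong)
  have "(LINT x|lborel. (\<Prod>j\<in>UNIV. f j ((x :: real^'n) $ j)))
      = (LINT g|(\<Pi>\<^sub>M b\<in>(Basis::(real^'n) set). lborel). (\<Prod>b\<in>Basis. F b (g b)))"
    unfolding prod_eq by (subst lborel_eq) (simp add: integral_distr sum_inner cong: prod.cong)
  also have "\<dots> = (\<Prod>b\<in>(Basis::(real^'n) set). (LINT s|lborel. F b s))"
    by (intro product_integral_prod FI finite_Basis)
  also have "\<dots> = (\<Prod>j\<in>UNIV. (LINT s|lborel. f j s))"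
    unfolding Basis by (subst prod.reindex[OF inj]) simp
  finally show "(LINT x|lborel. (\<Prod>j\<in>UNIV. f j ((x :: real^'n) $ j))) = (\<Prod>j\<in>UNIV. LINT s|lborel. f j s)" .
qed

section \<open>Affine changes of variables\<close>

lemma nn_integral_lborel_affine:
  fixes t :: "'a::euclidean_space"
  assumes [measurable]: "f \<in> borel_measurable borel" and c: "c \<noteq> 0"
  shows "(\<integral>\<^sup>+x. f x \<partial>lborel) = ennreal (\<bar>c\<bar> ^ DIM('a)) * (\<integral>\<^sup>+x. f (t + c *\<^sub>R x) \<partial>lborel)"
  by (subst lborel_affine[OF c, of t])
     (simp add: nn_integral_density nn_integral_distr nn_integral_cmult)

lemma lborel_integrable_affine:
  fixes f :: "'a::euclidean_space \<Rightarrow> 'b :: {banach, second_countable_topology}"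
  assumes f: "integrable lborel f" and c: "c \<noteq> 0"
  shows "integrable lborel (\<lambda>x. f (t + c *\<^sub>R x))"
proof -
  note [measurable] = borel_measurable_integrable[OF f]
  have "(\<integral>\<^sup>+x. ennreal (norm (f x)) \<partial>lborel) < \<infinity>"
    using f by (simp add: integrable_iff_bounded)
  then have "(\<integral>\<^sup>+x. ennreal (norm (f (t + c *\<^sub>R x))) \<partial>lborel) < \<infinity>"
    using c by (subst (asm) nn_integral_lborel_affine[OF _ c, of _ t]) (auto simp: ennreal_mult_less_top)
  moreover have "(\<lambda>x. f (t + c *\<^sub>R x)) \<in> borel_measurable lborel" by measurable
  ultimately show ?thesis by (simp add: integrable_iff_bounded)
qed

lemma lborel_integrable_affine_iff:
  fixes f :: "'a::euclidean_space \<Rightarrow> 'b :: {banach, second_countable_topology}"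
  assumes c: "c \<noteq> 0"
  shows "integrable lborel (\<lambda>x. f (t + c *\<^sub>R x)) \<longleftrightarrow> integrable lborel f"
proof
  assume "integrable lborel (\<lambda>x. f (t + c *\<^sub>R x))"
  from lborel_integrable_affine[OF this, of "1 / c" "- (1 / c) *\<^sub>R t"] c
  show "integrable lborel f" by (simp add: algebra_simps)
qed (rule lborel_integrable_affine[OF _ c])

lemma lborel_integral_affine:
  fixes f :: "'a::euclidean_space \<Rightarrow> 'b :: {banach, second_countable_topology}"
  assumes c: "c \<noteq> 0"
  shows "(LINT x|lborel. f x) = \<bar>c\<bar> ^ DIM('a) *\<^sub>R (LINT x|lborel. f (t + c *\<^sub>R x))"
proof (cases "integrable lborel f")
  case True
  note [measurable] = borel_measurable_integrable[OF True]
  have "integrable lborel (\<lambda>x. f (t + c *\<^sub>R x))" by (rule lborel_integrable_affine[OF True c])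
  then show ?thesis
    by (subst lborel_affine[OF c, of t]) (simp add: integral_density integral_distr)
next
  case False
  then show ?thesis
    by (simp add: lborel_integrable_affine_iff[OF c] not_integrable_integral_eq)
qed

lemma lborel_integral_reflect:
  fixes f :: "'a::euclidean_space \<Rightarrow> 'b :: {banach, second_countable_topology}"
  shows "(LINT x|lborel. f (t - x)) = (LINT x|lborel. f x)"
  using lborel_integral_affine[of "-1" f t] by simp

lemma lborel_integral_translate:
  fixes f :: "'a::euclidean_space \<Rightarrow> 'b :: {banach, second_countable_topology}"
  shows "(LINT x|lborel. f (t + x)) = (LINT x|lborel. f x)"
  using lborel_integral_affine[of 1 f t] by simp

lemma integrable_mult_fst_snd:
  fixes f :: "'a \<Rightarrow> 'c :: {real_normed_field, banach, second_countable_topology}"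
  assumes "sigma_finite_measure M" "sigma_finite_measure N"
  assumes f: "integrable M f" and g: "integrable N g"
  shows "integrable (M \<Otimes>\<^sub>M N) (\<lambda>(x, y). f x * g y)"
proof -
  interpret pair_sigma_finite M N using assms by (intro pair_sigma_finite.intro)
  note [measurable] = borel_measurable_integrable[OF f] borel_measurable_integrable[OF g]
  show ?thesis
    by (rule Fubini_integrable) (auto simp: norm_mult f g)
qed

section \<open>Gaussian integrals\<close>

text \<open>For e = 1 the value is the characteristic function of the standard normal distribution;
  the dilation by sqrt e gives the general case.\<close>

lemma
  fixes x e :: real
  assumes e: "0 < e"
  shows integrable_gaussian_real: "integrable lborel (\<lambda>s. complex_of_real (exp (- (e * s\<^sup>2 / 2))) * osc (s * x))"
    and integral_gaussian_real: "(LINT s|lborel. complex_of_real (exp (- (e * s\<^sup>2 / 2))) * osc (s * x))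
      = complex_of_real (sqrt (2 * pi / e) * exp (- (x\<^sup>2 / (2 * e))))"
proof -
  let ?g = "\<lambda>t s. complex_of_real (exp (- (s\<^sup>2 / 2))) * osc (s * t)"
  have std: "integrable lborel (\<lambda>s :: real. exp (- (s\<^sup>2 / 2)))"
  proof -
    have "integrable lborel (\<lambda>s. sqrt (2 * pi) * std_normal_density s)"
      by (intro integrable_mult_right integrable_normal_density) auto
    then show ?thesis by (simp add: std_normal_density_def)
  qed
  have int1: "integrable lborel (?g t)" for t
    by (rule Bochner_Integration.integrable_bound[OF std]) (auto simp: norm_mult)
  have val1: "(LINT s|lborel. ?g t s) = complex_of_real (sqrt (2 * pi) * exp (- (t\<^sup>2 / 2)))" for t
  proof -
    have "complex_of_real (exp (- (t\<^sup>2 / 2))) = char std_normal_distribution (- t)"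
      by (simp add: char_std_normal_distribution)
    also have "\<dots> = (LINT s|lborel. std_normal_density s *\<^sub>R exp (\<i> * complex_of_real (- t * s)))"
      unfolding char_def by (subst integral_density) auto
    also have "\<dots> = (LINT s|lborel. complex_of_real (1 / sqrt (2 * pi)) * ?g t s)"
      by (intro Bochner_Integration.integral_cong) (auto simp: std_normal_density_def scaleR_conv_of_real mult_ac)
    also have "\<dots> = complex_of_real (1 / sqrt (2 * pi)) * (LINT s|lborel. ?g t s)" by simp
    finally show ?thesis by (simp add: field_simps)
  qed
  let ?h = "\<lambda>s. complex_of_real (exp (- (e * s\<^sup>2 / 2))) * osc (s * x)"
  have h_eq: "?h s = ?g (x / sqrt e) (0 + sqrt e * s)" for s
    using e by (simp add: power_mult_distrib)
  have se: "sqrt e \<noteq> 0" using e by simp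
  show "integrable lborel ?h"
    unfolding h_eq by (rule lborel_integrable_real_affine[OF int1 se])
  have "(LINT s|lborel. ?g (x / sqrt e) s) = sqrt e *\<^sub>R (LINT s|lborel. ?h s)"
    using lborel_integral_real_affine[OF se, of "?g (x / sqrt e)" 0] e unfolding h_eq by simp
  then have "(LINT s|lborel. ?h s) = complex_of_real (sqrt (2 * pi) / sqrt e * exp (- ((x / sqrt e)\<^sup>2 / 2)))"
    using e unfolding val1 by (simp add: scaleR_conv_of_real field_simps)
  then show "(LINT s|lborel. ?h s) = complex_of_real (sqrt (2 * pi / e) * exp (- (x\<^sup>2 / (2 * e))))"
    using e by (simp add: real_sqrt_divide power_divide mult.commute)
qed

lemma norm_vec_sq: "(norm (x :: real^'n))\<^sup>2 = (\<Sum>j\<in>UNIV. (x $ j)\<^sup>2)"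
  unfolding norm_vec_def L2_set_def by (simp add: sum_nonneg)

lemma
  fixes x :: "real^'n" and e :: real
  assumes e: "0 < e"
  shows integrable_gaussian: "integrable lborel (\<lambda>s :: real^'n. complex_of_real (exp (- (e * (norm s)\<^sup>2 / 2))) * osc (x \<bullet> s))"
    and integral_gaussian: "(LINT s|lborel. complex_of_real (exp (- (e * (norm (s :: real^'n))\<^sup>2 / 2))) * osc (x \<bullet> s))
      = complex_of_real (sqrt (2 * pi / e) ^ CARD('n) * exp (- ((norm x)\<^sup>2 / (2 * e))))"
proof -
  let ?g = "\<lambda>j s. complex_of_real (exp (- (e * s\<^sup>2 / 2))) * osc (s * (x $ j))"
  have eq: "complex_of_real (exp (- (e * (norm s)\<^sup>2 / 2))) * osc (x \<bullet> s)
      = (\<Prod>j\<in>UNIV. ?g j (s $ j))" for s :: "real^'n"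
  proof -
    have "- (e * (norm s)\<^sup>2 / 2) = (\<Sum>j\<in>UNIV. - (e * (s $ j)\<^sup>2 / 2))"
      by (simp add: norm_vec_sq sum_negf sum_distrib_left sum_divide_distrib)
    moreover have "- \<i> * complex_of_real (x \<bullet> s) = (\<Sum>j\<in>UNIV. - \<i> * complex_of_real ((s $ j) * (x $ j)))"
      by (simp add: inner_vec_def sum_distrib_left sum_negf mult.commute)
    ultimately show ?thesis by (simp only: exp_sum finite of_real_prod prod.distrib)
  qed
  show "integrable lborel (\<lambda>s :: real^'n. complex_of_real (exp (- (e * (norm s)\<^sup>2 / 2))) * osc (x \<bullet> s))"
    unfolding eq by (intro integrable_lborel_vec_prod integrable_gaussian_real e)
  have "(\<Prod>j\<in>UNIV. exp (- ((x $ j)\<^sup>2 / (2 * e)))) = exp (- ((norm x)\<^sup>2 / (2 * e)))"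
    by (simp add: norm_vec_sq exp_sum[symmetric] sum_negf sum_divide_distrib)
  then show "(LINT s|lborel. complex_of_real (exp (- (e * (norm (s :: real^'n))\<^sup>2 / 2))) * osc (x \<bullet> s))
      = complex_of_real (sqrt (2 * pi / e) ^ CARD('n) * exp (- ((norm x)\<^sup>2 / (2 * e))))"
    unfolding eq
    by (subst integral_lborel_vec_prod)
       (simp_all only: integrable_gaussian_real[OF e] integral_gaussian_real[OF e] of_real_prod[symmetric]
          prod.distrib prod_constant)
qed

lemma
  fixes e :: real
  assumes e: "0 < e"
  shows integrable_gaussian_norm: "integrable lborel (\<lambda>s :: real^'n. exp (- (e * (norm s)\<^sup>2 / 2)))"
    and integral_gaussian_norm: "(LINT s|lborel. exp (- (e * (norm (s :: real^'n))\<^sup>2 / 2))) = sqrt (2 * pi / e) ^ CARD('n)"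
proof -
  have "integrable lborel (\<lambda>s :: real^'n. complex_of_real (exp (- (e * (norm s)\<^sup>2 / 2))))"
    using integrable_gaussian[OF e, where x="0::real^'n"] by simp
  then show int: "integrable lborel (\<lambda>s :: real^'n. exp (- (e * (norm s)\<^sup>2 / 2)))"
    by (rule complex_of_real_integrable_eq[THEN iffD1])
  have "complex_of_real (LINT s|lborel. exp (- (e * (norm (s :: real^'n))\<^sup>2 / 2))) = complex_of_real (sqrt (2 * pi / e) ^ CARD('n))"
    using integral_gaussian[OF e, where x="0::real^'n"] by simp
  then show "(LINT s|lborel. exp (- (e * (norm (s :: real^'n))\<^sup>2 / 2))) = sqrt (2 * pi / e) ^ CARD('n)"
    using of_real_eq_iff by blast
qed

text \<open>Splitting the rate over the coordinates reduces to dimension one, where the quadratic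
  Taylor bound for exp gives a multiple of 1 / (1 + s^2) as majorant.\<close>

lemma integrable_exp_norm:
  fixes c :: real
  assumes c: "0 < c"
  shows "integrable lborel (\<lambda>s :: real^'n. exp (- c * norm s))"
proof -
  have one: "integrable lborel (\<lambda>s :: real. exp (- a * \<bar>s\<bar>))" if a: "0 < a" for a :: real
  proof -
    \<comment> \<open>Chosen so that m (1 + s^2) \<le> 1 + a^2 s^2 / 2, which the quadratic Taylor
      polynomial of exp (a |s|) dominates.\<close>
    define m where "m = min 1 (a\<^sup>2 / 2)"
    have m: "0 < m" "m \<le> 1" "m \<le> a\<^sup>2 / 2" using a by (auto simp: m_def)
    have "integrable lborel (\<lambda>s :: real. inverse (1 + s\<^sup>2))"
      using integrable_inverse_1_plus_square
      by (simp add: set_integrable_def einterval_def)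
    then have "integrable lborel (\<lambda>s :: real. (1 / m) * inverse (1 + s\<^sup>2))" by simp
    then show ?thesis
    proof (rule Bochner_Integration.integrable_bound)
      show "AE s in lborel. norm (exp (- a * \<bar>s\<bar>)) \<le> norm (1 / m * inverse (1 + s\<^sup>2))"
      proof (rule AE_I2)
        fix s :: real
        have "m * (1 + s\<^sup>2) \<le> 1 + a\<^sup>2 / 2 * s\<^sup>2"
          using m mult_right_mono[OF m(3), of "s\<^sup>2"] by (simp add: algebra_simps)
        also have "\<dots> \<le> 1 + a * \<bar>s\<bar> + (a * \<bar>s\<bar>)\<^sup>2 / 2"
          using a by (simp add: power_mult_distrib)
        also have "\<dots> \<le> exp (a * \<bar>s\<bar>)"
          using a by (intro exp_lower_Taylor_quadratic) auto
        finally have "m * (1 + s\<^sup>2) \<le> exp (a * \<bar>s\<bar>)" .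
        moreover have "0 < m * (1 + s\<^sup>2)" using m by (simp add: add_pos_nonneg)
        ultimately have "inverse (exp (a * \<bar>s\<bar>)) \<le> inverse (m * (1 + s\<^sup>2))"
          by (intro le_imp_inverse_le) auto
        then show "norm (exp (- a * \<bar>s\<bar>)) \<le> norm (1 / m * inverse (1 + s\<^sup>2))"
          using m by (simp add: exp_minus inverse_eq_divide add_nonneg_nonneg)
      qed
    qed auto
  qed
  \<comment> \<open>Every |s_j| is at most the norm of s, so a share c / n of the rate for each
    coordinate makes the product an upper bound.\<close>
  let ?a = "c / CARD('n)"
  have "integrable lborel (\<lambda>s :: real^'n. \<Prod>j\<in>UNIV. exp (- ?a * \<bar>s $ j\<bar>))"
    by (intro integrable_lborel_vec_prod one) (use c in auto)
  then show ?thesis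
  proof (rule Bochner_Integration.integrable_bound)
    show "AE s in lborel. norm (exp (- c * norm s)) \<le> norm (\<Prod>j\<in>UNIV. exp (- ?a * \<bar>(s :: real^'n) $ j\<bar>))"
    proof (rule AE_I2)
      fix s :: "real^'n"
      have "?a * (\<Sum>j\<in>UNIV. \<bar>s $ j\<bar>) \<le> ?a * (\<Sum>j\<in>(UNIV :: 'n set). norm s)"
        using c by (intro mult_left_mono sum_mono component_le_norm_cart) auto
      also have "\<dots> = c * norm s" by simp
      finally have "exp (- c * norm s) \<le> exp (\<Sum>j\<in>UNIV. - ?a * \<bar>s $ j\<bar>)"
        by (simp add: sum_distrib_left sum_negf)
      then show "norm (exp (- c * norm s)) \<le> norm (\<Prod>j\<in>UNIV. exp (- ?a * \<bar>s $ j\<bar>))"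
        by (simp add: exp_sum abs_prod)
    qed
  qed auto
qed

section \<open>Uniqueness of the Fourier transform\<close>

lemma integrable_mult_norm_le_1:
  fixes f u :: "'a \<Rightarrow> complex"
  assumes "integrable M f" and [measurable]: "u \<in> borel_measurable M" and "\<And>x. cmod (u x) \<le> 1"
  shows "integrable M (\<lambda>x. f x * u x)"
proof (rule Bochner_Integration.integrable_bound[OF assms(1)])
  note [measurable] = borel_measurable_integrable[OF assms(1)]
  show "(\<lambda>x. f x * u x) \<in> borel_measurable M" by measurable
  show "AE x in M. norm (f x * u x) \<le> norm (f x)"
    using assms(3) by (auto simp: norm_mult intro!: AE_I2 mult_left_le)
qed

text \<open>A Gaussian centred at a is a superposition of the characters of x - a with Gaussian
  weight, so Fubini reduces the integral to the vanishing Fourier integrals of f.\<close>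

lemma integral_mult_gaussian_eq_0:
  fixes f :: "real^'n \<Rightarrow> complex"
  assumes f: "integrable lborel f"
    and zero: "\<And>\<eta>. (LINT x|lborel. f x * osc (\<eta> \<bullet> x)) = 0"
    and e: "0 < e"
  shows "(LINT x|lborel. f x * complex_of_real (exp (- ((norm (x - a))\<^sup>2 / (2 * e))))) = 0"
proof -
  note [measurable] = borel_measurable_integrable[OF f]
  let ?g = "\<lambda>s :: real^'n. complex_of_real (exp (- (e * (norm s)\<^sup>2 / 2)))"
  let ?K = "complex_of_real (sqrt (2 * pi / e) ^ CARD('n))"
  have g: "integrable lborel ?g"
    using integrable_gaussian_norm[OF e] by (subst complex_of_real_integrable_eq)
  have "integrable (lborel \<Otimes>\<^sub>M lborel) (\<lambda>(x, s). f x * ?g s)"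
    by (intro integrable_mult_fst_snd f g sigma_finite_lborel)
  then have "integrable (lborel \<Otimes>\<^sub>M lborel) (\<lambda>p. (case p of (x, s) \<Rightarrow> f x * ?g s) *
      (case p of (x, s) \<Rightarrow> osc ((x - a) \<bullet> s)))"
    by (rule integrable_mult_norm_le_1) (auto simp: split_beta)
  then have int: "integrable (lborel \<Otimes>\<^sub>M lborel)
      (\<lambda>(x, s). f x * (?g s * osc ((x - a) \<bullet> s)))"
    by (simp add: case_prod_unfold mult.assoc)
  have "(LINT x|lborel. f x * complex_of_real (exp (- ((norm (x - a))\<^sup>2 / (2 * e))))) * ?K
      = (LINT x|lborel. f x * (LINT s|lborel. ?g s * osc ((x - a) \<bullet> s)))"
    unfolding integral_gaussian[OF e] integral_mult_left_zero[symmetric]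
    by (simp add: mult_ac)
  also have "\<dots> = (LINT x|lborel. (LINT s|lborel. f x * (?g s * osc ((x - a) \<bullet> s))))"
    by simp
  also have "\<dots> = (LINT s|lborel. (LINT x|lborel. f x * (?g s * osc ((x - a) \<bullet> s))))"
    using int by (rule lborel_pair.Fubini_integral[symmetric])
  also have "\<dots> = (LINT s|lborel. (LINT x|lborel. ?g s * exp (\<i> * complex_of_real (a \<bullet> s)) * (f x * osc (s \<bullet> x))))"
  proof (intro Bochner_Integration.integral_cong refl)
    fix s x :: "real^'n"
    have "osc ((x - a) \<bullet> s) = exp (\<i> * complex_of_real (a \<bullet> s)) * osc (s \<bullet> x)"
      by (simp add: exp_add[symmetric] inner_diff_left inner_commute algebra_simps)
    then show "f x * (?g s * osc ((x - a) \<bullet> s))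
        = ?g s * exp (\<i> * complex_of_real (a \<bullet> s)) * (f x * osc (s \<bullet> x))"
      by (simp add: mult_ac)
  qed
  also have "\<dots> = 0" by (simp only: integral_mult_right_zero zero) simp
  finally show ?thesis using e by simp
qed

text \<open>Boxes form an intersection-stable generator of the Borel sets. The total integral
  handles complements, so the Dynkin argument makes the integral over every Borel set
  vanish.\<close>

lemma AE_eq_0_if_integral_box_eq_0:
  fixes f :: "'a::euclidean_space \<Rightarrow> complex"
  assumes f: "integrable lborel f" and univ: "(LINT x|lborel. f x) = 0"
    and box: "\<And>p q. (LINT x|lborel. indicator (box p q) x *\<^sub>R f x) = 0"
  shows "AE x in lborel. f x = 0"
proof (rule sigma_finite_measure.density_zero[OF sigma_finite_lborel f])
  fix A :: "'a set" assume A: "A \<in> sets lborel"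
  let ?G = "range (\<lambda>(a, b). box a b :: 'a set)"
  have sets: "sets borel = sigma_sets UNIV ?G" by (simp add: borel_eq_box)
  have stable: "Int_stable ?G" by (auto simp: Int_stable_def box_Int_box)
  have int: "set_integrable lborel B f" if "B \<in> sets borel" for B
    unfolding set_integrable_def using that f by (intro integrable_mult_indicator) auto
  have "A \<in> sigma_sets UNIV ?G" using A sets by simp
  have "?G \<subseteq> Pow UNIV" by simp
  from stable this \<open>A \<in> sigma_sets UNIV ?G\<close> show "set_lebesgue_integral lborel A f = 0"
  proof (induction rule: sigma_sets_induct_disjoint)
    case (basic A)
    then show ?case using box by (auto simp: set_lebesgue_integral_def)
  next
    case empty
    show ?case by (simp add: set_lebesgue_integral_def)
  next
    case (compl A)
    have "A \<in> sets borel" using compl sets by simp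
    have "set_lebesgue_integral lborel (UNIV - A) f
        = set_lebesgue_integral lborel (UNIV - A) f + set_lebesgue_integral lborel A f"
      using compl by simp
    also have "\<dots> = set_lebesgue_integral lborel ((UNIV - A) \<union> A) f"
      using \<open>A \<in> sets borel\<close> by (intro set_integral_Un[symmetric] int) auto
    also have "\<dots> = 0" using univ by (simp add: set_lebesgue_integral_def)
    finally show ?case .
  next
    case (union A)
    have "A i \<in> sets borel" for i using union(2) sets by auto
    moreover have "A i \<inter> A j = {}" if "i \<noteq> j" for i j
      using union(1) that by (auto simp: disjoint_family_on_def)
    ultimately have "set_lebesgue_integral lborel (\<Union>i. A i) f = (\<Sum>i. set_lebesgue_integral lborel (A i) f)"
      by (intro lebesgue_integral_countable_add int) auto
    then show ?case using union(3) by simp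
  qed
qed

text \<open>The functions \<open>x \<mapsto> \<integral>\<^bsub>B\<^esub> exp (- |x - a|\<^sup>2 / (2 s\<^sup>2)) da\<close>, suitably normalized, tend to the indicator of
  the box \<open>B\<close> off its boundary as \<open>s \<rightarrow> 0\<close>, which reduces uniqueness to integrals over boxes.\<close>

theorem integrable_fourier_unique:
  fixes f :: "real^'n \<Rightarrow> complex"
  assumes f: "integrable lborel f"
    and zero: "\<And>\<eta>. (LINT x|lborel. f x * osc (\<eta> \<bullet> x)) = 0"
  shows "AE x in lborel. f x = 0"
proof (rule AE_eq_0_if_integral_box_eq_0[OF f])
  show "(LINT x|lborel. f x) = 0" using zero[of 0] by simp
next
  fix p q :: "real^'n"
  note [measurable] = borel_measurable_integrable[OF f]
  let ?B = "box p q"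
  let ?G = "\<lambda>z :: real^'n. exp (- ((norm z)\<^sup>2 / 2))"
  let ?g = "\<lambda>s x a :: real^'n. exp (- ((norm (x - a))\<^sup>2 / (2 * s\<^sup>2)))"
  \<comment> \<open>Up to the factor K this is the box indicator smoothed at scale s, written with a
    = x + s z so that the Gaussian is independent of s and can dominate the limit.\<close>
  define \<phi> where "\<phi> s x = (LINT z|lborel. indicator ?B (x + s *\<^sub>R z) * ?G z)" for s :: real and x :: "real^'n"
  define K where "K = (LINT z|lborel. ?G z)"
  have G: "integrable lborel ?G" using integrable_gaussian_norm[of 1] by simp
  have K: "K > 0" unfolding K_def using integral_gaussian_norm[of 1, where 'n='n] by simp
  have [measurable]: "?B \<in> sets borel" by simp
  have \<phi>_meas[measurable]: "\<phi> s \<in> borel_measurable lborel" for s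
    unfolding \<phi>_def by measurable
  have \<phi>_int: "integrable lborel (\<lambda>z. indicator ?B (x + s *\<^sub>R z) * ?G z)" for x s
    by (rule Bochner_Integration.integrable_bound[OF G]) (auto simp: indicator_def)
  have \<phi>_le: "\<bar>\<phi> s x\<bar> \<le> K" for s x
  proof -
    have "0 \<le> \<phi> s x" unfolding \<phi>_def by (intro integral_nonneg_AE) auto
    moreover have "\<phi> s x \<le> K" unfolding \<phi>_def K_def
      by (intro integral_mono \<phi>_int G) (auto simp: indicator_def)
    ultimately show ?thesis by simp
  qed
  have \<phi>_zero: "(LINT x|lborel. f x * complex_of_real (\<phi> s x)) = 0" if s: "s > 0" for s
  proof -
    have \<phi>_eq: "s ^ CARD('n) * \<phi> s x = (LINT a|lborel. indicator ?B a * ?g s x a)" for x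
      using s unfolding \<phi>_def
      by (subst (2) lborel_integral_affine[of s _ x])
         (auto simp: power_mult_distrib norm_minus_commute)
    have B: "integrable lborel (\<lambda>a. complex_of_real (indicator ?B a))"
      by (subst complex_of_real_integrable_eq) (auto intro!: integrable_real_indicator emeasure_bounded_finite)
    have "integrable (lborel \<Otimes>\<^sub>M lborel) (\<lambda>(x, a). f x * complex_of_real (indicator ?B a))"
      by (intro integrable_mult_fst_snd f B sigma_finite_lborel)
    then have "integrable (lborel \<Otimes>\<^sub>M lborel) (\<lambda>p. (case p of (x, a) \<Rightarrow> f x * complex_of_real (indicator ?B a)) *
        (case p of (x, a) \<Rightarrow> complex_of_real (?g s x a)))"
      by (rule integrable_mult_norm_le_1) (auto simp: split_beta)
    then have int: "integrable (lborel \<Otimes>\<^sub>M lborel) (\<lambda>(x, a). f x *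
        complex_of_real (indicator ?B a * ?g s x a))"
      by (simp add: case_prod_unfold mult.assoc)
    have "complex_of_real (s ^ CARD('n)) * (LINT x|lborel. f x * complex_of_real (\<phi> s x))
        = (LINT x|lborel. f x * complex_of_real (s ^ CARD('n) * \<phi> s x))"
      by (subst integral_mult_right_zero[symmetric]) (simp add: mult_ac)
    also have "\<dots> = (LINT x|lborel. (LINT a|lborel. f x * complex_of_real (indicator ?B a * ?g s x a)))"
      unfolding \<phi>_eq by (simp only: integral_mult_right_zero integral_complex_of_real)
    also have "\<dots> = (LINT a|lborel. (LINT x|lborel. f x * complex_of_real (indicator ?B a * ?g s x a)))"
      using int by (rule lborel_pair.Fubini_integral[symmetric])
    also have "\<dots> = (LINT a|lborel. complex_of_real (indicator ?B a) * (LINT x|lborel. f x * complex_of_real (?g s x a)))"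
      by (subst integral_mult_right_zero[symmetric]) (simp add: mult_ac)
    also have "\<dots> = 0"
      using integral_mult_gaussian_eq_0[OF f zero, of "s\<^sup>2"] s by simp
    finally show ?thesis using s by simp
  qed
  define s where "s k = 1 / real (Suc k)" for k
  have s: "s k > 0" for k by (simp add: s_def)
  have s_lim: "s \<longlonglongrightarrow> 0" unfolding s_def by (rule LIMSEQ_Suc[OF lim_1_over_n, unfolded])
  \<comment> \<open>The faces lie in finitely many null hyperplanes. Off these hyperplanes x lies
    either in the open box or outside the closed one, so the indicator is constant near x.\<close>
  have off: "AE x in lborel. \<forall>b\<in>Basis. x \<bullet> b \<noteq> p \<bullet> b \<and> x \<bullet> b \<noteq> q \<bullet> b"
    by (subst AE_finite_all) (auto intro!: AE_lborel_inner_neq AE_conjI)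
  have lim: "(\<lambda>k. \<phi> (s k) x) \<longlonglongrightarrow> indicator ?B x * K"
    if x: "\<forall>b\<in>Basis. x \<bullet> b \<noteq> p \<bullet> b \<and> x \<bullet> b \<noteq> q \<bullet> b" for x
  proof -
    have ind: "(\<lambda>k. indicator ?B (x + s k *\<^sub>R z) * ?G z) \<longlonglongrightarrow> indicator ?B x * ?G z" for z
    proof -
      have xz: "(\<lambda>k. x + s k *\<^sub>R z) \<longlonglongrightarrow> x + 0 *\<^sub>R z" by (intro tendsto_intros s_lim)
      have "\<forall>\<^sub>F k in sequentially. indicator ?B (x + s k *\<^sub>R z) = (indicator ?B x :: real)"
      proof (cases "x \<in> ?B")
        case True
        then have "\<forall>\<^sub>F k in sequentially. x + s k *\<^sub>R z \<in> ?B"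
          using xz by (intro topological_tendstoD[OF xz]) auto
        then show ?thesis by eventually_elim (use True in auto)
      next
        case False
        then have "x \<in> - cbox p q" using x by (force simp: mem_box)
        then have "\<forall>\<^sub>F k in sequentially. x + s k *\<^sub>R z \<in> - cbox p q"
          using xz by (intro topological_tendstoD[OF xz]) (auto simp: closed_cbox)
        then show ?thesis
          by eventually_elim (use False box_subset_cbox[of p q] in \<open>auto simp: indicator_def\<close>)
      qed
      then have "(\<lambda>k. indicator ?B (x + s k *\<^sub>R z)) \<longlonglongrightarrow> (indicator ?B x :: real)"
        by (rule tendsto_eventually)
      then show ?thesis by (intro tendsto_intros)
    qed
    have "(\<lambda>k. LINT z|lborel. indicator ?B (x + s k *\<^sub>R z) * ?G z) \<longlonglongrightarrow> (LINT z|lborel. indicator ?B x * ?G z)"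
    proof (rule integral_dominated_convergence[where w="?G"])
      show "AE z in lborel. norm (indicator ?B (x + s k *\<^sub>R z) * ?G z) \<le> ?G z" for k
        by (auto simp: indicator_def)
    qed (use G ind in \<open>auto intro!: AE_I2\<close>)
    then show ?thesis by (simp add: \<phi>_def K_def)
  qed
  have "(\<lambda>k. LINT x|lborel. f x * complex_of_real (\<phi> (s k) x)) \<longlonglongrightarrow> (LINT x|lborel. f x * complex_of_real (indicator ?B x * K))"
  proof (rule integral_dominated_convergence[where w="\<lambda>x. cmod (f x) * K"])
    show "AE x in lborel. (\<lambda>k. f x * complex_of_real (\<phi> (s k) x)) \<longlonglongrightarrow> f x * complex_of_real (indicator ?B x * K)"
      using off by eventually_elim (intro tendsto_intros lim)
    show "AE x in lborel. norm (f x * complex_of_real (\<phi> (s k) x)) \<le> cmod (f x) * K" for k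
      using \<phi>_le by (auto simp: norm_mult intro!: mult_left_mono)
  qed (use f in auto)
  then have "(LINT x|lborel. f x * complex_of_real (indicator ?B x * K)) = 0"
    using \<phi>_zero[OF s] by (simp add: LIMSEQ_const_iff)
  moreover have "(LINT x|lborel. f x * complex_of_real (indicator ?B x * K))
      = complex_of_real K * (LINT x|lborel. indicator ?B x *\<^sub>R f x)"
    by (subst integral_mult_right_zero[symmetric])
       (auto simp: scaleR_conv_of_real mult_ac intro!: Bochner_Integration.integral_cong)
  ultimately show "(LINT x|lborel. indicator ?B x *\<^sub>R f x) = 0"
    using K by simp
qed

section \<open>The Fourier transform on \<open>L\<^sup>2\<close>\<close>

lemma fourier_integral_measurable[measurable]:
  fixes u :: "real^'n \<Rightarrow> complex"
  assumes [measurable]: "u \<in> borel_measurable borel"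
  shows "fourier_integral u \<in> borel_measurable borel"
proof -
  have "(\<lambda>\<xi>. LINT x|lborel. u x * osc (\<xi> \<bullet> x)) \<in> borel_measurable lborel"
    by measurable
  then show ?thesis unfolding fourier_integral_def[abs_def] by simp
qed

lemma cnj_borel_measurable[measurable]: "cnj \<in> borel_measurable borel"
  by (intro borel_measurable_continuous_onI continuous_intros)

lemma sigma_finite_lborel_pair:
  "sigma_finite_measure (lborel \<Otimes>\<^sub>M lborel :: ('a::euclidean_space \<times> 'b::euclidean_space) measure)"
  unfolding lborel_prod by (rule sigma_finite_lborel)

lemma fourier_const: "(2 * pi) powr (- real CARD('n::finite) / 2) = 1 / sqrt (2 * pi) ^ CARD('n)"
proof -
  have "(2 * pi) powr (- real CARD('n) / 2) = ((2 * pi) powr (1 / 2)) powr (- real CARD('n))"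
    by (simp add: powr_powr)
  also have "\<dots> = 1 / sqrt (2 * pi) ^ CARD('n)"
    by (simp add: powr_half_sqrt powr_minus powr_realpow divide_simps)
  finally show ?thesis .
qed

lemma integrable_fourier:
  fixes u :: "real^'n \<Rightarrow> complex"
  assumes "integrable lborel u"
  shows "integrable lborel (\<lambda>x. u x * osc (\<xi> \<bullet> x))"
  by (rule integrable_mult_norm_le_1[OF assms]) auto

lemma fourier_integral_diff:
  fixes u v :: "real^'n \<Rightarrow> complex"
  assumes "integrable lborel u" "integrable lborel v"
  shows "fourier_integral (\<lambda>x. u x - v x) \<xi> = fourier_integral u \<xi> - fourier_integral v \<xi>"
  unfolding fourier_integral_def
  using integrable_fourier[OF assms(1)] integrable_fourier[OF assms(2)]
  by (simp add: left_diff_distrib right_diff_distrib)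

lemma fourier_integral_multiplication:
  fixes u v :: "real^'n \<Rightarrow> complex"
  assumes u: "integrable lborel u" and v: "integrable lborel v"
  shows "(LINT \<xi>|lborel. fourier_integral u \<xi> * v \<xi>) = (LINT x|lborel. u x * fourier_integral v x)"
proof -
  note [measurable] = borel_measurable_integrable[OF u] borel_measurable_integrable[OF v]
  let ?c = "complex_of_real ((2 * pi) powr (- real CARD('n) / 2))"
  have "integrable (lborel \<Otimes>\<^sub>M lborel) (\<lambda>(x, \<xi>). u x * v \<xi>)"
    by (intro integrable_mult_fst_snd u v sigma_finite_lborel)
  then have "integrable (lborel \<Otimes>\<^sub>M lborel) (\<lambda>p. (case p of (x, \<xi>) \<Rightarrow> u x * v \<xi>) *
      (case p of (x, \<xi>) \<Rightarrow> osc (\<xi> \<bullet> x)))"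
    by (rule integrable_mult_norm_le_1) (auto simp: split_beta)
  then have int: "integrable (lborel \<Otimes>\<^sub>M lborel) (\<lambda>(x, \<xi>). u x * v \<xi> * osc (\<xi> \<bullet> x))"
    by (simp add: case_prod_unfold)
  have "(LINT \<xi>|lborel. fourier_integral u \<xi> * v \<xi>)
      = ?c * (LINT \<xi>|lborel. (LINT x|lborel. u x * v \<xi> * osc (\<xi> \<bullet> x)))"
    unfolding fourier_integral_def
    by (simp only: integral_mult_right_zero[symmetric] integral_mult_left_zero[symmetric] mult_ac)
  also have "(LINT \<xi>|lborel. (LINT x|lborel. u x * v \<xi> * osc (\<xi> \<bullet> x)))
      = (LINT x|lborel. (LINT \<xi>|lborel. u x * v \<xi> * osc (\<xi> \<bullet> x)))"
    using int by (rule lborel_pair.Fubini_integral)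
  also have "?c * \<dots> = (LINT x|lborel. u x * fourier_integral v x)"
    unfolding fourier_integral_def
    by (simp only: integral_mult_right_zero[symmetric] integral_mult_left_zero[symmetric] mult_ac inner_commute)
  finally show ?thesis .
qed

text \<open>Integrating in y first leaves a Gaussian mass independent of x. The lemma serves both
  the damped Plancherel inequality and the Fubini argument for Mehler's kernel.\<close>

lemma integral_gaussian_convolution:
  fixes u :: "real^'n \<Rightarrow> complex"
  assumes u: "u \<in> L2 lborel" and e: "0 < e"
  shows "integrable (lborel \<Otimes>\<^sub>M lborel) (\<lambda>(x, y). (cmod (u x))\<^sup>2 * exp (- ((norm (x - y))\<^sup>2 / (2 * e))))"
    and "(LINT p|(lborel \<Otimes>\<^sub>M lborel). (case p of (x, y) \<Rightarrow> (cmod (u x))\<^sup>2 * exp (- ((norm (x - y))\<^sup>2 / (2 * e)))))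
      = sqrt (2 * pi * e) ^ CARD('n) * (LINT x|lborel. (cmod (u x))\<^sup>2)"
proof -
  note [measurable] = L2_borel_measurable[OF u]
  have e': "0 < 1 / e" using e by simp
  have G: "integrable lborel (\<lambda>y :: real^'n. exp (- ((norm y)\<^sup>2 / (2 * e))))"
    using integrable_gaussian_norm[OF e'] by (simp add: field_simps)
  have Gx: "integrable lborel (\<lambda>y :: real^'n. exp (- ((norm (x - y))\<^sup>2 / (2 * e))))" for x
    using lborel_integrable_affine[OF G, of "-1" x] by simp
  have val: "(LINT y|lborel. exp (- ((norm (x - y))\<^sup>2 / (2 * e)))) = sqrt (2 * pi * e) ^ CARD('n)" for x :: "real^'n"
    using integral_gaussian_norm[OF e', where 'n='n]
    by (subst lborel_integral_reflect[of "\<lambda>y. exp (- ((norm y)\<^sup>2 / (2 * e)))" x]) (simp add: mult_ac)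
  show int: "integrable (lborel \<Otimes>\<^sub>M lborel) (\<lambda>(x, y). (cmod (u x))\<^sup>2 * exp (- ((norm (x - y))\<^sup>2 / (2 * e))))"
    by (rule lborel_pair.Fubini_integrable) (auto simp: val L2_integrable_sq[OF u] Gx)
  show "(LINT p|(lborel \<Otimes>\<^sub>M lborel). (case p of (x, y) \<Rightarrow> (cmod (u x))\<^sup>2 * exp (- ((norm (x - y))\<^sup>2 / (2 * e)))))
      = sqrt (2 * pi * e) ^ CARD('n) * (LINT x|lborel. (cmod (u x))\<^sup>2)"
    by (subst lborel_pair.integral_fst[OF int, symmetric]) (simp add: val)
qed

text \<open>Expanding the squared modulus as a double integral and integrating the damping in \<xi>
  first leaves a Gaussian in x - y. Its mass compensates the normalising constants, and the
  arithmetic-geometric mean inequality does the rest.\<close>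

lemma damped_Plancherel:
  fixes u :: "real^'n \<Rightarrow> complex"
  assumes u: "integrable lborel u" "u \<in> L2 lborel" and e: "0 < e"
  shows "(\<integral>\<^sup>+\<xi>. ennreal ((cmod (fourier_integral u \<xi>))\<^sup>2 * exp (- (e * (norm \<xi>)\<^sup>2 / 2))) \<partial>lborel)
    \<le> ennreal (LINT x|lborel. (cmod (u x))\<^sup>2)"
proof -
  note [measurable] = borel_measurable_integrable[OF u(1)]
  let ?P = "lborel \<Otimes>\<^sub>M lborel :: ((real^'n) \<times> (real^'n)) measure"
  let ?c = "(2 * pi) powr (- real CARD('n) / 2)"
  let ?E = "\<lambda>\<xi> :: real^'n. exp (- (e * (norm \<xi>)\<^sup>2 / 2))"
  let ?G = "\<lambda>p :: (real^'n) \<times> (real^'n). exp (- ((norm (fst p - snd p))\<^sup>2 / (2 * e)))"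
  let ?K = "sqrt (2 * pi / e) ^ CARD('n)"
  let ?N = "LINT x|lborel. (cmod (u x))\<^sup>2"
  define W where "W p = u (fst p) * cnj (u (snd p))" for p
  define ph where "ph \<xi> p = osc ((fst p - snd p) \<bullet> \<xi>)" for \<xi> :: "real^'n" and p
  have [measurable]: "W \<in> borel_measurable ?P" unfolding W_def by measurable
  have cnju: "integrable lborel (\<lambda>y. cnj (u y))" using u(1) by simp
  have W: "integrable ?P W"
    using integrable_mult_fst_snd[OF sigma_finite_lborel sigma_finite_lborel u(1) cnju]
    by (simp add: W_def[abs_def] case_prod_unfold)
  have W_ph: "integrable ?P (\<lambda>p. W p * ph \<xi> p)" for \<xi>
    by (rule integrable_mult_norm_le_1[OF W]) (auto simp: ph_def)
  \<comment> \<open>The squared modulus is the integral times its conjugate, hence a double integral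
    of u(x) times the conjugate of u(y) with phase (x - y) \<bullet> \<xi>.\<close>
  have sq: "complex_of_real ((cmod (fourier_integral u \<xi>))\<^sup>2) = complex_of_real (?c\<^sup>2) * (LINT p|?P. W p * ph \<xi> p)" for \<xi>
  proof -
    let ?I = "LINT x|lborel. u x * osc (\<xi> \<bullet> x)"
    have ph_eq: "ph \<xi> (x, y) = osc (\<xi> \<bullet> x) * cnj (osc (\<xi> \<bullet> y))" for x y
      by (simp add: ph_def exp_add[symmetric] exp_cnj inner_diff_left inner_commute algebra_simps)
    have "(LINT p|?P. W p * ph \<xi> p) = (LINT x|lborel. (LINT y|lborel. W (x, y) * ph \<xi> (x, y)))"
      by (rule lborel_pair.integral_fst'[OF W_ph, symmetric])
    also have "\<dots> = (LINT x|lborel. (LINT y|lborel. (u x * osc (\<xi> \<bullet> x)) *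
        cnj (u y * osc (\<xi> \<bullet> y))))"
      by (simp only: ph_eq W_def fst_conv snd_conv complex_cnj_mult mult_ac)
    also have "\<dots> = (LINT x|lborel. (u x * osc (\<xi> \<bullet> x)) * cnj ?I)"
      by (simp only: integral_mult_right_zero Bochner_Integration.integral_cnj)
    also have "\<dots> = ?I * cnj ?I" by (simp only: integral_mult_left_zero)
    finally have "(LINT p|?P. W p * ph \<xi> p) = complex_of_real ((cmod ?I)\<^sup>2)"
      by (simp only: complex_norm_square)
    moreover have "(cmod (fourier_integral u \<xi>))\<^sup>2 = ?c\<^sup>2 * (cmod ?I)\<^sup>2"
      by (simp add: fourier_integral_def norm_mult power_mult_distrib)
    ultimately show ?thesis by (simp only: of_real_mult)
  qed
  have E: "integrable lborel ?E" by (rule integrable_gaussian_norm[OF e])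
  have "integrable (?P \<Otimes>\<^sub>M lborel) (\<lambda>(p, \<xi>). W p * complex_of_real (?E \<xi>))"
    using E by (intro integrable_mult_fst_snd W sigma_finite_lborel sigma_finite_lborel_pair) 
               (auto simp: complex_of_real_integrable_eq)
  then have "integrable (?P \<Otimes>\<^sub>M lborel) (\<lambda>q. (case q of (p, \<xi>) \<Rightarrow> W p * complex_of_real (?E \<xi>)) * (case q of (p, \<xi>) \<Rightarrow> ph \<xi> p))"
    by (rule integrable_mult_norm_le_1) (auto simp: ph_def case_prod_unfold)
  then have int: "integrable (?P \<Otimes>\<^sub>M lborel) (\<lambda>(p, \<xi>). complex_of_real (?E \<xi>) * (W p * ph \<xi> p))"
    by (simp add: case_prod_unfold mult_ac)
  interpret PL: pair_sigma_finite ?P "lborel :: (real^'n) measure"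
    by (intro pair_sigma_finite.intro sigma_finite_lborel sigma_finite_lborel_pair)
  define I where "I = (\<lambda>\<xi>. (cmod (fourier_integral u \<xi>))\<^sup>2 * ?E \<xi>)"
  have I_eq: "complex_of_real (I \<xi>) = complex_of_real (?c\<^sup>2) * (LINT p|?P. complex_of_real (?E \<xi>) * (W p * ph \<xi> p))" for \<xi>
    unfolding I_def of_real_mult sq by simp
  have intI: "integrable lborel (\<lambda>\<xi>. complex_of_real (I \<xi>))"
    unfolding I_eq using PL.integrable_snd[OF int] by (intro integrable_mult_right)
  then have intI': "integrable lborel I" by (simp add: complex_of_real_integrable_eq)
  have "complex_of_real (LINT \<xi>|lborel. I \<xi>) = (LINT \<xi>|lborel. complex_of_real (I \<xi>))" by simp
  also have "\<dots> = complex_of_real (?c\<^sup>2) * (LINT \<xi>|lborel. (LINT p|?P. complex_of_real (?E \<xi>) * (W p * ph \<xi> p)))"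
    unfolding I_eq by simp
  also have "(LINT \<xi>|lborel. (LINT p|?P. complex_of_real (?E \<xi>) * (W p * ph \<xi> p)))
      = (LINT p|?P. (LINT \<xi>|lborel. complex_of_real (?E \<xi>) * (W p * ph \<xi> p)))"
    using int by (rule PL.Fubini_integral)
  also have "\<dots> = (LINT p|?P. W p * (LINT \<xi>|lborel. complex_of_real (?E \<xi>) * osc ((fst p - snd p) \<bullet> \<xi>)))"
    unfolding ph_def by (subst integral_mult_right_zero[symmetric]) (simp only: mult_ac)
  also have "\<dots> = (LINT p|?P. complex_of_real ?K * (W p * complex_of_real (?G p)))"
    unfolding integral_gaussian[OF e] by (simp add: mult_ac)
  also have "\<dots> = complex_of_real ?K * (LINT p|?P. W p * complex_of_real (?G p))" by simp
  finally have eq: "complex_of_real (LINT \<xi>|lborel. I \<xi>) = complex_of_real (?c\<^sup>2 * ?K) * (LINT p|?P. W p * complex_of_real (?G p))"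
    by simp
  have g1: "integrable ?P (\<lambda>p. (cmod (u (fst p)))\<^sup>2 * ?G p)"
    and v1: "(LINT p|?P. (cmod (u (fst p)))\<^sup>2 * ?G p) = sqrt (2 * pi * e) ^ CARD('n) * ?N"
    using integral_gaussian_convolution[OF u(2) e] by (simp_all add: case_prod_unfold)
  have g2: "integrable ?P (\<lambda>p. (cmod (u (snd p)))\<^sup>2 * ?G p)"
    using lborel_pair.integrable_product_swap[OF g1] by (simp add: case_prod_unfold norm_minus_commute)
  have v2: "(LINT p|?P. (cmod (u (snd p)))\<^sup>2 * ?G p) = sqrt (2 * pi * e) ^ CARD('n) * ?N"
    using lborel_pair.integral_product_swap[of "\<lambda>p. (cmod (u (fst p)))\<^sup>2 * ?G p"] g1 v1
    by (simp add: case_prod_unfold norm_minus_commute)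
  \<comment> \<open>Since |u(x) u(y)| is at most half the sum of the two squares, each half
    contributes half of the Gaussian mass times \<open>?N\<close>.\<close>
  have "cmod (LINT p|?P. W p * complex_of_real (?G p))
      \<le> (LINT p|?P. ((cmod (u (fst p)))\<^sup>2 * ?G p + (cmod (u (snd p)))\<^sup>2 * ?G p) / 2)"
  proof (rule order_trans[OF integral_norm_bound integral_mono])
    show "integrable ?P (\<lambda>p. cmod (W p * complex_of_real (?G p)))"
      using integrable_norm[of ?P "\<lambda>p. W p * complex_of_real (?G p)"]
        integrable_mult_norm_le_1[OF W, of "\<lambda>p. complex_of_real (?G p)"] e by simp
    show "integrable ?P (\<lambda>p. ((cmod (u (fst p)))\<^sup>2 * ?G p + (cmod (u (snd p)))\<^sup>2 * ?G p) / 2)"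
      using g1 g2 by simp
    show "cmod (W p * complex_of_real (?G p)) \<le> ((cmod (u (fst p)))\<^sup>2 * ?G p + (cmod (u (snd p)))\<^sup>2 * ?G p) / 2" for p
      using mult_right_mono[OF norm_mult_le_half_sum_squares[of "u (fst p)" "cnj (u (snd p))"], of "?G p"]
      by (simp add: W_def norm_mult algebra_simps)
  qed
  also have "\<dots> = sqrt (2 * pi * e) ^ CARD('n) * ?N"
    using g1 g2 v1 v2 by simp
  finally have le: "cmod (LINT p|?P. W p * complex_of_real (?G p)) \<le> sqrt (2 * pi * e) ^ CARD('n) * ?N" .
  \<comment> \<open>The parameter e cancels: the dampings of all widths give the same bound.\<close>
  have const: "?c\<^sup>2 * ?K * sqrt (2 * pi * e) ^ CARD('n) = 1"
  proof -
    have "?c\<^sup>2 * ?K * sqrt (2 * pi * e) ^ CARD('n)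
        = (1 / sqrt (2 * pi) * (1 / sqrt (2 * pi)) * sqrt (2 * pi / e) * sqrt (2 * pi * e)) ^ CARD('n)"
      by (simp only: fourier_const power2_eq_square power_mult_distrib power_one_over)
    also have "1 / sqrt (2 * pi) * (1 / sqrt (2 * pi)) * sqrt (2 * pi / e) * sqrt (2 * pi * e) = 1"
      using e by (simp add: real_sqrt_mult real_sqrt_divide)
    finally show ?thesis by simp
  qed
  have "(LINT \<xi>|lborel. I \<xi>) \<le> cmod (complex_of_real (LINT \<xi>|lborel. I \<xi>))" by simp
  also have "\<dots> = ?c\<^sup>2 * ?K * cmod (LINT p|?P. W p * complex_of_real (?G p))"
    unfolding eq using e by (simp add: norm_mult norm_power)
  also have "\<dots> \<le> ?c\<^sup>2 * ?K * (sqrt (2 * pi * e) ^ CARD('n) * ?N)"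
    using e by (intro mult_left_mono le) auto
  also have "\<dots> = ?N" by (simp only: mult.assoc[symmetric] const mult_1)
  finally have "(LINT \<xi>|lborel. I \<xi>) \<le> ?N" .
  moreover have "(\<integral>\<^sup>+\<xi>. ennreal (I \<xi>) \<partial>lborel) = ennreal (LINT \<xi>|lborel. I \<xi>)"
    by (intro nn_integral_eq_integral intI') (auto simp: I_def)
  ultimately show ?thesis by (simp add: I_def ennreal_leI)
qed

text \<open>Fatou's lemma removes the damping as e tends to 0. This contractivity carries rapidly
  Cauchy truncations over to their transforms.\<close>

theorem Plancherel_le:
  fixes u :: "real^'n \<Rightarrow> complex"
  assumes u: "integrable lborel u" "u \<in> L2 lborel"
  shows "(\<integral>\<^sup>+\<xi>. nsq (fourier_integral u \<xi>) \<partial>lborel) \<le> (\<integral>\<^sup>+x. nsq (u x) \<partial>lborel)"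
proof -
  note [measurable] = L2_borel_measurable[OF u(2)]
  define e where "e k = 1 / real (Suc k)" for k
  have e: "e k > 0" for k by (simp add: e_def)
  have e_lim: "e \<longlonglongrightarrow> 0" unfolding e_def by (rule LIMSEQ_Suc[OF lim_1_over_n, unfolded])
  let ?I = "\<lambda>k \<xi>. ennreal ((cmod (fourier_integral u \<xi>))\<^sup>2 * exp (- (e k * (norm \<xi>)\<^sup>2 / 2)))"
  have "(\<lambda>k. ?I k \<xi>) \<longlonglongrightarrow> ennreal ((cmod (fourier_integral u \<xi>))\<^sup>2 * exp (- (0 * (norm \<xi>)\<^sup>2 / 2)))" for \<xi>
    by (intro tendsto_ennrealI tendsto_intros e_lim) auto
  then have lim: "liminf (\<lambda>k. ?I k \<xi>) = nsq (fourier_integral u \<xi>)" for \<xi>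
    using lim_imp_Liminf[of sequentially "\<lambda>k. ?I k \<xi>"] by simp
  have "(\<integral>\<^sup>+\<xi>. nsq (fourier_integral u \<xi>) \<partial>lborel) = (\<integral>\<^sup>+\<xi>. liminf (\<lambda>k. ?I k \<xi>) \<partial>lborel)"
    by (simp only: lim)
  also have "\<dots> \<le> liminf (\<lambda>k. \<integral>\<^sup>+\<xi>. ?I k \<xi> \<partial>lborel)"
    by (intro nn_integral_liminf) measurable
  also have "\<dots> \<le> liminf (\<lambda>k. ennreal (LINT x|lborel. (cmod (u x))\<^sup>2))"
    by (intro Liminf_mono always_eventually allI damped_Plancherel u e)
  also have "\<dots> = (\<integral>\<^sup>+x. nsq (u x) \<partial>lborel)"
    by (simp add: Liminf_const nn_integral_eq_integral L2_integrable_sq[OF u(2)])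
  finally show ?thesis .
qed

lemma fourier_integral_L2:
  fixes u :: "real^'n \<Rightarrow> complex"
  assumes "integrable lborel u" "u \<in> L2 lborel"
  shows "fourier_integral u \<in> L2 lborel"
  using Plancherel_le[OF assms] assms(2) unfolding L2_iff_nn_integral
  by (auto intro: le_less_trans)

section \<open>Fourier pairs defined by duality\<close>

text \<open>Testing against all \<open>v \<in> L\<^sup>1 \<inter> L\<^sup>2\<close> determines the Fourier transform of an \<open>L\<^sup>2\<close> function up to null sets,
  without reference to the representative chosen by \<^const>\<open>fourier_L2\<close>.\<close>

definition fourier_pair :: "(real^'n \<Rightarrow> complex) \<Rightarrow> (real^'n \<Rightarrow> complex) \<Rightarrow> bool" where
  "fourier_pair g h \<longleftrightarrow> g \<in> L2 lborel \<and> h \<in> L2 lborel \<and>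
     (\<forall>v. integrable lborel v \<longrightarrow> v \<in> L2 lborel \<longrightarrow>
        (LINT \<xi>|lborel. h \<xi> * v \<xi>) = (LINT x|lborel. g x * fourier_integral v x))"

lemma fourier_pair_L2:
  assumes "fourier_pair g h" shows "g \<in> L2 lborel" "h \<in> L2 lborel"
  using assms by (simp_all add: fourier_pair_def)

lemma fourier_pairD:
  assumes "fourier_pair g h" "integrable lborel v" "v \<in> L2 lborel"
  shows "(LINT \<xi>|lborel. h \<xi> * v \<xi>) = (LINT x|lborel. g x * fourier_integral v x)"
  using assms by (simp add: fourier_pair_def)

text \<open>The multiplication formula holds for each u j, and both of its sides converge
  weakly.\<close>

lemma fourier_pair_limit:
  assumes "g \<in> L2 lborel" "h \<in> L2 lborel"
    and u: "\<And>j. u j \<in> L2 lborel" "\<And>j. integrable lborel (u j)"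
    and "L2_tendsto lborel u g" "L2_tendsto lborel (\<lambda>j. fourier_integral (u j)) h"
  shows "fourier_pair g h"
  unfolding fourier_pair_def
proof (intro conjI allI impI assms)
  fix v :: "real^'a \<Rightarrow> complex" assume v: "integrable lborel v" "v \<in> L2 lborel"
  have "(\<lambda>j. LINT \<xi>|lborel. fourier_integral (u j) \<xi> * v \<xi>) \<longlonglongrightarrow> (LINT \<xi>|lborel. h \<xi> * v \<xi>)"
    using assms v by (intro L2_tendsto_integral fourier_integral_L2)
  moreover have "(\<lambda>j. LINT \<xi>|lborel. fourier_integral (u j) \<xi> * v \<xi>) \<longlonglongrightarrow> (LINT x|lborel. g x * fourier_integral v x)"
    unfolding fourier_integral_multiplication[OF u(2) v(1)]
    using assms v by (intro L2_tendsto_integral fourier_integral_L2)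
  ultimately show "(LINT \<xi>|lborel. h \<xi> * v \<xi>) = (LINT x|lborel. g x * fourier_integral v x)"
    by (rule LIMSEQ_unique)
qed

lemma L2_bounded_integrable:
  fixes f :: "'a \<Rightarrow> complex"
  assumes "integrable M f" "\<And>x. cmod (f x) \<le> B"
  shows "f \<in> L2 M"
proof -
  note [measurable] = borel_measurable_integrable[OF assms(1)]
  have "integrable M (\<lambda>x. B * cmod (f x))" using assms(1) by simp
  then have "integrable M (\<lambda>x. (cmod (f x))\<^sup>2)"
  proof (rule Bochner_Integration.integrable_bound)
    have "(cmod (f x))\<^sup>2 \<le> B * cmod (f x)" for x
      unfolding power2_eq_square by (intro mult_right_mono assms) auto
    then show "AE x in M. norm ((cmod (f x))\<^sup>2) \<le> norm (B * cmod (f x))"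
      by (intro AE_I2) (auto intro: order_trans[OF _ abs_ge_self])
  qed measurable
  then show ?thesis by (simp add: L2_def)
qed

text \<open>These two families are the test functions for \<open>fourier_pair\<close>. The Fourier
  transform exchanges them, up to the sign of \<eta>, so either side of the duality can be turned
  into integrals against modulated Gaussians.\<close>

definition modulated_gaussian :: "real^'n \<Rightarrow> real^'n \<Rightarrow> complex" where
  "modulated_gaussian \<eta> x = complex_of_real (exp (- ((norm x)\<^sup>2 / 2))) * osc (\<eta> \<bullet> x)"

definition translated_gaussian :: "real^'n \<Rightarrow> real^'n \<Rightarrow> complex" where
  "translated_gaussian \<eta> x = complex_of_real (exp (- ((norm (x + \<eta>))\<^sup>2 / 2)))"

lemma integrable_modulated_gaussian: "integrable lborel (modulated_gaussian \<eta>)"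
  unfolding modulated_gaussian_def[abs_def] using integrable_gaussian[of 1 \<eta>] by simp

lemma integrable_translated_gaussian: "integrable lborel (translated_gaussian \<eta>)"
proof -
  have "integrable lborel (translated_gaussian (0 :: real^'a))"
    unfolding translated_gaussian_def[abs_def] using integrable_gaussian_norm[of 1]
    by (simp add: complex_of_real_integrable_eq)
  from lborel_integrable_affine[OF this, of 1 \<eta>] show ?thesis
    by (simp add: translated_gaussian_def[abs_def] add.commute)
qed

lemma L2_modulated_gaussian: "modulated_gaussian \<eta> \<in> L2 lborel"
  by (rule L2_bounded_integrable[OF integrable_modulated_gaussian, of _ 1])
     (simp add: modulated_gaussian_def norm_mult)

lemma L2_translated_gaussian: "translated_gaussian \<eta> \<in> L2 lborel"
  by (rule L2_bounded_integrable[OF integrable_translated_gaussian, of _ 1])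
     (simp add: translated_gaussian_def)

lemma fourier_modulated_gaussian:
  "fourier_integral (modulated_gaussian \<eta>) = translated_gaussian (\<eta> :: real^'n)"
proof
  fix x :: "real^'n"
  have "(LINT s|lborel. modulated_gaussian \<eta> s * osc (x \<bullet> s))
      = (LINT s|lborel. complex_of_real (exp (- (1 * (norm s)\<^sup>2 / 2))) * osc ((x + \<eta>) \<bullet> s))"
    by (intro Bochner_Integration.integral_cong refl)
       (simp add: modulated_gaussian_def mult.assoc exp_add[symmetric] inner_add_left algebra_simps)
  then show "fourier_integral (modulated_gaussian \<eta>) x = translated_gaussian \<eta> x"
    unfolding fourier_integral_def fourier_const
    by (subst (asm) integral_gaussian) (simp_all add: translated_gaussian_def field_simps)
qed

lemma fourier_translated_gaussian:
  "fourier_integral (translated_gaussian \<eta>) = modulated_gaussian (- \<eta> :: real^'n)"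
proof
  fix x :: "real^'n"
  have "(LINT s|lborel. translated_gaussian \<eta> s * osc (x \<bullet> s))
      = (LINT s|lborel. translated_gaussian \<eta> (- \<eta> + s) * osc (x \<bullet> (- \<eta> + s)))"
    by (rule lborel_integral_translate[symmetric])
  also have "\<dots> = (LINT s|lborel. exp (\<i> * complex_of_real (\<eta> \<bullet> x)) * (complex_of_real (exp (- (1 * (norm s)\<^sup>2 / 2))) * osc (x \<bullet> s)))"
    by (intro Bochner_Integration.integral_cong refl)
       (simp add: translated_gaussian_def exp_add[symmetric] inner_diff_right inner_commute algebra_simps)
  also have "\<dots> = exp (\<i> * complex_of_real (\<eta> \<bullet> x)) * complex_of_real (sqrt (2 * pi) ^ CARD('n) * exp (- ((norm x)\<^sup>2 / 2)))"
    by (simp only: integral_mult_right_zero integral_gaussian[OF zero_less_one]) simp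
  finally show "fourier_integral (translated_gaussian \<eta>) x = modulated_gaussian (- \<eta>) x"
    unfolding fourier_integral_def fourier_const
    by (simp add: modulated_gaussian_def field_simps)
qed

text \<open>An L2 function times a fixed Gaussian is integrable, and its Fourier integrals are
  exactly the integrals against modulated Gaussians. This reduces uniqueness in L2 to uniqueness in
  L1.\<close>

lemma L2_eq_if_gaussian_integrals_eq:
  fixes h h' :: "real^'n \<Rightarrow> complex"
  assumes h: "h \<in> L2 lborel" "h' \<in> L2 lborel"
    and eq: "\<And>\<eta>. (LINT \<xi>|lborel. h \<xi> * modulated_gaussian \<eta> \<xi>) = (LINT \<xi>|lborel. h' \<xi> * modulated_gaussian \<eta> \<xi>)"
  shows "AE \<xi> in lborel. h \<xi> = h' \<xi>"
proof -
  let ?f = "\<lambda>\<xi>. (h \<xi> - h' \<xi>) * translated_gaussian 0 \<xi>"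
  have d: "(\<lambda>\<xi>. h \<xi> - h' \<xi>) \<in> L2 lborel" using h by (rule L2_diff)
  have "integrable lborel ?f"
    by (rule L2_mult_integrable[OF d L2_translated_gaussian])
  then have "AE \<xi> in lborel. ?f \<xi> = 0"
  proof (rule integrable_fourier_unique)
    fix \<eta> :: "real^'n"
    have "(LINT \<xi>|lborel. ?f \<xi> * osc (\<eta> \<bullet> \<xi>))
        = (LINT \<xi>|lborel. h \<xi> * modulated_gaussian \<eta> \<xi> - h' \<xi> * modulated_gaussian \<eta> \<xi>)"
      by (intro Bochner_Integration.integral_cong refl)
         (simp add: modulated_gaussian_def translated_gaussian_def algebra_simps)
    also have "\<dots> = 0"
      using eq L2_mult_integrable[OF h(1) L2_modulated_gaussian] L2_mult_integrable[OF h(2) L2_modulated_gaussian]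
      by (subst Bochner_Integration.integral_diff) auto
    finally show "(LINT \<xi>|lborel. ?f \<xi> * osc (\<eta> \<bullet> \<xi>)) = 0" .
  qed
  then show ?thesis by eventually_elim (simp add: translated_gaussian_def)
qed

lemma fourier_pair_unique:
  assumes "fourier_pair g h" "fourier_pair g h'"
  shows "AE \<xi> in lborel. h \<xi> = h' \<xi>"
  by (rule L2_eq_if_gaussian_integrals_eq[OF fourier_pair_L2(2) fourier_pair_L2(2), OF assms])
     (simp only: fourier_pairD[OF _ integrable_modulated_gaussian L2_modulated_gaussian] assms
        fourier_pairD[OF assms(1) integrable_modulated_gaussian L2_modulated_gaussian]
        fourier_pairD[OF assms(2) integrable_modulated_gaussian L2_modulated_gaussian])

lemma fourier_pair_cong_AE:
  assumes gh: "fourier_pair g h" and h': "h' \<in> L2 lborel" and ae: "AE \<xi> in lborel. h' \<xi> = h \<xi>"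
  shows "fourier_pair g h'"
  unfolding fourier_pair_def
proof (intro conjI allI impI)
  fix v :: "real^'a \<Rightarrow> complex" assume v: "integrable lborel v" "v \<in> L2 lborel"
  note [measurable] = L2_borel_measurable[OF h'] borel_measurable_integrable[OF v(1)]
  note [measurable] = L2_borel_measurable[OF fourier_pair_L2(2)[OF gh]]
  have "(LINT \<xi>|lborel. h' \<xi> * v \<xi>) = (LINT \<xi>|lborel. h \<xi> * v \<xi>)"
    using ae by (intro integral_cong_AE) auto
  then show "(LINT \<xi>|lborel. h' \<xi> * v \<xi>) = (LINT x|lborel. g x * fourier_integral v x)"
    using gh v by (simp add: fourier_pair_def)
qed (use gh h' in \<open>auto simp: fourier_pair_def\<close>)

text \<open>The test function \<open>translated_gaussian (- \<eta>)\<close> has transform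
  \<open>modulated_gaussian \<eta>\<close>, so the duality puts modulated Gaussians on the side of
  g.\<close>

lemma fourier_pair_inj:
  assumes gh: "fourier_pair g h" and gh': "fourier_pair g' h'" and ae: "AE \<xi> in lborel. h \<xi> = h' \<xi>"
  shows "AE x in lborel. g x = g' x"
proof (rule L2_eq_if_gaussian_integrals_eq)
  have *: "fourier_pair g' h" using fourier_pair_cong_AE[OF gh' _ ae] gh by (simp add: fourier_pair_def)
  show "(LINT x|lborel. g x * modulated_gaussian \<eta> x) = (LINT x|lborel. g' x * modulated_gaussian \<eta> x)" for \<eta>
    using fourier_pairD[OF gh integrable_translated_gaussian[of "- \<eta>"] L2_translated_gaussian[of "- \<eta>"]]
      fourier_pairD[OF * integrable_translated_gaussian[of "- \<eta>"] L2_translated_gaussian[of "- \<eta>"]]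
    by (simp add: fourier_translated_gaussian)
qed (use assms in \<open>auto simp: fourier_pair_def\<close>)

text \<open>Fourier inversion, since the reflected transform is the inverse one. Against a modulated
  Gaussian the multiplication formula is used twice; the reflection undoes the sign change of the
  second Gaussian transform.\<close>

lemma fourier_pair_inverse:
  fixes g :: "real^'n \<Rightarrow> complex"
  assumes g: "integrable lborel g" "g \<in> L2 lborel"
    and pair: "fourier_pair (\<lambda>x. fourier_integral g (- x)) h"
  shows "AE \<xi> in lborel. h \<xi> = g \<xi>"
proof (rule L2_eq_if_gaussian_integrals_eq)
  fix \<eta> :: "real^'n"
  have "(LINT \<xi>|lborel. h \<xi> * modulated_gaussian \<eta> \<xi>) = (LINT x|lborel. fourier_integral g (- x) * translated_gaussian \<eta> x)"
    by (simp only: fourier_pairD[OF pair integrable_modulated_gaussian L2_modulated_gaussian] fourier_modulated_gaussian)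
  also have "\<dots> = (LINT x|lborel. fourier_integral g x * translated_gaussian \<eta> (- x))"
    using lborel_integral_reflect[of "\<lambda>x. fourier_integral g x * translated_gaussian \<eta> (- x)" 0] by simp
  also have "\<dots> = (LINT x|lborel. fourier_integral g x * translated_gaussian (- \<eta>) x)"
    by (intro Bochner_Integration.integral_cong refl)
       (simp add: translated_gaussian_def norm_minus_commute)
  also have "\<dots> = (LINT \<xi>|lborel. g \<xi> * modulated_gaussian \<eta> \<xi>)"
    by (simp add: fourier_integral_multiplication g integrable_translated_gaussian fourier_translated_gaussian)
  finally show "(LINT \<xi>|lborel. h \<xi> * modulated_gaussian \<eta> \<xi>) = (LINT \<xi>|lborel. g \<xi> * modulated_gaussian \<eta> \<xi>)" .
qed (use assms in \<open>auto simp: fourier_pair_def\<close>)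

text \<open>The given h and u show that the choice in \<open>fourier_L2\<close> is not vacuous. The
  chosen function may come with another approximating sequence, but \<open>fourier_pair\<close> does
  not mention the sequence.\<close>

lemma fourier_pair_fourier_L2:
  assumes g: "g \<in> L2 lborel" and h: "h \<in> L2 lborel"
    and u: "\<And>j. u j \<in> L2 lborel" "\<And>j. integrable lborel (u j)"
      "L2_tendsto lborel u g" "L2_tendsto lborel (\<lambda>j. fourier_integral (u j)) h"
  shows "fourier_pair g (fourier_L2 g)"
proof -
  have "\<exists>h. h \<in> L2 lborel \<and> (\<exists>u. (\<forall>j. u j \<in> L2 lborel \<and> integrable lborel (u j)) \<and>
      L2_tendsto lborel u g \<and> L2_tendsto lborel (\<lambda>j. fourier_integral (u j)) h)"
    using h u by blast
  from someI_ex[OF this] show ?thesis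
    unfolding fourier_L2_def[symmetric] using g by (auto intro: fourier_pair_limit)
qed

section \<open>The partial Fourier transform\<close>

lemma L2_pair_nn_integral:
  fixes f :: "'a::euclidean_space \<times> 'b::euclidean_space \<Rightarrow> complex"
  assumes [measurable]: "f \<in> borel_measurable borel"
  shows "(\<integral>\<^sup>+p. nsq (f p) \<partial>lborel)
    = (\<integral>\<^sup>+x. (\<integral>\<^sup>+y. nsq (f (x, y)) \<partial>lborel) \<partial>lborel)"
proof -
  have [measurable]: "f \<in> borel_measurable (lborel \<Otimes>\<^sub>M lborel)" by (simp add: lborel_prod)
  show ?thesis
    unfolding lborel_prod[symmetric] by (rule lborel.nn_integral_fst[symmetric]) measurable
qed

lemma L2_pairI:
  fixes f :: "'a::euclidean_space \<times> 'b::euclidean_space \<Rightarrow> complex"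
  assumes "f \<in> borel_measurable borel"
    and "(\<integral>\<^sup>+x. (\<integral>\<^sup>+y. nsq (f (x, y)) \<partial>lborel) \<partial>lborel) < \<infinity>"
  shows "f \<in> L2 lborel"
  using assms by (simp add: L2_iff_nn_integral L2_pair_nn_integral)

lemma borel_measurable_slice:
  fixes f :: "'a::euclidean_space \<times> 'b::euclidean_space \<Rightarrow> complex"
  assumes "f \<in> borel_measurable borel"
  shows "(\<lambda>y. f (x, y)) \<in> borel_measurable borel" "(\<lambda>x. f (x, y)) \<in> borel_measurable borel"
proof -
  have [measurable]: "f \<in> borel_measurable (borel \<Otimes>\<^sub>M borel)" using assms by (simp add: borel_prod)
  show "(\<lambda>y. f (x, y)) \<in> borel_measurable borel" "(\<lambda>x. f (x, y)) \<in> borel_measurable borel" by measurable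
qed

lemma
  fixes f :: "'a::euclidean_space \<times> 'b::euclidean_space \<Rightarrow> complex"
  assumes f: "f \<in> L2 lborel"
  shows AE_L2_slice_fst: "AE x in lborel. (\<lambda>y. f (x, y)) \<in> L2 lborel"
    and AE_L2_slice_snd: "AE y in lborel. (\<lambda>x. f (x, y)) \<in> L2 lborel"
proof -
  have int: "integrable (lborel \<Otimes>\<^sub>M lborel) (\<lambda>(x, y). (cmod (f (x, y)))\<^sup>2)"
    using L2_integrable_sq[OF f] by (simp add: lborel_prod case_prod_unfold)
  have meas: "f \<in> borel_measurable borel" using L2_borel_measurable[OF f] by simp
  show "AE x in lborel. (\<lambda>y. f (x, y)) \<in> L2 lborel"
    using lborel_pair.AE_integrable_fst[OF int] by eventually_elim (simp add: L2_def borel_measurable_slice[OF meas])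
  show "AE y in lborel. (\<lambda>x. f (x, y)) \<in> L2 lborel"
    using lborel_pair.AE_integrable_snd[OF int] by eventually_elim (simp add: L2_def borel_measurable_slice[OF meas])
qed

lemma ennreal_suminf_tendsto_0:
  fixes a :: "nat \<Rightarrow> ennreal"
  assumes "(\<Sum>j. a j) < \<infinity>"
  shows "a \<longlonglongrightarrow> 0"
proof -
  have fin: "a j \<noteq> \<infinity>" for j
    using assms sum_le_suminf[of a "{j}"] by (auto simp: top_unique)
  then have eq: "a j = ennreal (enn2real (a j))" for j by (simp add: less_top)
  have "summable (\<lambda>j. enn2real (a j))"
    using assms by (intro summable_suminf_not_top) (auto simp: eq[symmetric])
  then have "(\<lambda>j. ennreal (enn2real (a j))) \<longlonglongrightarrow> ennreal 0"
    by (intro tendsto_ennrealI summable_LIMSEQ_zero)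
  then show ?thesis by (simp add: eq[symmetric])
qed

lemma borel_measurable_fourier_slices:
  fixes F :: "(real^'m) \<times> (real^'n) \<Rightarrow> complex"
  assumes "F \<in> borel_measurable borel"
  shows "(\<lambda>p. fourier_integral (\<lambda>y. F (fst p, y)) (snd p)) \<in> borel_measurable borel"
proof -
  have [measurable]: "F \<in> borel_measurable (borel \<Otimes>\<^sub>M borel)" using assms by (simp add: borel_prod)
  have "(\<lambda>p :: (real^'m) \<times> (real^'n). LINT y|lborel. F (fst p, y) * osc (snd p \<bullet> y))
      \<in> borel_measurable (borel \<Otimes>\<^sub>M borel)"
    by measurable
  then show ?thesis unfolding fourier_integral_def by (simp add: borel_prod)
qed

text \<open>Plancherel's inequality on almost every slice, integrated by Tonelli. It is applied to
  truncations, to the heat solution and to the heat kernel.\<close>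

lemma Plancherel_le_slices:
  fixes F :: "(real^'m) \<times> (real^'n) \<Rightarrow> complex"
  assumes F: "F \<in> L2 lborel" and int: "AE x in lborel. integrable lborel (\<lambda>y. F (x, y))"
  shows "(\<lambda>p. fourier_integral (\<lambda>y. F (fst p, y)) (snd p)) \<in> L2 lborel"
proof (rule L2_pairI)
  have F_meas: "F \<in> borel_measurable borel" using L2_borel_measurable[OF F] by simp
  then show "(\<lambda>p. fourier_integral (\<lambda>y. F (fst p, y)) (snd p)) \<in> borel_measurable borel"
    by (rule borel_measurable_fourier_slices)
  have "(\<integral>\<^sup>+x. (\<integral>\<^sup>+\<xi>. nsq (fourier_integral (\<lambda>y. F (x, y)) \<xi>) \<partial>lborel) \<partial>lborel)
      \<le> (\<integral>\<^sup>+x. (\<integral>\<^sup>+y. nsq (F (x, y)) \<partial>lborel) \<partial>lborel)"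
  proof (rule nn_integral_mono_AE)
    show "AE x in lborel. (\<integral>\<^sup>+\<xi>. nsq (fourier_integral (\<lambda>y. F (x, y)) \<xi>) \<partial>lborel)
        \<le> (\<integral>\<^sup>+y. nsq (F (x, y)) \<partial>lborel)"
      using int AE_L2_slice_fst[OF F] by eventually_elim (rule Plancherel_le)
  qed
  also have "\<dots> < \<infinity>"
    using F by (simp add: L2_iff_nn_integral L2_pair_nn_integral[OF F_meas, symmetric])
  finally show "(\<integral>\<^sup>+x. (\<integral>\<^sup>+\<xi>. nsq (fourier_integral (\<lambda>y. F (fst (x, \<xi>), y)) (snd (x, \<xi>))) \<partial>lborel) \<partial>lborel) < \<infinity>"
    by simp
qed

abbreviation trunc_snd :: "real \<Rightarrow> ('a \<times> 'b::real_normed_vector \<Rightarrow> complex) \<Rightarrow> 'a \<times> 'b \<Rightarrow> complex" where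
  "trunc_snd c f p \<equiv> (if norm (snd p) \<le> c then f p else 0)"

lemma borel_measurable_truncate_snd:
  fixes f :: "'a::euclidean_space \<times> 'b::euclidean_space \<Rightarrow> complex"
  assumes "f \<in> borel_measurable borel"
  shows "(\<lambda>p. trunc_snd c f p) \<in> borel_measurable borel"
proof -
  have [measurable]: "f \<in> borel_measurable (borel \<Otimes>\<^sub>M borel)" using assms by (simp add: borel_prod)
  have "(\<lambda>p. trunc_snd c f p) \<in> borel_measurable (borel \<Otimes>\<^sub>M borel)" by measurable
  then show ?thesis by (simp add: borel_prod)
qed

lemma L2_tail_tendsto_0:
  fixes f :: "'a::euclidean_space \<times> 'b::euclidean_space \<Rightarrow> complex"
  assumes f: "f \<in> L2 lborel"
  shows "(\<lambda>r. \<integral>\<^sup>+p. nsq (trunc_snd (real r) f p - f p) \<partial>lborel) \<longlonglongrightarrow> 0"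
proof -
  have [measurable]: "f \<in> borel_measurable borel" using L2_borel_measurable[OF f] by simp
  have meas: "(\<lambda>p. (trunc_snd (real r) f p) - f p) \<in> borel_measurable borel" for r
    by (intro borel_measurable_diff borel_measurable_truncate_snd) auto
  have "(\<lambda>r. \<integral>\<^sup>+p. nsq (trunc_snd (real r) f p - f p) \<partial>lborel)
      \<longlonglongrightarrow> (\<integral>\<^sup>+p. 0 \<partial>(lborel :: ('a \<times> 'b) measure))"
  proof (rule nn_integral_dominated_convergence[where w="\<lambda>p. nsq (f p)"])
    show "(\<lambda>p. nsq (trunc_snd (real r) f p - f p)) \<in> borel_measurable lborel" for r
      using measurable_compose[OF meas[of r], of "\<lambda>z. ennreal ((cmod z)\<^sup>2)" borel] by simp
    show "(\<integral>\<^sup>+p. nsq (f p) \<partial>lborel) < \<infinity>" using f by (simp add: L2_iff_nn_integral)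
    show "AE p in lborel. (\<lambda>r. nsq (trunc_snd (real r) f p - f p)) \<longlonglongrightarrow> 0"
    proof (intro AE_I2 tendsto_eventually)
      fix p :: "'a \<times> 'b"
      show "\<forall>\<^sub>F r in sequentially. nsq (trunc_snd (real r) f p - f p) = 0"
        using eventually_ge_at_top[of "nat \<lceil>norm (snd p)\<rceil>"]
        by eventually_elim (auto simp: nat_le_iff ceiling_le_iff)
    qed
  qed (auto simp: ennreal_leI)
  then show ?thesis by simp
qed

text \<open>Truncation in the second variable makes almost every slice integrable, so its transform
  is a jointly measurable integral. With errors of order 4^-j the transforms are rapidly Cauchy in
  L2 of the product and on almost every slice, so their pointwise limit is jointly measurable,
  square-integrable and slicewise the Fourier transform. Its existence validates the choice in
  \<open>partial_fourier\<close>.\<close>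

theorem partial_fourier_pair:
  fixes f :: "(real^'m) \<times> (real^'n) \<Rightarrow> complex"
  assumes f: "f \<in> L2 lborel"
  shows "partial_fourier f \<in> L2 lborel"
    and "AE x in lborel. fourier_pair (\<lambda>y. f (x, y)) (\<lambda>\<xi>. partial_fourier f (x, \<xi>))"
proof -
  have [measurable]: "f \<in> borel_measurable borel" using L2_borel_measurable[OF f] by simp
  \<comment> \<open>The error 4^-j still sums after multiplication by the weight 2^j of
    \<open>rapid_Cauchy_L2_limit\<close>.\<close>
  have "\<exists>r :: nat. (\<integral>\<^sup>+p. nsq (trunc_snd (real r) f p - f p) \<partial>lborel) \<le> ennreal ((1 / 4) ^ j)" for j
  proof -
    have "\<forall>\<^sub>F r in sequentially. (\<integral>\<^sup>+p. nsq (trunc_snd (real r) f p - f p) \<partial>lborel) < ennreal ((1 / 4) ^ j)"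
      by (intro order_tendstoD(2)[OF L2_tail_tendsto_0[OF f]]) simp
    then show ?thesis by (auto simp: eventually_sequentially intro: less_imp_le)
  qed
  then have "\<forall>j. \<exists>r :: nat. (\<integral>\<^sup>+p. nsq (trunc_snd (real r) f p - f p) \<partial>lborel) \<le> ennreal ((1 / 4) ^ j)"
    by (rule allI)
  from choice[OF this] obtain r :: "nat \<Rightarrow> nat" where r: "\<forall>j. (\<integral>\<^sup>+p. nsq (trunc_snd (real (r j)) f p - f p) \<partial>lborel) \<le> ennreal ((1 / 4) ^ j)"
    by (rule exE)
  define u where "u j p = (trunc_snd (real (r j)) f p)" for j p
  define H where "H j p = fourier_integral (\<lambda>y. u j (fst p, y)) (snd p)" for j p
  define D where "D j x = (\<integral>\<^sup>+y. nsq (u j (x, y) - f (x, y)) \<partial>lborel)" for j x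
  let ?\<Delta> = "\<lambda>j x. \<integral>\<^sup>+\<xi>. nsq (H (Suc j) (x, \<xi>) - H j (x, \<xi>)) \<partial>lborel"
  let ?W = "\<lambda>j x. \<integral>\<^sup>+\<xi>. ennreal (2 ^ j * (cmod (H (Suc j) (x, \<xi>) - H j (x, \<xi>)))\<^sup>2) \<partial>lborel"
  let ?B = "\<lambda>j x. ennreal (2 ^ j) * (D j x + D (Suc j) x)"
  have u_meas[measurable]: "u j \<in> borel_measurable borel" for j
    unfolding u_def[abs_def] by (rule borel_measurable_truncate_snd) simp
  have u_L2: "u j \<in> L2 lborel" for j
    using u_meas[of j] by (intro L2_bound[OF f, where C=1]) (auto simp: u_def intro!: AE_I2)
  have slices: "AE x in lborel. (\<lambda>y. f (x, y)) \<in> L2 lborel" by (rule AE_L2_slice_fst[OF f])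
  have u_slice: "(\<lambda>y. u j (x, y)) \<in> L2 lborel" "integrable lborel (\<lambda>y. u j (x, y))"
    if "(\<lambda>y. f (x, y)) \<in> L2 lborel" for x j
  proof -
    show 1: "(\<lambda>y. u j (x, y)) \<in> L2 lborel"
      using borel_measurable_slice(1)[OF u_meas, of j x]
      by (intro L2_bound[OF that, where C=1]) (auto simp: u_def intro!: AE_I2)
    \<comment> \<open>The truncated slice equals its product with the indicator of a ball, and a
      product of two L2 functions is integrable.\<close>
    have "integrable lborel (\<lambda>y :: real^'n. complex_of_real (indicator (cball 0 (real (r j))) y))"
      by (subst complex_of_real_integrable_eq) (auto intro!: integrable_real_indicator emeasure_bounded_finite)
    then have "(\<lambda>y :: real^'n. complex_of_real (indicator (cball 0 (real (r j))) y)) \<in> L2 lborel"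
      by (rule L2_bounded_integrable[where B=1]) (simp add: indicator_def)
    from L2_mult_integrable[OF 1 this] show "integrable lborel (\<lambda>y. u j (x, y))"
      by (rule Bochner_Integration.integrable_cong[THEN iffD1, rotated 2])
         (auto simp: u_def indicator_def)
  qed
  have H_L2: "H j \<in> L2 lborel" for j
  proof -
    have "AE x in lborel. integrable lborel (\<lambda>y. u j (x, y))"
      using slices by eventually_elim (rule u_slice(2))
    from Plancherel_le_slices[OF u_L2 this] show ?thesis unfolding H_def[abs_def] .
  qed
  then have H_meas[measurable]: "H j \<in> borel_measurable borel" for j
    using L2_borel_measurable[OF H_L2] by simp
  have H_slice[measurable]: "(\<lambda>\<xi>. H j (x, \<xi>)) \<in> borel_measurable borel" for j x
    by (rule borel_measurable_slice[OF H_meas])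
  have D_meas[measurable]: "D j \<in> borel_measurable borel" for j
  proof -
    have [measurable]: "(\<lambda>p. u j p - f p) \<in> borel_measurable (borel \<Otimes>\<^sub>M borel)"
      unfolding borel_prod by measurable
    have "(\<lambda>x. \<integral>\<^sup>+y. nsq (u j (x, y) - f (x, y)) \<partial>lborel) \<in> borel_measurable borel"
      by measurable
    then show ?thesis by (simp add: D_def[abs_def])
  qed
  have D_int: "(\<integral>\<^sup>+x. D j x \<partial>lborel) \<le> ennreal ((1 / 4) ^ j)" for j
  proof -
    have "(\<integral>\<^sup>+x. D j x \<partial>lborel) = (\<integral>\<^sup>+p. nsq (u j p - f p) \<partial>lborel)"
      unfolding D_def by (rule L2_pair_nn_integral[symmetric]) measurable
    then show ?thesis using r[rule_format, of j] by (simp add: u_def)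
  qed
  have H_diff: "AE x in lborel. \<forall>j. ?\<Delta> j x \<le> D j x + D (Suc j) x"
    using slices
  proof (eventually_elim, intro allI)
    fix x j assume x: "(\<lambda>y. f (x, y)) \<in> L2 lborel"
    have [measurable]: "(\<lambda>y. f (x, y)) \<in> borel_measurable borel" "(\<lambda>y. u i (x, y)) \<in> borel_measurable borel" for i
      by (rule borel_measurable_slice; measurable)+
    have "?\<Delta> j x
        = (\<integral>\<^sup>+\<xi>. nsq (fourier_integral (\<lambda>y. u (Suc j) (x, y) - u j (x, y)) \<xi>) \<partial>lborel)"
      by (simp add: H_def fourier_integral_diff u_slice[OF x])
    also have "\<dots> \<le> (\<integral>\<^sup>+y. nsq (u (Suc j) (x, y) - u j (x, y)) \<partial>lborel)"
      using u_slice[OF x] by (intro Plancherel_le L2_diff Bochner_Integration.integrable_diff)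
    \<comment> \<open>There is no factor 2: at each point a truncation is either f or 0, so at most
      one of the two errors is present when the truncations differ.\<close>
    also have "\<dots> \<le> (\<integral>\<^sup>+y. nsq (u j (x, y) - f (x, y)) + nsq (u (Suc j) (x, y) - f (x, y)) \<partial>lborel)"
      by (intro nn_integral_mono) (auto simp: u_def)
    also have "\<dots> = D j x + D (Suc j) x"
      unfolding D_def by (rule nn_integral_add) measurable
    finally show "?\<Delta> j x \<le> D j x + D (Suc j) x" .
  qed
  have H_diff': "AE x in lborel. \<forall>j. ?W j x
      \<le> ?B j x"
    using H_diff
  proof (eventually_elim, intro allI)
    fix x j assume *: "\<forall>j. ?\<Delta> j x \<le> D j x + D (Suc j) x"
    show "?W j x \<le> ?B j x"
      using mult_left_mono[OF *[rule_format, of j], of "ennreal (2 ^ j)"]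
      by (simp add: ennreal_mult nn_integral_cmult)
  qed
  have D_sum: "(\<integral>\<^sup>+x. ?B j x \<partial>lborel) \<le> ennreal (2 * (1 / 2) ^ j)" for j
  proof -
    have "(\<integral>\<^sup>+x. ?B j x \<partial>lborel) = ennreal (2 ^ j) * ((\<integral>\<^sup>+x. D j x \<partial>lborel) + (\<integral>\<^sup>+x. D (Suc j) x \<partial>lborel))"
      by (simp add: nn_integral_cmult nn_integral_add)
    also have "\<dots> \<le> ennreal (2 ^ j) * (ennreal ((1 / 4) ^ j) + ennreal ((1 / 4) ^ Suc j))"
      by (intro mult_left_mono add_mono D_int) auto
    also have "\<dots> = ennreal (2 ^ j * ((1 / 4) ^ j + (1 / 4) ^ Suc j))"
      by (subst ennreal_mult) (simp_all only: ennreal_plus zero_le_power zero_le_divide_1_iff zero_le_numeral add_nonneg_nonneg)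
    also have "\<dots> \<le> ennreal (2 * (1 / 2) ^ j)"
    proof (rule ennreal_leI)
      have "2 ^ j * ((1 / 4) ^ j + (1 / 4) ^ Suc j) = (5 / 4) * (2 * (1 / 4) :: real) ^ j"
        unfolding power_mult_distrib by (simp add: algebra_simps)
      also have "\<dots> \<le> 2 * (1 / 2 :: real) ^ j" by (auto intro: mult_right_mono)
      finally show "2 ^ j * ((1 / 4) ^ j + (1 / 4) ^ Suc j) \<le> 2 * (1 / 2 :: real) ^ j" .
    qed
    finally show ?thesis .
  qed
  have sum_fin: "(\<Sum>j. \<integral>\<^sup>+x. ?B j x \<partial>lborel) < \<infinity>"
  proof -
    have "(\<Sum>j. \<integral>\<^sup>+x. ?B j x \<partial>lborel) \<le> (\<Sum>j. ennreal (2 * (1 / 2) ^ j))"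
      by (intro suminf_le D_sum) auto
    also have "\<dots> = ennreal (\<Sum>j. 2 * (1 / 2) ^ j)"
      by (intro suminf_ennreal2 summable_mult summable_geometric) auto
    also have "\<dots> < \<infinity>" by simp
    finally show ?thesis .
  qed
  then have "(\<integral>\<^sup>+x. (\<Sum>j. ?B j x) \<partial>lborel) < \<infinity>"
    by (subst nn_integral_suminf) auto
  then have D_ae: "AE x in lborel. (\<Sum>j. ?B j x) \<noteq> \<infinity>"
    by (intro nn_integral_PInf_AE) auto
  \<comment> \<open>Because this limit is pointwise, its slices are the limits of the slices, and
    one function serves both as global and as slicewise L2 limit.\<close>
  define h where "h p = lim (\<lambda>j. H j p)" for p
  have h_meas[measurable]: "h \<in> borel_measurable borel"
    unfolding h_def[abs_def] by (intro borel_measurable_lim_metric H_meas)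
  have "(\<Sum>j. \<integral>\<^sup>+p. ennreal (2 ^ j * (cmod (H (Suc j) p - H j p))\<^sup>2) \<partial>lborel)
      \<le> (\<Sum>j. \<integral>\<^sup>+x. ?B j x \<partial>lborel)"
  proof (intro suminf_le)
    fix j
    \<comment> \<open>The weight enters the modulus as sqrt (2^j), which gives the integrand the
      shape of \<open>L2_pair_nn_integral\<close>.\<close>
    have "(\<integral>\<^sup>+p. ennreal (2 ^ j * (cmod (H (Suc j) p - H j p))\<^sup>2) \<partial>lborel)
        = (\<integral>\<^sup>+p. nsq (complex_of_real (sqrt (2 ^ j)) * (H (Suc j) p - H j p)) \<partial>lborel)"
      by (simp add: norm_mult power_mult_distrib)
    also have "\<dots> = (\<integral>\<^sup>+x. (\<integral>\<^sup>+\<xi>. nsq (complex_of_real (sqrt (2 ^ j)) * (H (Suc j) (x, \<xi>) - H j (x, \<xi>))) \<partial>lborel) \<partial>lborel)"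
      by (rule L2_pair_nn_integral) measurable
    also have "\<dots> = (\<integral>\<^sup>+x. ?W j x \<partial>lborel)"
      by (simp add: norm_mult power_mult_distrib)
    also have "\<dots> \<le> (\<integral>\<^sup>+x. ?B j x \<partial>lborel)"
      using H_diff' by (intro nn_integral_mono_AE) (auto elim: eventually_mono)
    finally show "(\<integral>\<^sup>+p. ennreal (2 ^ j * (cmod (H (Suc j) p - H j p))\<^sup>2) \<partial>lborel)
      \<le> (\<integral>\<^sup>+x. ?B j x \<partial>lborel)" .
  qed auto
  with sum_fin have "L2_tendsto lborel H h"
    unfolding h_def[abs_def] by (intro rapid_Cauchy_L2_limit) auto
  then have h_L2: "h \<in> L2 lborel"
    by (rule L2_tendsto_L2[OF _ H_L2]) simp
  have pair: "AE x in lborel. fourier_pair (\<lambda>y. f (x, y)) (\<lambda>\<xi>. h (x, \<xi>)) \<and>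
      fourier_pair (\<lambda>y. f (x, y)) (fourier_L2 (\<lambda>y. f (x, y)))"
    using slices AE_L2_slice_fst[OF h_L2] H_diff' D_ae
  proof eventually_elim
    fix x
    assume x: "(\<lambda>y. f (x, y)) \<in> L2 lborel" and hx: "(\<lambda>\<xi>. h (x, \<xi>)) \<in> L2 lborel"
      and Hx: "\<forall>j. ?W j x \<le> ?B j x"
      and Dx: "(\<Sum>j. ?B j x) \<noteq> \<infinity>"
    have "(\<Sum>j. ?W j x) \<le> (\<Sum>j. ?B j x)"
      using Hx by (intro suminf_le) auto
    also have "\<dots> < \<infinity>" using Dx by (simp only: less_top infinity_ennreal_def)
    finally have "(\<Sum>j. ?W j x) < \<infinity>" .
    then have "L2_tendsto lborel (\<lambda>j \<xi>. H j (x, \<xi>)) (\<lambda>\<xi>. h (x, \<xi>))"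
      unfolding h_def by (intro rapid_Cauchy_L2_limit) auto
    then have lim_h: "L2_tendsto lborel (\<lambda>j. fourier_integral (\<lambda>y. u j (x, y))) (\<lambda>\<xi>. h (x, \<xi>))"
      by (simp add: H_def)
    have lim_0: "(\<lambda>j. ?B j x) \<longlonglongrightarrow> 0"
      using Dx by (intro ennreal_suminf_tendsto_0) (simp add: less_top)
    have "(\<lambda>j. D j x) \<longlonglongrightarrow> 0"
    proof (rule tendsto_sandwich[OF _ _ tendsto_const lim_0])
      have "D j x \<le> ?B j x" for j
      proof -
        have "1 \<le> ennreal (2 ^ j)"
          using ennreal_leI[of 1 "2 ^ j"] by simp
        then have "1 * (D j x + 0) \<le> ?B j x"
          by (intro mult_mono add_mono order_refl zero_le)
        then show ?thesis by simp
      qed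
      then show "\<forall>\<^sub>F j in sequentially. D j x \<le> ?B j x" by simp
    qed simp
    then have lim_u: "L2_tendsto lborel (\<lambda>j y. u j (x, y)) (\<lambda>y. f (x, y))"
      unfolding L2_tendsto_def D_def .
    show "fourier_pair (\<lambda>y. f (x, y)) (\<lambda>\<xi>. h (x, \<xi>)) \<and> fourier_pair (\<lambda>y. f (x, y)) (fourier_L2 (\<lambda>y. f (x, y)))"
      using fourier_pair_limit[OF x hx u_slice(1)[OF x] u_slice(2)[OF x] lim_u lim_h]
        fourier_pair_fourier_L2[OF x hx u_slice(1)[OF x] u_slice(2)[OF x] lim_u lim_h] by simp
  qed
  \<comment> \<open>Both h and \<open>fourier_L2\<close> are partners of the same slice, so
    uniqueness makes h a witness for the choice in \<open>partial_fourier\<close>.\<close>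
  then have "AE x in lborel. AE \<xi> in lborel. h (x, \<xi>) = fourier_L2 (\<lambda>y. f (x, y)) \<xi>"
    by eventually_elim (rule fourier_pair_unique[OF conjunct1 conjunct2])
  with h_L2 have "\<exists>h. h \<in> L2 lborel \<and> (AE x in lborel. AE \<xi> in lborel. h (x, \<xi>) = fourier_L2 (\<lambda>y. f (x, y)) \<xi>)"
    by blast
  from someI_ex[OF this] have pf: "partial_fourier f \<in> L2 lborel"
    and ae: "AE x in lborel. AE \<xi> in lborel. partial_fourier f (x, \<xi>) = fourier_L2 (\<lambda>y. f (x, y)) \<xi>"
    unfolding partial_fourier_def[symmetric] by auto
  show "partial_fourier f \<in> L2 lborel" by (rule pf)
  show "AE x in lborel. fourier_pair (\<lambda>y. f (x, y)) (\<lambda>\<xi>. partial_fourier f (x, \<xi>))"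
    using pair ae AE_L2_slice_fst[OF pf]
    by eventually_elim (rule fourier_pair_cong_AE[OF conjunct2])
qed

section \<open>Hermite functions\<close>

text \<open>The Hermite function without its normalising constant, so that recurrence and derivative
  have rational coefficients. The constants return in \<open>scaled_hermite_fun_eq\<close>.\<close>

definition hermite_gauss :: "nat \<Rightarrow> real \<Rightarrow> real" where
  "hermite_gauss n u = Hermite_poly n u * exp (- (u\<^sup>2 / 2))"

text \<open>For n = 0 the index \<open>n - 1\<close> is 0 by truncated subtraction, and the factor n
  removes that term.\<close>

lemma Hermite_poly_Suc: "Hermite_poly (Suc n) u = 2 * u * Hermite_poly n u - 2 * real n * Hermite_poly (n - 1) u"
  by (cases n) auto

lemma hermite_gauss_recurrence:
  "u * hermite_gauss n u = hermite_gauss (Suc n) u / 2 + real n * hermite_gauss (n - 1) u"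
  unfolding hermite_gauss_def Hermite_poly_Suc by (simp add: field_simps)

lemma Hermite_poly_has_derivative:
  "(Hermite_poly n has_real_derivative 2 * real n * Hermite_poly (n - 1) u) (at u)"
proof (induction n u rule: Hermite_poly.induct)
  case (1 u)
  have "Hermite_poly 0 = (\<lambda>u. 1)" by auto
  then show ?case by simp
next
  case (2 u)
  have "Hermite_poly (Suc 0) = (\<lambda>u. 2 * u)" by auto
  then show ?case by (auto intro!: derivative_eq_intros)
next
  case (3 n u)
  have eq: "Hermite_poly (Suc (Suc n)) = (\<lambda>u. 2 * u * Hermite_poly (Suc n) u - 2 * real (Suc n) * Hermite_poly n u)"
    by auto
  show ?case unfolding eq
    by (rule derivative_eq_intros 3 refl)+ (simp add: Hermite_poly_Suc[of n] algebra_simps)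
qed

lemma hermite_gauss_has_derivative:
  "(hermite_gauss n has_real_derivative (real n * hermite_gauss (n - 1) u - hermite_gauss (Suc n) u / 2)) (at u)"
proof -
  have "((\<lambda>u. exp (- (u\<^sup>2 / 2))) has_real_derivative (- u * exp (- (u\<^sup>2 / 2)))) (at u)"
    by (auto intro!: derivative_eq_intros)
  from DERIV_mult[OF Hermite_poly_has_derivative[of n u] this] show ?thesis
    unfolding hermite_gauss_def[abs_def]
    by (rule DERIV_cong) (simp add: Hermite_poly_Suc field_simps)
qed

lemma continuous_hermite_gauss: "isCont (hermite_gauss n) u"
  using hermite_gauss_has_derivative by (rule DERIV_isCont)

lemma borel_measurable_hermite_gauss[measurable]: "hermite_gauss n \<in> borel_measurable borel"
  by (intro borel_measurable_continuous_onI continuous_at_imp_continuous_on ballI continuous_hermite_gauss)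

text \<open>Each recursion step multiplies by u, and |u| \<le> exp |u| raises the rate by
  one.\<close>

lemma Hermite_poly_bound: "\<exists>C\<ge>0. \<forall>u. \<bar>Hermite_poly n u\<bar> \<le> C * exp (real n * \<bar>u\<bar>)"
\<comment> \<open>The second argument only fits the shape of the induction rule of
  \<open>Hermite_poly\<close>; the claim depends on n alone.\<close>
proof (induction n "0::real" rule: Hermite_poly.induct)
  case 1
  show ?case by (intro exI[of _ 1]) auto
next
  case 2
  have "\<bar>v\<bar> \<le> exp \<bar>v\<bar>" for v :: real using exp_ge_add_one_self[of "\<bar>v\<bar>"] by linarith
  then show ?case by (intro exI[of _ 2]) (auto simp: abs_mult)
next
  case (3 n)
  obtain C where C: "C \<ge> 0" "\<And>u. \<bar>Hermite_poly (Suc n) u\<bar> \<le> C * exp (real (Suc n) * \<bar>u\<bar>)" using 3 by blast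
  obtain D where D: "D \<ge> 0" "\<And>u. \<bar>Hermite_poly n u\<bar> \<le> D * exp (real n * \<bar>u\<bar>)" using 3 by blast
  have "\<bar>Hermite_poly (Suc (Suc n)) v\<bar> \<le> (2 * C + 2 * real (Suc n) * D) * exp (real (Suc (Suc n)) * \<bar>v\<bar>)" for v
  proof -
    have v: "\<bar>v\<bar> \<le> exp \<bar>v\<bar>" using exp_ge_add_one_self[of "\<bar>v\<bar>"] by linarith
    have "\<bar>Hermite_poly (Suc (Suc n)) v\<bar> \<le> \<bar>2 * v * Hermite_poly (Suc n) v\<bar> + \<bar>2 * real (Suc n) * Hermite_poly n v\<bar>"
      by (simp only: Hermite_poly.simps abs_triangle_ineq4)
    also have "\<dots> = 2 * (\<bar>v\<bar> * \<bar>Hermite_poly (Suc n) v\<bar>) + 2 * real (Suc n) * \<bar>Hermite_poly n v\<bar>"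
      by (simp add: abs_mult)
    also have "\<dots> \<le> 2 * (exp \<bar>v\<bar> * (C * exp (real (Suc n) * \<bar>v\<bar>))) + 2 * real (Suc n) * (D * exp (real (Suc (Suc n)) * \<bar>v\<bar>))"
    proof -
      have "D * exp (real n * \<bar>v\<bar>) \<le> D * exp (real (Suc (Suc n)) * \<bar>v\<bar>)"
        using D(1) by (intro mult_left_mono) (auto intro: mult_right_mono)
      then have "\<bar>Hermite_poly n v\<bar> \<le> D * exp (real (Suc (Suc n)) * \<bar>v\<bar>)" using D(2)[of v] by linarith
      then show ?thesis using C by (intro add_mono mult_left_mono mult_mono v) auto
    qed
    also have "\<dots> = (2 * C + 2 * real (Suc n) * D) * exp (real (Suc (Suc n)) * \<bar>v\<bar>)"
    proof -
      have e: "exp (real (Suc (Suc n)) * \<bar>v\<bar>) = exp \<bar>v\<bar> * exp (real (Suc n) * \<bar>v\<bar>)"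
        by (simp add: mult_exp_exp algebra_simps)
      show ?thesis unfolding e by algebra
    qed
    finally show ?thesis .
  qed
  then show ?case using C(1) D(1) by (intro exI[of _ "2 * C + 2 * real (Suc n) * D"]) auto
qed

text \<open>Half of the Gaussian exponent pays for the linear growth, since (c - |u| / 2)^2 is
  nonnegative.\<close>

lemma exp_linear_gauss_le: "exp (c * \<bar>u\<bar> - u\<^sup>2 / 2) \<le> exp (c\<^sup>2) * exp (- (u\<^sup>2 / 4))" for c u :: real
proof -
  have "0 \<le> (c - \<bar>u\<bar> / 2)\<^sup>2" by simp
  then have "c * \<bar>u\<bar> \<le> c\<^sup>2 + u\<^sup>2 / 4" by (simp add: power2_diff power_divide)
  then show ?thesis by (simp add: exp_add[symmetric])
qed

lemma hermite_gauss_bound: "\<exists>C\<ge>0. \<forall>u. \<bar>hermite_gauss n u\<bar> \<le> C * exp (- (u\<^sup>2 / 4))"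
proof -
  obtain C where C: "C \<ge> 0" "\<And>u. \<bar>Hermite_poly n u\<bar> \<le> C * exp (real n * \<bar>u\<bar>)"
    using Hermite_poly_bound by blast
  have "\<bar>hermite_gauss n u\<bar> \<le> (C * exp ((real n)\<^sup>2)) * exp (- (u\<^sup>2 / 4))" for u
  proof -
    have "\<bar>hermite_gauss n u\<bar> \<le> (C * exp (real n * \<bar>u\<bar>)) * exp (- (u\<^sup>2 / 2))"
      unfolding hermite_gauss_def abs_mult using C by (intro mult_mono) auto
    also have "\<dots> = C * exp (real n * \<bar>u\<bar> - u\<^sup>2 / 2)" by (simp add: mult_exp_exp mult.assoc)
    also have "\<dots> \<le> C * (exp ((real n)\<^sup>2) * exp (- (u\<^sup>2 / 4)))"
      using C(1) exp_linear_gauss_le by (intro mult_left_mono)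
    finally show ?thesis by (simp add: mult_ac)
  qed
  then show ?thesis using C(1) by (intro exI[of _ "C * exp ((real n)\<^sup>2)"]) auto
qed

lemma integrable_gauss_real: "0 < b \<Longrightarrow> integrable lborel (\<lambda>s :: real. exp (- (b * s\<^sup>2)))"
  using integrable_gaussian_real[of "2 * b" 0] by (simp add: complex_of_real_integrable_eq)

lemma gaussian_bounded_L2:
  fixes g :: "real \<Rightarrow> complex"
  assumes [measurable]: "g \<in> borel_measurable borel" and b: "0 < b"
    and le: "\<And>s. cmod (g s) \<le> C * exp (- (b * s\<^sup>2))"
  shows "g \<in> L2 lborel"
proof -
  have C: "0 \<le> C" using order_trans[OF norm_ge_zero le[of 0]] by simp
  have "integrable lborel (\<lambda>s. C * exp (- (b * s\<^sup>2)))" using integrable_gauss_real[OF b] by simp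
  then have int: "integrable lborel g"
    by (rule Bochner_Integration.integrable_bound)
       (auto intro!: AE_I2 order_trans[OF le] simp: C)
  have "C * exp (- (b * s\<^sup>2)) \<le> C * 1" for s
    using C b by (intro mult_left_mono) auto
  then show "g \<in> L2 lborel"
    using le by (intro L2_bounded_integrable[OF int, of C]) (metis mult.right_neutral order_trans)
qed

lemma L2_vec_prod:
  fixes g :: "'m::finite \<Rightarrow> real \<Rightarrow> complex"
  assumes g: "\<And>j. g j \<in> L2 lborel"
  shows "(\<lambda>x :: real^'m. \<Prod>j\<in>UNIV. g j (x $ j)) \<in> L2 lborel"
proof -
  have [measurable]: "g j \<in> borel_measurable borel" for j using L2_borel_measurable[OF g[of j]] by simp
  have "integrable lborel (\<lambda>x :: real^'m. \<Prod>j\<in>UNIV. (cmod (g j (x $ j)))\<^sup>2)"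
    by (rule integrable_lborel_vec_prod[of "\<lambda>j s. (cmod (g j s))\<^sup>2"]) (rule L2_integrable_sq[OF g])
  moreover have "(\<lambda>x :: real^'m. \<Prod>j\<in>UNIV. g j (x $ j)) \<in> borel_measurable borel" by measurable
  ultimately show ?thesis by (simp add: L2_def prod_norm[symmetric] prod_power_distrib[symmetric])
qed

section \<open>Completeness of the Hermite functions\<close>

lemma sum_exp_series_le: "(\<Sum>k<N. x ^ k / fact k) \<le> exp x" if "0 \<le> x" for x :: real
proof -
  have "(\<Sum>k<N. x ^ k /\<^sub>R fact k) \<le> (\<Sum>k. x ^ k /\<^sub>R fact k)"
    using that by (intro sum_le_suminf summable_exp_generic) auto
  then show ?thesis by (simp add: exp_def divide_inverse mult.commute)
qed

text \<open>One variable at a time: the Hermite moments determine the monomial moments, and these determine the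
  Fourier integral through the exponential series.\<close>

lemma hermite_moments_zero_imp_fourier_zero:
  fixes F :: "'a \<Rightarrow> complex" and X :: "'a \<Rightarrow> real" and \<eta> :: real
  assumes [measurable]: "F \<in> borel_measurable M" "X \<in> borel_measurable M"
    and int: "\<And>c. integrable M (\<lambda>x. F x * complex_of_real (exp (c * \<bar>X x\<bar> - (X x)\<^sup>2 / 2)))"
    and zero: "\<And>n. (LINT x|M. F x * complex_of_real (hermite_gauss n (X x))) = 0"
  shows "(LINT x|M. F x * (complex_of_real (exp (- ((X x)\<^sup>2 / 2))) * osc (\<eta> * X x))) = 0"
proof -
  let ?\<mu> = "\<lambda>p n x. F x * complex_of_real (X x ^ p * hermite_gauss n (X x))" and ?e = "\<lambda>x. complex_of_real (exp (- ((X x)\<^sup>2 / 2)))" and ?w = "\<lambda>x. F x * complex_of_real (exp (\<bar>\<eta>\<bar> * \<bar>X x\<bar> - (X x)\<^sup>2 / 2))"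
  have mom_int: "integrable M (\<lambda>x. ?\<mu> p n x)" for p n
  proof -
    obtain C where C: "C \<ge> 0" "\<And>u. \<bar>Hermite_poly n u\<bar> \<le> C * exp (real n * \<bar>u\<bar>)"
      using Hermite_poly_bound by blast
    let ?G = "\<lambda>x. complex_of_real (fact p * C) * (F x * complex_of_real (exp ((1 + real n) * \<bar>X x\<bar> - (X x)\<^sup>2 / 2)))"
    have bound: "\<bar>u ^ p * hermite_gauss n u\<bar> \<le> fact p * C * exp ((1 + real n) * \<bar>u\<bar> - u\<^sup>2 / 2)" for u
    proof -
      \<comment> \<open>A single term of the exponential series bounds |u|^p by p! exp |u|, so
        moments reduce to the exponential integrability assumed in \<open>int\<close>.\<close>
      have "\<bar>u\<bar> ^ p / fact p \<le> (\<Sum>k<Suc p. \<bar>u\<bar> ^ k / fact k)"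
        by (intro member_le_sum[of p "{..<Suc p}" "\<lambda>k. \<bar>u\<bar> ^ k / fact k"]) auto
      then have "\<bar>u\<bar> ^ p / fact p \<le> exp \<bar>u\<bar>" using sum_exp_series_le[of "\<bar>u\<bar>" "Suc p"] by simp
      then have "\<bar>u\<bar> ^ p \<le> fact p * exp \<bar>u\<bar>" by (simp add: field_simps)
      then have "\<bar>u\<bar> ^ p * \<bar>Hermite_poly n u\<bar> * exp (- (u\<^sup>2 / 2)) \<le> (fact p * exp \<bar>u\<bar>) * (C * exp (real n * \<bar>u\<bar>)) * exp (- (u\<^sup>2 / 2))"
        using C by (intro mult_right_mono mult_mono) auto
      also have "\<dots> = fact p * C * exp ((1 + real n) * \<bar>u\<bar> - u\<^sup>2 / 2)"
      proof -
        have e: "(1 + real n) * \<bar>u\<bar> - u\<^sup>2 / 2 = \<bar>u\<bar> + real n * \<bar>u\<bar> + - (u\<^sup>2 / 2)" by (simp add: algebra_simps)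
        show ?thesis unfolding e exp_add by (simp only: mult_ac)
      qed
      finally show ?thesis by (simp add: hermite_gauss_def abs_mult power_abs mult.assoc)
    qed
    have le: "norm (?\<mu> p n x) \<le> norm (?G x)" for x
    proof -
      have "norm (?\<mu> p n x) = cmod (F x) * \<bar>X x ^ p * hermite_gauss n (X x)\<bar>"
        by (simp only: norm_mult norm_of_real)
      also have "\<dots> \<le> cmod (F x) * (fact p * C * exp ((1 + real n) * \<bar>X x\<bar> - (X x)\<^sup>2 / 2))"
        by (intro mult_left_mono bound) simp
      also have "\<dots> = norm (?G x)" using C(1) by (simp add: norm_mult)
      finally show ?thesis .
    qed
    have "integrable M ?G" by (intro integrable_mult_right int)
    then show ?thesis
      by (rule Bochner_Integration.integrable_bound) (use le in auto)
  qed
  \<comment> \<open>The recurrence trades one power of X for the neighbouring Hermite indices, so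
    the induction on p needs all n.\<close>
  have mom: "(LINT x|M. ?\<mu> p n x) = 0" for p n
  proof (induction p arbitrary: n)
    case 0
    then show ?case using zero by simp
  next
    case (Suc p)
    have "(LINT x|M. ?\<mu> (Suc p) n x)
        = (LINT x|M. (1/2) * (?\<mu> p (Suc n) x)
            + of_nat n * (?\<mu> p (n - 1) x))"
    proof (intro Bochner_Integration.integral_cong refl)
      fix x
      have "X x ^ Suc p * hermite_gauss n (X x) = X x ^ p * (X x * hermite_gauss n (X x))" by simp
      also have "\<dots> = 1/2 * (X x ^ p * hermite_gauss (Suc n) (X x)) + real n * (X x ^ p * hermite_gauss (n - 1) (X x))"
        unfolding hermite_gauss_recurrence by (simp add: algebra_simps)
      finally show "?\<mu> (Suc p) n x
        = (1/2) * (?\<mu> p (Suc n) x)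
            + of_nat n * (?\<mu> p (n - 1) x)"
        by (simp add: algebra_simps)
    qed
    also have "\<dots> = 0"
      by (subst Bochner_Integration.integral_add) (auto intro!: integrable_mult_right mom_int simp: Suc.IH simp del: of_real_mult of_real_power)
    finally show ?case .
  qed
  \<comment> \<open>Partial sums of the exponential series of the character;
    \<open>hermite_gauss 0\<close> is the Gaussian weight itself.\<close>
  define S where "S N x = F x * (\<Sum>k<N. (- \<i> * complex_of_real \<eta>) ^ k / fact k * complex_of_real (X x ^ k * hermite_gauss 0 (X x)))" for N x
  have S_zero: "(LINT x|M. S N x) = 0" for N
  proof -
    have "(LINT x|M. S N x) = (LINT x|M. (\<Sum>k<N. (- \<i> * complex_of_real \<eta>) ^ k / fact k * (?\<mu> k 0 x)))"
      unfolding S_def by (simp only: sum_distrib_left mult.left_commute)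
    also have "\<dots> = (\<Sum>k<N. (- \<i> * complex_of_real \<eta>) ^ k / fact k * (LINT x|M. ?\<mu> k 0 x))"
      by (subst Bochner_Integration.integral_sum) (auto intro!: integrable_mult_right mom_int simp del: of_real_mult of_real_power)
    finally show ?thesis by (simp only: mom) simp
  qed
  have S_eq: "S N x = F x * (?e x * (\<Sum>k<N. (- \<i> * complex_of_real (\<eta> * X x)) ^ k / fact k))" for N x
  proof -
    have "(\<Sum>k<N. (- \<i> * complex_of_real \<eta>) ^ k / fact k * complex_of_real (X x ^ k * hermite_gauss 0 (X x)))
       = ?e x * (\<Sum>k<N. (- \<i> * complex_of_real (\<eta> * X x)) ^ k / fact k)"
    proof -
      have "(- \<i> * complex_of_real (\<eta> * X x)) ^ k = (- \<i> * complex_of_real \<eta>) ^ k * complex_of_real (X x ^ k)" for k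
        by (simp only: of_real_mult of_real_power mult.assoc[symmetric] power_mult_distrib)
      then show ?thesis by (simp add: hermite_gauss_def sum_distrib_left mult_ac)
    qed
    then show ?thesis by (simp add: S_def)
  qed
  have "(\<lambda>N. LINT x|M. S N x) \<longlonglongrightarrow> (LINT x|M. F x * (?e x * osc (\<eta> * X x)))"
  \<comment> \<open>Partial sums of the series at an imaginary argument are bounded by the
    exponential of its modulus, uniformly in N.\<close>
  proof (rule integral_dominated_convergence[where w="\<lambda>x. cmod (?w x)"])
    show "integrable M (\<lambda>x. cmod (?w x))"
      by (intro integrable_norm int)
    show "AE x in M. (\<lambda>N. S N x) \<longlonglongrightarrow> F x * (?e x * osc (\<eta> * X x))"
    proof (rule AE_I2)
      fix x
      have "(\<lambda>N. \<Sum>k<N. z ^ k / fact k) \<longlonglongrightarrow> exp z" for z :: complex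
        using exp_converges[of z] by (simp add: sums_def scaleR_conv_of_real divide_inverse mult.commute)
      then show "(\<lambda>N. S N x) \<longlonglongrightarrow> F x * (?e x * osc (\<eta> * X x))"
        unfolding S_eq by (intro tendsto_intros)
    qed
    show "AE x in M. norm (S N x) \<le> cmod (?w x)" for N
    proof (rule AE_I2)
      fix x
      have "cmod (\<Sum>k<N. (- \<i> * complex_of_real (\<eta> * X x)) ^ k / fact k) \<le> (\<Sum>k<N. \<bar>\<eta> * X x\<bar> ^ k / fact k)"
        by (rule order_trans[OF norm_sum]) (simp add: norm_divide norm_power norm_mult abs_mult)
      also have "\<dots> \<le> exp \<bar>\<eta> * X x\<bar>" by (rule sum_exp_series_le) simp
      finally have "exp (- ((X x)\<^sup>2 / 2)) * cmod (\<Sum>k<N. (- \<i> * complex_of_real (\<eta> * X x)) ^ k / fact k) \<le> exp (- ((X x)\<^sup>2 / 2)) * exp \<bar>\<eta> * X x\<bar>"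
        by (intro mult_left_mono) auto
      then have le: "exp (- ((X x)\<^sup>2 / 2)) * cmod (\<Sum>k<N. (- \<i> * complex_of_real (\<eta> * X x)) ^ k / fact k) \<le> exp (\<bar>\<eta>\<bar> * \<bar>X x\<bar> - (X x)\<^sup>2 / 2)"
        by (simp only: mult_exp_exp abs_mult uminus_add_conv_diff)
      show "norm (S N x) \<le> cmod (?w x)"
        unfolding S_eq norm_mult norm_of_real abs_exp_cancel using le by (intro mult_left_mono) auto
    qed
  qed (auto simp: S_def)
  then show ?thesis by (simp add: S_zero LIMSEQ_const_iff)
qed

lemma scaled_hermite_fun_eq:
  assumes "0 < \<tau>"
  shows "scaled_hermite_fun k \<tau> (x :: real^'m) = \<tau> powr (real CARD('m) / 4) *
    (\<Prod>j\<in>UNIV. (2 ^ (k $ j) * fact (k $ j) * sqrt pi) powr (- 1 / 2)) * (\<Prod>j\<in>UNIV. hermite_gauss (k $ j) (sqrt \<tau> * x $ j))"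
  using assms
  by (simp add: scaled_hermite_fun_def hermite_fun_vec_def hermite_fun_def hermite_gauss_def
      prod.distrib powr_half_sqrt mult.assoc)

text \<open>Hermite factors are replaced by Gaussian-weighted characters one coordinate at a time.
  When all are replaced, the Fourier integrals of f times a Gaussian vanish, and uniqueness in L1
  applies.\<close>

theorem scaled_hermite_complete:
  fixes f :: "real^'m \<Rightarrow> complex"
  assumes f: "f \<in> L2 lborel" and \<tau>: "0 < \<tau>"
    and zero: "\<And>k. (LINT x|lborel. f x * complex_of_real (scaled_hermite_fun k \<tau> x)) = 0"
  shows "AE x in lborel. f x = 0"
proof -
  define a where "a = sqrt \<tau>"
  have a: "0 < a" using \<tau> by (simp add: a_def)
  have [measurable]: "f \<in> borel_measurable borel" using L2_borel_measurable[OF f] by simp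
  define E where "E \<eta> s = complex_of_real (exp (- (s\<^sup>2 / 2))) * osc (\<eta> * s)" for \<eta> s :: real
  have [measurable]: "E \<eta> \<in> borel_measurable borel" for \<eta> unfolding E_def by measurable
  \<comment> \<open>The hybrid factor: already a character for coordinates in J, still a Hermite
    function for the others.\<close>
  define \<psi> where "\<psi> J k \<eta> j s = (if j \<in> J then E (\<eta> j) (a * s) else complex_of_real (hermite_gauss (k j) (a * s)))"
    for J and k :: "'m \<Rightarrow> nat" and \<eta> :: "'m \<Rightarrow> real" and j and s :: real
  have \<psi>_meas[measurable]: "\<psi> J k \<eta> j \<in> borel_measurable borel" for J k \<eta> j
    unfolding \<psi>_def by (cases "j \<in> J") (simp_all, measurable)
  have L2_scaled: "(\<lambda>s. g (a * s)) \<in> L2 lborel" if [measurable]: "g \<in> borel_measurable borel"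
    and "\<And>s. cmod (g s) \<le> C * exp (- (s\<^sup>2 / 4))" for g C
    using a that(2)[of "a * _"]
    by (intro gaussian_bounded_L2[of _ "a\<^sup>2 / 4" C]) (auto simp: power_mult_distrib)
  have exp4: "exp (- (s\<^sup>2 / 2)) \<le> exp (- (s\<^sup>2 / 4))" for s :: real by simp
  have \<psi>_L2: "\<psi> J k \<eta> j \<in> L2 lborel" for J k \<eta> j
  proof (cases "j \<in> J")
    case True
    have "(\<lambda>s. E (\<eta> j) (a * s)) \<in> L2 lborel"
      by (rule L2_scaled[where C=1]) (auto simp: E_def norm_mult)
    then show ?thesis using True by (simp add: \<psi>_def[abs_def])
  next
    case False
    obtain C where "\<And>u. \<bar>hermite_gauss (k j) u\<bar> \<le> C * exp (- (u\<^sup>2 / 4))"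
      using hermite_gauss_bound by blast
    then have "(\<lambda>s. complex_of_real (hermite_gauss (k j) (a * s))) \<in> L2 lborel"
      by (intro L2_scaled[of "\<lambda>s. complex_of_real (hermite_gauss (k j) s)" C]) auto
    then show ?thesis using False by (simp add: \<psi>_def[abs_def])
  qed
  have "(LINT x|lborel. f x * (\<Prod>j\<in>UNIV. \<psi> J k \<eta> j (x $ j))) = 0" if "finite J" for J k \<eta>
    using that
  \<comment> \<open>The indices stay free because replacing coordinate i uses the vanishing for
    every Hermite index at i.\<close>
  proof (induction J arbitrary: k rule: finite_induct)
    case empty
    have "\<tau> powr (real CARD('m) / 4) * (\<Prod>j\<in>UNIV. (2 ^ k j * fact (k j) * sqrt pi) powr (- 1 / 2)) \<noteq> 0"
      using \<tau> by simp
    then show ?case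
      using zero[of "\<chi> j. k j"] unfolding scaled_hermite_fun_eq[OF \<tau>] \<psi>_def a_def
      by (simp add: mult.left_commute[of "f _"] mult.assoc)
  next
    case (insert i J)
    define F where "F x = f x * (\<Prod>j\<in>UNIV-{i}. \<psi> J k \<eta> j (x $ j))" for x :: "real^'m"
    have [measurable]: "F \<in> borel_measurable borel" unfolding F_def by measurable
    have upd: "(\<Prod>j\<in>UNIV-{i}. \<psi> J (k(i:=n)) \<eta> j (x $ j)) = (\<Prod>j\<in>UNIV-{i}. \<psi> J k \<eta> j (x $ j))" for n and x :: "real^'m"
      by (intro prod.cong refl) (auto simp: \<psi>_def)
    have ins: "(\<Prod>j\<in>UNIV-{i}. \<psi> (insert i J) k \<eta> j (x $ j)) = (\<Prod>j\<in>UNIV-{i}. \<psi> J k \<eta> j (x $ j))" for x :: "real^'m"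
      by (intro prod.cong refl) (auto simp: \<psi>_def)
    have split: "(\<Prod>j\<in>UNIV. h j) = h i * (\<Prod>j\<in>UNIV-{i}. h j)" for h :: "'m \<Rightarrow> complex"
      by (rule prod.remove) auto
    have "(LINT x|lborel. F x * E (\<eta> i) (a * x $ i)) = 0"
      unfolding E_def
    proof (rule hermite_moments_zero_imp_fourier_zero)
      fix n
      have "F x * complex_of_real (hermite_gauss n (a * x $ i)) = f x * (\<Prod>j\<in>UNIV. \<psi> J (k(i:=n)) \<eta> j (x $ j))" for x
        using insert.hyps unfolding split upd by (simp add: F_def \<psi>_def)
      then show "(LINT x|lborel. F x * complex_of_real (hermite_gauss n (a * x $ i))) = 0"
        using insert.IH by simp
    next
      fix c
      \<comment> \<open>Only the factor at i changes, and it keeps a Gaussian bound. The product is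
        therefore still in L2, and its product with f is integrable.\<close>
      define g where "g j s = (if j = i then complex_of_real (exp (c * \<bar>a * s\<bar> - (a * s)\<^sup>2 / 2)) else \<psi> J k \<eta> j s)" for j s
      have "(\<lambda>s. complex_of_real (exp (c * \<bar>a * s\<bar> - (a * s)\<^sup>2 / 2))) \<in> L2 lborel"
        using exp_linear_gauss_le
        by (intro L2_scaled[of "\<lambda>s. complex_of_real (exp (c * \<bar>s\<bar> - s\<^sup>2 / 2))" "exp (c\<^sup>2)"]) auto
      then have "g j \<in> L2 lborel" for j
        using \<psi>_L2 by (cases "j = i") (simp_all add: g_def[abs_def])
      then have "(\<lambda>x :: real^'m. \<Prod>j\<in>UNIV. g j (x $ j)) \<in> L2 lborel" by (rule L2_vec_prod)
      from L2_mult_integrable[OF f this]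
      have "integrable lborel (\<lambda>x. f x * (\<Prod>j\<in>UNIV. g j (x $ j)))" .
      moreover have "f x * (\<Prod>j\<in>UNIV. g j (x $ j)) = F x * complex_of_real (exp (c * \<bar>a * x $ i\<bar> - (a * x $ i)\<^sup>2 / 2))" for x
      proof -
        have "(\<Prod>j\<in>UNIV-{i}. g j (x $ j)) = (\<Prod>j\<in>UNIV-{i}. \<psi> J k \<eta> j (x $ j))"
          by (intro prod.cong refl) (auto simp: g_def)
        then show ?thesis unfolding split by (simp add: F_def g_def mult_ac)
      qed
      ultimately show "integrable lborel (\<lambda>x. F x * complex_of_real (exp (c * \<bar>a * x $ i\<bar> - (a * x $ i)\<^sup>2 / 2)))"
        by simp
    qed measurable
    moreover have "f x * (\<Prod>j\<in>UNIV. \<psi> (insert i J) k \<eta> j (x $ j)) = F x * E (\<eta> i) (a * x $ i)" for x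
      unfolding split ins by (simp add: F_def \<psi>_def mult_ac)
    ultimately show ?case by simp
  qed
  from this[of UNIV] have zero': "(LINT x|lborel. f x * (\<Prod>j\<in>UNIV. E (\<eta> j) (a * x $ j))) = 0" for \<eta> :: "'m \<Rightarrow> real"
    by (simp add: \<psi>_def)
  define G where "G x = complex_of_real (exp (- (\<tau> * (norm x)\<^sup>2 / 2)))" for x :: "real^'m"
  have "G \<in> L2 lborel"
    unfolding G_def[abs_def]
    by (rule L2_bounded_integrable[where B=1])
       (use integrable_gaussian_norm[OF \<tau>] \<tau> in \<open>auto simp: complex_of_real_integrable_eq\<close>)
  then have "integrable lborel (\<lambda>x. f x * G x)" by (rule L2_mult_integrable[OF f])
  then have "AE x in lborel. f x * G x = 0"
  proof (rule integrable_fourier_unique)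
    fix \<zeta> :: "real^'m"
    \<comment> \<open>Dividing the frequency by a undoes the dilation of the variable.\<close>
    have "(\<Prod>j\<in>UNIV. E (\<zeta> $ j / a) (a * x $ j)) = G x * osc (\<zeta> \<bullet> x)" for x
    proof -
      have "(\<Prod>j\<in>UNIV. E (\<zeta> $ j / a) (a * x $ j)) = (\<Prod>j\<in>UNIV. complex_of_real (exp (- ((a * x $ j)\<^sup>2 / 2)))) *
          (\<Prod>j\<in>UNIV. osc (\<zeta> $ j * x $ j))"
        unfolding E_def prod.distrib using a by simp
      also have "(\<Prod>j\<in>UNIV. complex_of_real (exp (- ((a * x $ j)\<^sup>2 / 2)))) = G x"
        using \<tau> by (simp add: G_def norm_vec_sq a_def power_mult_distrib exp_sum[symmetric] sum_distrib_left
            sum_divide_distrib sum_negf flip: of_real_prod)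
      also have "(\<Prod>j\<in>UNIV. osc (\<zeta> $ j * x $ j)) = osc (\<zeta> \<bullet> x)"
        by (simp add: exp_sum[symmetric] inner_vec_def sum_distrib_left sum_negf)
      finally show ?thesis .
    qed
    then show "(LINT x|lborel. f x * G x * osc (\<zeta> \<bullet> x)) = 0"
      using zero'[of "\<lambda>j. \<zeta> $ j / a"] by (simp add: mult.assoc)
  qed
  then show ?thesis by eventually_elim (simp add: G_def)
qed

section \<open>Mehler's kernel\<close>

text \<open>One coordinate of Mehler's kernel without its prefactor, in the rotated variables x + y
  and x - y of the heat kernel.\<close>

definition mehler_exp :: "real \<Rightarrow> real \<Rightarrow> real \<Rightarrow> real" where
  "mehler_exp s x y = exp (- (1 / 4) * (tanh s * (x + y)\<^sup>2 + coth s * (x - y)\<^sup>2))"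

text \<open>The identities tanh s + coth s = 2 coth (2 s) and coth s - tanh s = 2 / sinh (2 s) give
  the classical form, which is easier to differentiate and to complete to a square.\<close>

lemma mehler_exp_bilinear:
  fixes s x y :: real
  assumes s: "0 < s"
  defines "A \<equiv> cosh (2 * s) / sinh (2 * s)" and "B \<equiv> 1 / sinh (2 * s)"
  shows "mehler_exp s x y = exp (- (A / 2) * (x\<^sup>2 + y\<^sup>2) + B * x * y)"
proof -
  have pos: "0 < sinh s" "0 < cosh s" using s by auto
  have one: "(cosh s)\<^sup>2 = 1 + (sinh s)\<^sup>2" by (simp add: cosh_square_eq)
  have A: "A * 2 = tanh s + coth s"
    unfolding A_def tanh_def coth_def sinh_double cosh_double
    using pos by (simp add: field_simps power2_eq_square)
  have B: "B * 2 = coth s - tanh s"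
    unfolding B_def tanh_def coth_def sinh_double
    using pos one by (simp add: field_simps power2_eq_square)
  have "- (1 / 4) * (tanh s * (x + y)\<^sup>2 + coth s * (x - y)\<^sup>2)
      = - ((tanh s + coth s) / 4) * (x\<^sup>2 + y\<^sup>2) + (coth s - tanh s) / 2 * x * y"
    by (simp add: power2_eq_square field_simps)
  then show ?thesis unfolding mehler_exp_def A[symmetric] B[symmetric] by simp
qed

lemma tanh_nonneg: "0 \<le> s \<Longrightarrow> 0 \<le> tanh (s :: real)"
  by (simp add: tanh_def)

lemma coth_nonneg: "0 \<le> s \<Longrightarrow> 0 \<le> coth s"
  by (simp add: coth_def)

lemma mehler_exp_le_1: "0 \<le> s \<Longrightarrow> mehler_exp s x y \<le> 1"
  by (simp add: mehler_exp_def tanh_nonneg coth_nonneg)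

section \<open>Hermite functions as eigenfunctions of Mehler's kernel\<close>

lemma integral_derivative_eq_0:
  fixes F f :: "real \<Rightarrow> real"
  assumes F: "\<And>x. (F has_real_derivative f x) (at x)" and f: "\<And>x. isCont f x"
    and int: "integrable lborel f" and lim: "(F \<longlongrightarrow> 0) at_top" "(F \<longlongrightarrow> 0) at_bot"
  shows "(LINT x|lborel. f x) = 0"
proof -
  have "(LBINT x=-\<infinity>..\<infinity>. f x) = 0 - 0"
  proof (rule interval_integral_FTC_integrable[where F=F])
    show "(F has_vector_derivative f x) (at x)" for x
      using F[of x] by (simp add: has_real_derivative_iff_has_vector_derivative)
    show "set_integrable lborel (einterval (-\<infinity>) \<infinity>) f"
      using int by (simp add: set_integrable_def einterval_def)
    show "((F \<circ> real_of_ereal) \<longlongrightarrow> 0) (at_right (-\<infinity>))" "((F \<circ> real_of_ereal) \<longlongrightarrow> 0) (at_left \<infinity>)"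
      using lim by (simp_all add: ereal_tendsto_simps1)
  qed (use f in auto)
  then show ?thesis by (simp add: interval_lebesgue_integral_def set_lebesgue_integral_def einterval_def)
qed

lemma tendsto_0_gaussian_bound:
  fixes F :: "real \<Rightarrow> real"
  assumes "\<And>x. \<bar>F x\<bar> \<le> C * exp (- (x\<^sup>2 / 4))"
  shows "(F \<longlongrightarrow> 0) at_top" "(F \<longlongrightarrow> 0) at_bot"
proof -
  have "filterlim (\<lambda>x :: real. x\<^sup>2) at_top at_top"
    by (intro filterlim_pow_at_top filterlim_ident) simp
  then have "filterlim (\<lambda>x :: real. 1 / 4 * x\<^sup>2) at_top at_top"
    by (rule filterlim_tendsto_pos_mult_at_top[OF tendsto_const, rotated]) simp
  then have "filterlim (\<lambda>x :: real. - (1 / 4 * x\<^sup>2)) at_bot at_top"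
    by (simp add: filterlim_uminus_at_top)
  then have "((\<lambda>x :: real. exp (- (1 / 4 * x\<^sup>2))) \<longlongrightarrow> 0) at_top"
    by (rule filterlim_compose[OF exp_at_bot])
  then have "((\<lambda>x :: real. C * exp (- (x\<^sup>2 / 4))) \<longlongrightarrow> C * 0) at_top"
    by (intro tendsto_mult tendsto_const) simp
  then have lim: "((\<lambda>x :: real. C * exp (- (x\<^sup>2 / 4))) \<longlongrightarrow> 0) at_top" by simp
  have top: "(G \<longlongrightarrow> 0) at_top" if "\<And>x. \<bar>G x\<bar> \<le> C * exp (- (x\<^sup>2 / 4))" for G :: "real \<Rightarrow> real"
    by (rule Lim_null_comparison[OF _ lim]) (use that in auto)
  show "(F \<longlongrightarrow> 0) at_top" by (rule top[OF assms])
  have "\<bar>F (- x)\<bar> \<le> C * exp (- (x\<^sup>2 / 4))" for x using assms[of "- x"] by simp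
  from top[OF this] show "(F \<longlongrightarrow> 0) at_bot" by (simp add: filterlim_at_bot_mirror)
qed

lemma integrable_hermite_gauss_mult:
  assumes [measurable]: "g \<in> borel_measurable borel" and "\<And>x. \<bar>g x\<bar> \<le> 1"
  shows "integrable lborel (\<lambda>x :: real. g x * hermite_gauss n x)"
proof -
  obtain C where C: "\<And>u. \<bar>hermite_gauss n u\<bar> \<le> C * exp (- (u\<^sup>2 / 4))"
    using hermite_gauss_bound by blast
  have "integrable lborel (\<lambda>u :: real. C * exp (- (u\<^sup>2 / 4)))"
    using integrable_gauss_real[of "1 / 4"] by simp
  then show ?thesis
  proof (rule Bochner_Integration.integrable_bound)
    have "\<bar>g x\<bar> * \<bar>hermite_gauss n x\<bar> \<le> 1 * (C * exp (- (x\<^sup>2 / 4)))" for x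
      using assms(2) C order_trans[OF abs_ge_zero C[of x]] by (intro mult_mono) auto
    then have "norm (g x * hermite_gauss n x) \<le> norm (C * exp (- (x\<^sup>2 / 4)))" for x
      unfolding real_norm_def abs_mult[of "g x"] mult_1 by (rule order_trans[OF _ abs_ge_self])
    then show "AE x in lborel. norm (g x * hermite_gauss n x) \<le> norm (C * exp (- (x\<^sup>2 / 4)))"
      by (intro AE_I2)
  qed measurable
qed

text \<open>Integrating by parts turns the three-term recurrence of the Hermite functions into one for their
  integrals against Mehler's kernel.\<close>

lemma integral_mehler_exp_hermite_gauss:
  fixes s y :: real
  assumes s: "0 < s"
  shows "integrable lborel (\<lambda>x. mehler_exp s x y * hermite_gauss n x)"
    and "(LINT x|lborel. mehler_exp s x y * hermite_gauss n x)
      = sqrt (2 * pi * sinh (2 * s)) * exp (- (2 * real n + 1) * s) * hermite_gauss n y"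
proof -
  define A B where "A = cosh (2 * s) / sinh (2 * s)" and "B = 1 / sinh (2 * s)"
  have sh: "0 < sinh (2 * s)" using s by simp
  have A: "0 < A" using sh by (simp add: A_def)
  have K: "mehler_exp s = (\<lambda>x y. exp (- (A / 2) * (x\<^sup>2 + y\<^sup>2) + B * x * y))"
    using mehler_exp_bilinear[OF s] by (auto simp: A_def B_def)
  have shch: "sinh (2 * s) + cosh (2 * s) = exp (2 * s)" by (simp add: sinh_plus_cosh)
  have chsh: "cosh (2 * s) - sinh (2 * s) = exp (- (2 * s))" by (simp add: cosh_minus_sinh)
  have A1: "1 + A = exp (2 * s) / sinh (2 * s)"
    unfolding A_def shch[symmetric] using sh by (simp add: field_simps)
  have A2: "1 - A = - exp (- (2 * s)) / sinh (2 * s)"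
    unfolding A_def chsh[symmetric] using sh by (simp add: field_simps)
  \<comment> \<open>These two ratios are the coefficients of the recurrence solved for I (Suc n).
    The second is minus the square of the first, which is why each index step contributes one factor
    exp (- 2 s).\<close>
  have B1: "B / (1 + A) = exp (- (2 * s))"
    unfolding A1 B_def using sh by (simp add: exp_minus field_simps)
  have A21: "(1 - A) / (1 + A) = - (exp (- (2 * s)))\<^sup>2"
    unfolding A1 A2 using sh by (simp add: exp_minus field_simps power2_eq_square)
  have K_meas[measurable]: "(\<lambda>x. mehler_exp s x y) \<in> borel_measurable borel" for y
    unfolding K by measurable
  have K_le: "\<bar>mehler_exp s x y\<bar> \<le> 1" for x y
    using mehler_exp_le_1[of s x y] s by (simp add: mehler_exp_def)
  have int: "integrable lborel (\<lambda>x. mehler_exp s x y * hermite_gauss n x)" for n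
    by (rule integrable_hermite_gauss_mult) (use K_le in auto)
  then show "integrable lborel (\<lambda>x. mehler_exp s x y * hermite_gauss n x)" .
  define I where "I n = (LINT x|lborel. mehler_exp s x y * hermite_gauss n x)" for n
  have rec: "(1 + A) * I (Suc n) = 2 * B * y * I n + 2 * real n * (1 - A) * I (n - 1)" for n
  proof -
    obtain C where C: "\<And>u. \<bar>hermite_gauss n u\<bar> \<le> C * exp (- (u\<^sup>2 / 4))"
      using hermite_gauss_bound by blast
    let ?F = "\<lambda>x. mehler_exp s x y * hermite_gauss n x"
    let ?f = "\<lambda>x. - ((1 + A) / 2) * (mehler_exp s x y * hermite_gauss (Suc n) x)
        + B * y * (mehler_exp s x y * hermite_gauss n x) + real n * (1 - A) * (mehler_exp s x y * hermite_gauss (n - 1) x)"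
    have "(LINT x|lborel. ?f x) = 0"
    proof (rule integral_derivative_eq_0)
      fix x
      have "((\<lambda>x. mehler_exp s x y) has_real_derivative (mehler_exp s x y * (- A * x + B * y))) (at x)"
        unfolding K by (auto intro!: derivative_eq_intros)
      from DERIV_mult[OF this hermite_gauss_has_derivative[of n x]]
      have "(?F has_real_derivative mehler_exp s x y *
          (- A * (x * hermite_gauss n x) + B * y * hermite_gauss n x + real n * hermite_gauss (n - 1) x - hermite_gauss (Suc n) x / 2)) (at x)"
        by (rule DERIV_cong) (simp add: algebra_simps)
      then show "(?F has_real_derivative ?f x) (at x)"
        unfolding hermite_gauss_recurrence by (rule DERIV_cong) (simp add: field_simps)
      have "isCont (\<lambda>x. mehler_exp s x y) x" unfolding K by (intro continuous_intros)
      then show "isCont ?f x" by (intro continuous_intros continuous_hermite_gauss)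
    next
      show "integrable lborel ?f"
        by (intro Bochner_Integration.integrable_add integrable_mult_right int)
      have "\<bar>?F x\<bar> \<le> C * exp (- (x\<^sup>2 / 4))" for x
      proof -
        have "\<bar>mehler_exp s x y\<bar> * \<bar>hermite_gauss n x\<bar> \<le> 1 * (C * exp (- (x\<^sup>2 / 4)))"
          using K_le C order_trans[OF abs_ge_zero C[of x]] by (intro mult_mono) auto
        then show ?thesis by (simp add: abs_mult)
      qed
      then show "(?F \<longlongrightarrow> 0) at_top" "(?F \<longlongrightarrow> 0) at_bot" by (rule tendsto_0_gaussian_bound)+
    qed
    also have "(LINT x|lborel. ?f x) = - ((1 + A) / 2) * I (Suc n) + B * y * I n + real n * (1 - A) * I (n - 1)"
      unfolding I_def using int
      by (simp only: Bochner_Integration.integral_add integral_mult_right_zero Bochner_Integration.integrable_add integrable_mult_right)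
    finally show ?thesis by (simp add: field_simps)
  qed
  define w where "w = exp (- (2 * s))"
  have A1_pos: "0 < 1 + A" using A by simp
  have rec': "I (Suc n) = w * (2 * y * I n) - w\<^sup>2 * (2 * real n * I (n - 1))" for n
  proof -
    have "I (Suc n) = (B / (1 + A)) * (2 * y * I n) + ((1 - A) / (1 + A)) * (2 * real n * I (n - 1))"
    proof -
      have "I (Suc n) = (2 * B * y * I n + 2 * real n * (1 - A) * I (n - 1)) / (1 + A)"
        unfolding rec[symmetric] using A1_pos by simp
      then show ?thesis by (simp add: add_divide_distrib mult_ac)
    qed
    then show ?thesis unfolding B1 A21 w_def by simp
  qed
  have I0: "I 0 = sqrt (2 * pi * sinh (2 * s)) * exp (- s) * hermite_gauss 0 y"
  proof -
    \<comment> \<open>Completing the square in x centres the Gaussian at \<open>?m\<close>; the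
      coefficient A - 1 of the remaining y^2 comes from B^2 / (1 + A) = A - 1.\<close>
    let ?m = "B * y / (1 + A)"
    have sq: "mehler_exp s x y * hermite_gauss 0 x = exp (- (y\<^sup>2 / 2)) * exp (- ((1 + A) * (- ?m + x)\<^sup>2 / 2))" for x
    proof -
      have w2: "B * B / (1 + A) = A - 1"
      proof -
        have "B * (B / (1 + A)) = exp (- (2 * s)) / sinh (2 * s)" unfolding B1 by (simp add: B_def)
        also have "\<dots> = A - 1" using A2 by simp
        finally show ?thesis by simp
      qed
      have "(1 + A) * (- ?m + x)\<^sup>2 = (1 + A) * x\<^sup>2 - 2 * B * y * x + (B * B / (1 + A)) * y\<^sup>2"
      proof -
        have m: "(1 + A) * ?m = B * y" using A1_pos by simp
        have "(1 + A) * (- ?m + x)\<^sup>2 = (1 + A) * x\<^sup>2 - 2 * ((1 + A) * ?m) * x + ((1 + A) * ?m) * ?m"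
          unfolding power2_eq_square by algebra
        then show ?thesis unfolding m by (simp add: power2_eq_square mult_ac)
      qed
      also have "\<dots> = (1 + A) * x\<^sup>2 - 2 * B * y * x + (A - 1) * y\<^sup>2" unfolding w2 ..
      finally have "- (y\<^sup>2 / 2) + - ((1 + A) * (- ?m + x)\<^sup>2 / 2) = - (A / 2) * (x\<^sup>2 + y\<^sup>2) + B * x * y + - (x\<^sup>2 / 2)"
        by (simp add: field_simps)
      then show ?thesis unfolding K hermite_gauss_def mult_exp_exp by (simp add: mult_exp_exp)
    qed
    have "complex_of_real (LINT x|lborel. exp (- ((1 + A) * x\<^sup>2 / 2))) = complex_of_real (sqrt (2 * pi / (1 + A)))"
      using integral_gaussian_real[OF A1_pos, of 0] by simp
    then have gauss: "(LINT x|lborel. exp (- ((1 + A) * x\<^sup>2 / 2))) = sqrt (2 * pi / (1 + A))" by (simp only: of_real_eq_iff)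
    have "I 0 = exp (- (y\<^sup>2 / 2)) * (LINT x|lborel. exp (- ((1 + A) * (- ?m + x)\<^sup>2 / 2)))"
      unfolding I_def sq by simp
    also have "(LINT x|lborel. exp (- ((1 + A) * (- ?m + x)\<^sup>2 / 2))) = sqrt (2 * pi / (1 + A))"
      using lborel_integral_translate[of "\<lambda>x :: real. exp (- ((1 + A) * x\<^sup>2 / 2))" "- ?m"] gauss by simp
    also have "2 * pi / (1 + A) = (2 * pi * sinh (2 * s)) * (exp (- s))\<^sup>2"
      unfolding A1 using sh by (simp add: exp_minus field_simps power2_eq_square mult_exp_exp)
    finally show ?thesis by (simp add: real_sqrt_mult hermite_gauss_def mult_ac)
  qed
  define c where "c = sqrt (2 * pi * sinh (2 * s)) * exp (- s)"
  \<comment> \<open>The recurrence has order two, so two consecutive indices are carried.\<close>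
  have "I n = c * w ^ n * hermite_gauss n y \<and> I (Suc n) = c * w ^ Suc n * hermite_gauss (Suc n) y" for n
  proof (induction n)
    case 0
    show ?case using rec'[of 0] I0 by (simp add: c_def hermite_gauss_def)
  next
    case (Suc n)
    have h: "hermite_gauss (Suc (Suc n)) y = 2 * y * hermite_gauss (Suc n) y - 2 * real (Suc n) * hermite_gauss n y"
      using hermite_gauss_recurrence[of y "Suc n"] by (simp add: field_simps)
    have "I (Suc (Suc n)) = w * (2 * y * I (Suc n)) - w\<^sup>2 * (2 * real (Suc n) * I n)"
      using rec'[of "Suc n"] by simp
    also have "\<dots> = c * w ^ Suc (Suc n) * hermite_gauss (Suc (Suc n)) y"
      unfolding h Suc.IH[THEN conjunct1] Suc.IH[THEN conjunct2] by (simp add: power2_eq_square algebra_simps)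
    finally show ?case using Suc.IH by simp
  qed
  then have "I n = sqrt (2 * pi * sinh (2 * s)) * (exp (- s) * w ^ n) * hermite_gauss n y"
    by (simp add: c_def)
  also have "exp (- s) * w ^ n = exp (- (2 * real n + 1) * s)"
    by (simp add: w_def exp_of_nat_mult[symmetric] mult_exp_exp algebra_simps)
  finally show "(LINT x|lborel. mehler_exp s x y * hermite_gauss n x)
      = sqrt (2 * pi * sinh (2 * s)) * exp (- (2 * real n + 1) * s) * hermite_gauss n y"
    by (simp add: I_def)
qed

text \<open>The kernel at time t of the semigroup generated by the Hermite operator -\<Delta> +
  \<tau>^2 |x|^2. At \<tau> = 0 the \<open>powr\<close> factor is 0 by convention, so the bounds
  below also cover \<xi> = 0.\<close>

definition mehler :: "real \<Rightarrow> real \<Rightarrow> real^'m \<Rightarrow> real^'m \<Rightarrow> real" where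
  "mehler t \<tau> x y = (\<tau> / (2 * pi * sinh (2 * (t * \<tau>)))) powr (real CARD('m) / 2) *
     exp (- (\<tau> / 4) * ((norm (x + y))\<^sup>2 * tanh (t * \<tau>) + (norm (x - y))\<^sup>2 * coth (t * \<tau>)))"

lemma mehler_eq_prod:
  fixes x y :: "real^'m"
  assumes "0 < \<tau>"
  shows "exp (- (\<tau> / 4) * ((norm (x + y))\<^sup>2 * tanh s + (norm (x - y))\<^sup>2 * coth s))
    = (\<Prod>j\<in>UNIV. mehler_exp s (sqrt \<tau> * x $ j) (sqrt \<tau> * y $ j))"
proof -
  have "(sqrt \<tau> * a + sqrt \<tau> * b)\<^sup>2 = \<tau> * (a + b)\<^sup>2" "(sqrt \<tau> * a - sqrt \<tau> * b)\<^sup>2 = \<tau> * (a - b)\<^sup>2" for a b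
    using assms by (simp_all add: power_mult_distrib flip: distrib_left right_diff_distrib)
  then have "mehler_exp s (sqrt \<tau> * a) (sqrt \<tau> * b) = exp (- (\<tau> / 4) * ((a + b)\<^sup>2 * tanh s + (a - b)\<^sup>2 * coth s))" for a b
    unfolding mehler_exp_def by (simp only:) (simp add: field_simps)
  then show ?thesis
    by (simp only: exp_sum[OF finite, symmetric] norm_vec_sq sum_distrib_left[symmetric] sum.distrib
        sum_distrib_right[symmetric] vector_add_component vector_minus_component)
qed

text \<open>After dilation by sqrt \<tau> both factors split over the coordinates. The prefactor of
  \<open>mehler\<close> cancels the constant \<open>?q / a\<close> that each coordinate contributes,
  and the one-dimensional exponents add up to the eigenvalue.\<close>

theorem integral_mehler_scaled_hermite_fun:
  fixes y :: "real^'m"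
  assumes t: "0 < t" and \<tau>: "0 < \<tau>"
  shows "(LINT x|lborel. mehler t \<tau> x y * scaled_hermite_fun k \<tau> x)
    = exp (- t * (real (2 * (\<Sum>j\<in>UNIV. k $ j) + CARD('m)) * \<tau>)) * scaled_hermite_fun k \<tau> y"
proof -
  define s where "s = t * \<tau>"
  define a where "a = sqrt \<tau>"
  have s: "0 < s" and a: "0 < a" using t \<tau> by (auto simp: s_def a_def)
  let ?q = "sqrt (2 * pi * sinh (2 * s))"
  have q: "0 < ?q" using s by simp
  let ?P = "(\<tau> / (2 * pi * sinh (2 * s))) powr (real CARD('m) / 2)"
  let ?c = "\<tau> powr (real CARD('m) / 4) * (\<Prod>j\<in>UNIV. (2 ^ (k $ j) * fact (k $ j) * sqrt pi) powr (- 1 / 2))"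
  have P: "?P = (a / ?q) ^ CARD('m)"
  proof -
    have "?P = ((\<tau> / (2 * pi * sinh (2 * s))) powr (1 / 2)) powr real CARD('m)"
      by (simp add: powr_powr)
    also have "\<dots> = (a / ?q) powr real CARD('m)"
      using \<tau> s by (simp add: powr_half_sqrt real_sqrt_divide a_def)
    finally show ?thesis using a q by (simp add: powr_realpow)
  qed
  let ?g = "\<lambda>j u. mehler_exp s (a * u) (a * y $ j) * hermite_gauss (k $ j) (a * u)"
  have g_int: "integrable lborel (?g j)" for j
    using lborel_integrable_real_affine[OF integral_mehler_exp_hermite_gauss(1)[OF s], of a 0] a by simp
  have g_val: "(LINT u|lborel. ?g j u) = ?q / a * exp (- (2 * real (k $ j) + 1) * s) * hermite_gauss (k $ j) (a * y $ j)" for j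
  proof -
    have "?q * exp (- (2 * real (k $ j) + 1) * s) * hermite_gauss (k $ j) (a * y $ j) = a * (LINT u|lborel. ?g j u)"
      using lborel_integral_real_affine[of a "\<lambda>u. mehler_exp s u (a * y $ j) * hermite_gauss (k $ j) u" 0] a
      unfolding integral_mehler_exp_hermite_gauss(2)[OF s] by simp
    then show ?thesis using a by (simp add: field_simps)
  qed
  have "mehler t \<tau> x y * scaled_hermite_fun k \<tau> x = ?P * ?c * (\<Prod>j\<in>UNIV. ?g j (x $ j))" for x
    unfolding mehler_def s_def[symmetric] mehler_eq_prod[OF \<tau>] scaled_hermite_fun_eq[OF \<tau>] a_def
    by (simp add: prod.distrib mult_ac)
  then have "(LINT x|lborel. mehler t \<tau> x y * scaled_hermite_fun k \<tau> x) = ?P * ?c * (\<Prod>j\<in>UNIV. (LINT u|lborel. ?g j u))"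
    by (simp only: integral_mult_right_zero integral_lborel_vec_prod[of ?g, OF g_int])
  also have "(\<Prod>j\<in>UNIV. (LINT u|lborel. ?g j u)) = (?q / a) ^ CARD('m) * (\<Prod>j\<in>UNIV. exp (- (2 * real (k $ j) + 1) * s)) *
      (\<Prod>j\<in>UNIV. hermite_gauss (k $ j) (a * y $ j))"
    by (simp only: g_val prod.distrib prod_constant)
  also have "(\<Prod>j\<in>UNIV. exp (- (2 * real (k $ j) + 1) * s)) = exp (- t * (real (2 * (\<Sum>j\<in>UNIV. k $ j) + CARD('m)) * \<tau>))"
  proof -
    have "(\<Sum>j\<in>UNIV. - (2 * real (k $ j) + 1) * s) = - (2 * (\<Sum>j\<in>UNIV. real (k $ j)) + real CARD('m)) * s"
      by (simp only: sum_distrib_right[symmetric] sum_negf sum.distrib sum_distrib_left[symmetric]) simp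
    also have "\<dots> = - t * (real (2 * (\<Sum>j\<in>UNIV. k $ j) + CARD('m)) * \<tau>)"
      by (simp add: s_def algebra_simps)
    finally show ?thesis by (simp only: exp_sum[OF finite, symmetric])
  qed
  also have "?P * ?c * ((?q / a) ^ CARD('m) * exp (- t * (real (2 * (\<Sum>j\<in>UNIV. k $ j) + CARD('m)) * \<tau>)) *
      (\<Prod>j\<in>UNIV. hermite_gauss (k $ j) (a * y $ j)))
     = (?P * (?q / a) ^ CARD('m)) * exp (- t * (real (2 * (\<Sum>j\<in>UNIV. k $ j) + CARD('m)) * \<tau>)) * scaled_hermite_fun k \<tau> y"
    unfolding scaled_hermite_fun_eq[OF \<tau>] a_def by (simp only: mult_ac)
  also have "?P * (?q / a) ^ CARD('m) = 1"
    unfolding P power_mult_distrib[symmetric] using a q s by simp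
  finally show ?thesis by simp
qed

section \<open>Bounds for Mehler's kernel\<close>

lemma le_sinh: "r \<le> sinh r" if "0 \<le> r" for r :: real
proof -
  have "sinh 0 - 0 \<le> sinh r - r"
  proof (rule DERIV_nonneg_imp_nondecreasing[OF that, of "\<lambda>r. sinh r - r"])
    fix x :: real
    have "((\<lambda>r. sinh r - r) has_real_derivative cosh x - 1) (at x)"
      by (auto intro!: derivative_eq_intros)
    then show "\<exists>y. ((\<lambda>r. sinh r - r) has_real_derivative y) (at x) \<and> 0 \<le> y"
      using cosh_real_ge_1[of x] by (intro exI[of _ "cosh x - 1"]) auto
  qed
  then show ?thesis by simp
qed

lemma sinh_le_mult_cosh: "sinh r \<le> r * cosh r" if "0 \<le> r" for r :: real
proof -
  have "0 * cosh 0 - sinh 0 \<le> r * cosh r - sinh r"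
  proof (rule DERIV_nonneg_imp_nondecreasing[OF that, of "\<lambda>r. r * cosh r - sinh r"])
    fix x :: real assume "0 \<le> x"
    have "((\<lambda>r. r * cosh r - sinh r) has_real_derivative x * sinh x) (at x)"
      by (auto intro!: derivative_eq_intros)
    then show "\<exists>y. ((\<lambda>r. r * cosh r - sinh r) has_real_derivative y) (at x) \<and> 0 \<le> y"
      using \<open>0 \<le> x\<close> by (intro exI[of _ "x * sinh x"]) auto
  qed
  then show ?thesis by simp
qed

text \<open>From sinh (2 r) = 2 sinh r cosh r, with r \<le> sinh r and exp r \<le> 2 cosh r. The
  factor r cancels the \<tau> in the prefactor of \<open>mehler\<close>, and exp r leaves the
  decay.\<close>

lemma mult_exp_le_sinh_double: "r * exp r \<le> sinh (2 * r)" if "0 \<le> r" for r :: real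
proof -
  have "r \<le> sinh r"
    using that by (rule le_sinh)
  moreover have "exp r \<le> 2 * cosh r" by (simp add: cosh_def)
  ultimately have "r * exp r \<le> sinh r * (2 * cosh r)" using that by (intro mult_mono) auto
  then show ?thesis by (simp add: sinh_double)
qed

lemma inverse_le_coth: "0 < r \<Longrightarrow> 1 / r \<le> coth r"
  using sinh_le_mult_cosh[of r] by (simp add: coth_def field_simps)

lemma mehler_nonneg: "0 \<le> mehler t \<tau> x y"
  by (simp add: mehler_def)

text \<open>The prefactor supplies exponential decay in \<tau>, and coth r \<ge> 1 / r supplies a
  Gaussian in x - y whose width does not depend on \<tau>. The tanh term only makes the kernel
  smaller.\<close>

lemma mehler_bound:
  fixes x y :: "real^'m"
  assumes t: "0 < t" and \<tau>: "0 \<le> \<tau>"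
  shows "mehler t \<tau> x y \<le> (1 / (2 * pi * t)) powr (real CARD('m) / 2) * exp (- (t * real CARD('m) / 2) * \<tau>) * exp (- ((norm (x - y))\<^sup>2 / (4 * t)))"
proof (cases "\<tau> = 0")
  case True
  then show ?thesis by (simp add: mehler_def)
next
  case False
  then have \<tau>: "0 < \<tau>" using \<tau> by simp
  have s: "0 < t * \<tau>" using t \<tau> by simp
  have "\<tau> / (2 * pi * sinh (2 * (t * \<tau>))) \<le> \<tau> / (2 * pi * ((t * \<tau>) * exp (t * \<tau>)))"
    using mult_exp_le_sinh_double[of "t * \<tau>"] s \<tau> t by (intro divide_left_mono mult_left_mono mult_pos_pos) auto
  also have "\<dots> = 1 / (2 * pi * t) * exp (- (t * \<tau>))"
    using t \<tau> by (simp add: exp_minus field_simps)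
  finally have "(\<tau> / (2 * pi * sinh (2 * (t * \<tau>)))) powr (real CARD('m) / 2) \<le> (1 / (2 * pi * t) * exp (- (t * \<tau>))) powr (real CARD('m) / 2)"
    using s \<tau> by (intro powr_mono2) auto
  also have "\<dots> = (1 / (2 * pi * t)) powr (real CARD('m) / 2) * exp (- (t * real CARD('m) / 2) * \<tau>)"
    using t by (subst powr_mult) (auto simp: powr_def)
  finally have 1: "(\<tau> / (2 * pi * sinh (2 * (t * \<tau>)))) powr (real CARD('m) / 2) \<le> (1 / (2 * pi * t)) powr (real CARD('m) / 2) * exp (- (t * real CARD('m) / 2) * \<tau>)" .
  have "(norm (x - y))\<^sup>2 / t \<le> \<tau> * ((norm (x + y))\<^sup>2 * tanh (t * \<tau>) + (norm (x - y))\<^sup>2 * coth (t * \<tau>))"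
  proof -
    have "(norm (x - y))\<^sup>2 / t = \<tau> * (0 + (norm (x - y))\<^sup>2 * (1 / (t * \<tau>)))" using t \<tau> by simp
    also have "\<dots> \<le> \<tau> * ((norm (x + y))\<^sup>2 * tanh (t * \<tau>) + (norm (x - y))\<^sup>2 * coth (t * \<tau>))"
      using t s \<tau> inverse_le_coth[OF s] by (intro mult_left_mono add_mono mult_nonneg_nonneg tanh_nonneg) auto
    finally show ?thesis .
  qed
  then have 2: "exp (- (\<tau> / 4) * ((norm (x + y))\<^sup>2 * tanh (t * \<tau>) + (norm (x - y))\<^sup>2 * coth (t * \<tau>))) \<le> exp (- ((norm (x - y))\<^sup>2 / (4 * t)))"
    by simp
  show ?thesis unfolding mehler_def by (intro mult_mono 1 2) auto
qed

lemma borel_measurable_sinh_cosh[measurable]: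
  "(sinh :: real \<Rightarrow> real) \<in> borel_measurable borel" "(cosh :: real \<Rightarrow> real) \<in> borel_measurable borel"
  by (intro borel_measurable_continuous_onI continuous_intros)+

lemma borel_measurable_tanh_coth[measurable]:
  "(tanh :: real \<Rightarrow> real) \<in> borel_measurable borel" "coth \<in> borel_measurable borel"
  unfolding tanh_def[abs_def] coth_def[abs_def] by measurable

lemma borel_measurable_mehler[measurable (raw)]:
  fixes a :: "'a \<Rightarrow> real" and b c :: "'a \<Rightarrow> real^'m"
  assumes [measurable]: "a \<in> borel_measurable M" "b \<in> borel_measurable M" "c \<in> borel_measurable M"
  shows "(\<lambda>p. mehler t (a p) (b p) (c p)) \<in> borel_measurable M"
  unfolding mehler_def by measurable

lemma mehler_commute: "mehler t \<tau> x y = mehler t \<tau> y x"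
  by (simp add: mehler_def add.commute norm_minus_commute)

text \<open>The type argument carries the dimension d', which no term argument would
  determine.\<close>

definition mehler_const :: "'m::finite itself \<Rightarrow> real \<Rightarrow> real" where
  "mehler_const _ t = (1 / (2 * pi * t)) powr (real CARD('m) / 2)"

definition mehler_rate :: "'m::finite itself \<Rightarrow> real \<Rightarrow> real" where
  "mehler_rate _ t = t * real CARD('m) / 2"

lemma mehler_const_nonneg: "0 \<le> mehler_const TYPE('m::finite) t"
  by (simp add: mehler_const_def)

lemma mehler_rate_pos: "0 < t \<Longrightarrow> 0 < mehler_rate TYPE('m::finite) t"
  by (simp add: mehler_rate_def)

lemma mehler_le:
  fixes x y :: "real^'m"
  assumes "0 < t" "0 \<le> \<tau>"
  shows "mehler t \<tau> x y \<le> mehler_const TYPE('m) t * exp (- mehler_rate TYPE('m) t * \<tau>) * exp (- ((norm (x - y))\<^sup>2 / (4 * t)))"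
  using mehler_bound[OF assms, of x y] by (simp add: mehler_const_def mehler_rate_def)

lemma mehler_le_gauss:
  fixes x y :: "real^'m"
  assumes "0 < t" "0 \<le> \<tau>"
  shows "mehler t \<tau> x y \<le> mehler_const TYPE('m) t * exp (- ((norm (x - y))\<^sup>2 / (4 * t)))"
proof -
  have "mehler t \<tau> x y \<le> mehler_const TYPE('m) t * 1 * exp (- ((norm (x - y))\<^sup>2 / (4 * t)))"
    using mehler_rate_pos[OF assms(1), where 'm='m] assms(2) mehler_const_nonneg
    by (intro order_trans[OF mehler_le[OF assms]] mult_left_mono mult_right_mono) auto
  then show ?thesis by simp
qed

lemma mehler_le_exp:
  fixes x y :: "real^'m"
  assumes "0 < t" "0 \<le> \<tau>"
  shows "mehler t \<tau> x y \<le> mehler_const TYPE('m) t * exp (- mehler_rate TYPE('m) t * \<tau>)"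
proof -
  have "mehler t \<tau> x y \<le> mehler_const TYPE('m) t * exp (- mehler_rate TYPE('m) t * \<tau>) * 1"
    using assms(1) mehler_const_nonneg[where 'm='m] by (intro order_trans[OF mehler_le[OF assms]] mult_left_mono) auto
  then show ?thesis by simp
qed

lemma
  fixes x :: "real^'m"
  assumes t: "0 < t"
  shows integrable_heat_gauss: "integrable lborel (\<lambda>y. exp (- ((norm (x - y))\<^sup>2 / (4 * t))))"
    and integral_heat_gauss: "(LINT y|lborel. exp (- ((norm (x - y))\<^sup>2 / (4 * t)))) = sqrt (4 * pi * t) ^ CARD('m)"
proof -
  have t': "0 < 1 / (2 * t)" using t by simp
  have G: "integrable lborel (\<lambda>y :: real^'m. exp (- ((norm y)\<^sup>2 / (4 * t))))"
    using integrable_gaussian_norm[OF t'] by (simp add: field_simps)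
  show "integrable lborel (\<lambda>y. exp (- ((norm (x - y))\<^sup>2 / (4 * t))))"
    using lborel_integrable_affine[OF G, of "-1" x] by simp
  show "(LINT y|lborel. exp (- ((norm (x - y))\<^sup>2 / (4 * t)))) = sqrt (4 * pi * t) ^ CARD('m)"
    using integral_gaussian_norm[OF t', where 'n='m]
    by (subst lborel_integral_reflect[of "\<lambda>y. exp (- ((norm y)\<^sup>2 / (4 * t)))" x]) (simp add: mult_ac)
qed

lemma integrable_mehler:
  fixes x :: "real^'m"
  assumes t: "0 < t" and \<tau>: "0 \<le> \<tau>"
  shows "integrable lborel (\<lambda>y. mehler t \<tau> x y)"
proof (rule Bochner_Integration.integrable_bound)
  show "integrable lborel (\<lambda>y. mehler_const TYPE('m) t * exp (- ((norm (x - y))\<^sup>2 / (4 * t))))"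
    by (intro integrable_mult_right integrable_heat_gauss t)
  show "AE y in lborel. norm (mehler t \<tau> x y) \<le> norm (mehler_const TYPE('m) t * exp (- ((norm (x - y))\<^sup>2 / (4 * t))))"
    using mehler_le_gauss[OF t \<tau>] by (intro AE_I2) (simp add: mehler_nonneg mehler_const_nonneg abs_mult)
qed measurable

text \<open>The mass of the Gaussian majorant, uniform in x and \<tau>; it is the constant of the
  Schur test.\<close>

definition mehler_mass :: "'m::finite itself \<Rightarrow> real \<Rightarrow> real" where
  "mehler_mass T t = mehler_const T t * sqrt (4 * pi * t) ^ CARD('m)"

lemma mehler_mass_nonneg: "0 < t \<Longrightarrow> 0 \<le> mehler_mass TYPE('m::finite) t"
  by (simp add: mehler_mass_def mehler_const_nonneg)

lemma nn_integral_mehler_le: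
  fixes x :: "real^'m"
  assumes t: "0 < t" and \<tau>: "0 \<le> \<tau>"
  shows "(\<integral>\<^sup>+y. ennreal (mehler t \<tau> x y) \<partial>lborel) \<le> ennreal (mehler_mass TYPE('m) t)"
proof -
  have "(\<integral>\<^sup>+y. ennreal (mehler t \<tau> x y) \<partial>lborel) = ennreal (LINT y|lborel. mehler t \<tau> x y)"
    by (intro nn_integral_eq_integral integrable_mehler t \<tau>) (simp add: mehler_nonneg)
  also have "(LINT y|lborel. mehler t \<tau> x y) \<le> (LINT y|lborel. mehler_const TYPE('m) t * exp (- ((norm (x - y))\<^sup>2 / (4 * t))))"
    using t \<tau> by (intro integral_mono integrable_mehler mehler_le_gauss integrable_mult_right integrable_heat_gauss)
  also have "\<dots> = mehler_mass TYPE('m) t" by (simp add: integral_heat_gauss[OF t] mehler_mass_def)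
  finally show ?thesis by (simp add: ennreal_leI)
qed

text \<open>One factor is bounded uniformly in y and the other by its Gaussian majorant; both keep
  their exponential decay in \<tau>, on which integrability in \<xi> depends.\<close>

lemma nn_integral_mehler_sq_le:
  fixes x :: "real^'m"
  assumes t: "0 < t" and \<tau>: "0 \<le> \<tau>"
  shows "(\<integral>\<^sup>+y. nsq (complex_of_real (mehler t \<tau> x y)) \<partial>lborel)
    \<le> ennreal (mehler_const TYPE('m) t * mehler_mass TYPE('m) t * (exp (- mehler_rate TYPE('m) t * \<tau>))\<^sup>2)"
proof -
  let ?C = "mehler_const TYPE('m) t" and ?e = "exp (- mehler_rate TYPE('m) t * \<tau>)"
  have "(mehler t \<tau> x y)\<^sup>2 \<le> (?C * ?e) * (?C * ?e * exp (- ((norm (x - y))\<^sup>2 / (4 * t))))" for y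
    using mult_mono[OF mehler_le_exp[OF t \<tau>, of x y] mehler_le[OF t \<tau>, of x y]]
    by (simp add: power2_eq_square[of "mehler t \<tau> x y"] mehler_nonneg mehler_const_nonneg)
  then have "(\<integral>\<^sup>+y. nsq (complex_of_real (mehler t \<tau> x y)) \<partial>lborel)
      \<le> (\<integral>\<^sup>+y. ennreal ((?C * ?e) * (?C * ?e * exp (- ((norm (x - y))\<^sup>2 / (4 * t))))) \<partial>lborel)"
    by (intro nn_integral_mono ennreal_leI) simp
  also have "\<dots> = ennreal (LINT y|lborel. (?C * ?e) * (?C * ?e * exp (- ((norm (x - y))\<^sup>2 / (4 * t)))))"
    by (intro nn_integral_eq_integral integrable_mult_right integrable_heat_gauss t) (simp add: mehler_const_nonneg)
  also have "\<dots> = ennreal (?C * mehler_mass TYPE('m) t * ?e\<^sup>2)"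
    unfolding integral_mult_right_zero integral_heat_gauss[OF t] mehler_mass_def
    by (simp add: power2_eq_square mult_ac)
  finally show ?thesis .
qed

section \<open>The heat semigroup on the Fourier side\<close>

definition mehler_apply :: "real \<Rightarrow> ((real^'m) \<times> (real^'n) \<Rightarrow> complex) \<Rightarrow> (real^'m) \<times> (real^'n) \<Rightarrow> complex" where
  "mehler_apply t P = (\<lambda>p. LINT y|lborel. complex_of_real (mehler t (norm (snd p)) (fst p) y) * P (y, snd p))"

lemma borel_measurable_mehler_apply:
  fixes P :: "(real^'m) \<times> (real^'n) \<Rightarrow> complex"
  assumes "P \<in> borel_measurable borel"
  shows "mehler_apply t P \<in> borel_measurable borel"
proof -
  have [measurable]: "P \<in> borel_measurable (borel \<Otimes>\<^sub>M borel)" using assms by (simp add: borel_prod)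
  have "mehler_apply t P \<in> borel_measurable (borel \<Otimes>\<^sub>M borel)"
    unfolding mehler_apply_def by measurable
  then show ?thesis by (simp add: borel_prod)
qed

text \<open>Cauchy-Schwarz in y bounds the slice by a decaying exponential in |\<xi>| times S \<xi>,
  the norm of P(., \<xi>). Both are square-integrable in \<xi>, and neither depends on x, so the
  result holds for every x.\<close>

lemma mehler_apply_slice:
  fixes P :: "(real^'m) \<times> (real^'n) \<Rightarrow> complex"
  assumes t: "0 < t" and P: "P \<in> L2 lborel"
  shows "integrable lborel (\<lambda>\<xi>. mehler_apply t P (x, \<xi>))" "(\<lambda>\<xi>. mehler_apply t P (x, \<xi>)) \<in> L2 lborel"
proof -
  have P_meas: "P \<in> borel_measurable borel" using L2_borel_measurable[OF P] by simp
  note [measurable] = borel_measurable_slice[OF borel_measurable_mehler_apply[OF P_meas]]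
  let ?K = "sqrt (mehler_const TYPE('m) t * mehler_mass TYPE('m) t)"
  let ?E = "\<lambda>\<xi> :: real^'n. exp (- mehler_rate TYPE('m) t * norm \<xi>)"
  define S where "S \<xi> = sqrt (LINT y|lborel. (cmod (P (y, \<xi>)))\<^sup>2)" for \<xi>
  have K: "0 \<le> mehler_const TYPE('m) t * mehler_mass TYPE('m) t"
    using t by (simp add: mehler_const_nonneg mehler_mass_nonneg)
  have int: "integrable (lborel \<Otimes>\<^sub>M lborel) (\<lambda>(y, \<xi>). (cmod (P (y, \<xi>)))\<^sup>2)"
    using L2_integrable_sq[OF P] by (simp add: lborel_prod case_prod_unfold)
  have N: "integrable lborel (\<lambda>\<xi>. LINT y|lborel. (cmod (P (y, \<xi>)))\<^sup>2)"
    by (rule lborel_pair.integrable_snd[OF int])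
  have S_meas[measurable]: "S \<in> borel_measurable borel"
    unfolding S_def[abs_def] using borel_measurable_integrable[OF N] by simp
  have S: "(\<lambda>\<xi>. complex_of_real (S \<xi>)) \<in> L2 lborel"
    using N by (simp add: L2_def S_def)
  have E: "(\<lambda>\<xi>. complex_of_real (?E \<xi>)) \<in> L2 lborel"
    using mehler_rate_pos[OF t, where 'm='m] integrable_exp_norm[OF mehler_rate_pos[OF t, where 'm='m]]
    by (intro L2_bounded_integrable[where B=1]) (auto simp: complex_of_real_integrable_eq)
  have bound: "AE \<xi> in lborel. cmod (mehler_apply t P (x, \<xi>)) \<le> ?K * ?E \<xi> * S \<xi>"
    using AE_L2_slice_snd[OF P]
  proof eventually_elim
    fix \<xi> assume \<xi>: "(\<lambda>y. P (y, \<xi>)) \<in> L2 lborel"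
    have Sn: "(\<integral>\<^sup>+y. nsq (P (y, \<xi>)) \<partial>lborel) = ennreal ((S \<xi>)\<^sup>2)"
      using L2_integrable_sq[OF \<xi>] by (simp add: S_def nn_integral_eq_integral)
    have "nsq (mehler_apply t P (x, \<xi>))
        \<le> (\<integral>\<^sup>+y. nsq (complex_of_real (mehler t (norm \<xi>) x y)) \<partial>lborel) * (\<integral>\<^sup>+y. nsq (P (y, \<xi>)) \<partial>lborel)"
      unfolding mehler_apply_def fst_conv snd_conv
      using L2_borel_measurable[OF \<xi>] by (intro norm_integral_mult_le) simp_all
    also have "\<dots> \<le> ennreal (mehler_const TYPE('m) t * mehler_mass TYPE('m) t * (?E \<xi>)\<^sup>2) * ennreal ((S \<xi>)\<^sup>2)"
      unfolding Sn by (intro mult_right_mono nn_integral_mehler_sq_le t) auto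
    also have "\<dots> = ennreal ((?K * ?E \<xi> * S \<xi>)\<^sup>2)"
      using K by (simp add: ennreal_mult[symmetric] power_mult_distrib)
    finally have "(cmod (mehler_apply t P (x, \<xi>)))\<^sup>2 \<le> (?K * ?E \<xi> * S \<xi>)\<^sup>2" by simp
    then show "cmod (mehler_apply t P (x, \<xi>)) \<le> ?K * ?E \<xi> * S \<xi>"
      by (rule power2_le_imp_le) (use K in \<open>simp add: S_def\<close>)
  qed
  have "integrable lborel (\<lambda>\<xi>. complex_of_real ?K * (complex_of_real (?E \<xi>) * complex_of_real (S \<xi>)))"
    by (intro integrable_mult_right L2_mult_integrable E S)
  then show "integrable lborel (\<lambda>\<xi>. mehler_apply t P (x, \<xi>))"
  proof (rule Bochner_Integration.integrable_bound)
    show "AE \<xi> in lborel. norm (mehler_apply t P (x, \<xi>)) \<le> norm (complex_of_real ?K * (complex_of_real (?E \<xi>) * complex_of_real (S \<xi>)))"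
      using bound by eventually_elim (use K in \<open>simp add: norm_mult S_def\<close>)
  qed measurable
  show "(\<lambda>\<xi>. mehler_apply t P (x, \<xi>)) \<in> L2 lborel"
  proof (rule L2_bound[OF S, where C="?K"])
    show "AE \<xi> in lborel. cmod (mehler_apply t P (x, \<xi>)) \<le> ?K * cmod (complex_of_real (S \<xi>))"
      using bound
    proof eventually_elim
      case (elim \<xi>)
      have "?K * ?E \<xi> * S \<xi> \<le> ?K * 1 * S \<xi>"
        using K mehler_rate_pos[OF t, where 'm='m] by (intro mult_right_mono mult_left_mono) (auto simp: S_def)
      then show ?case using elim by (simp add: S_def)
    qed
  qed measurable
qed

text \<open>Schur's test: write the kernel as the square of its root and apply the Cauchy-Schwarz inequality.\<close>

lemma L2_mehler_apply:
  fixes P :: "(real^'m) \<times> (real^'n) \<Rightarrow> complex"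
  assumes t: "0 < t" and P: "P \<in> L2 lborel"
  shows "mehler_apply t P \<in> L2 lborel"
proof (rule L2_pairI)
  have P_meas: "P \<in> borel_measurable borel" using L2_borel_measurable[OF P] by simp
  then have [measurable]: "P \<in> borel_measurable (borel \<Otimes>\<^sub>M borel)" by (simp add: borel_prod)
  show "mehler_apply t P \<in> borel_measurable borel" by (rule borel_measurable_mehler_apply[OF P_meas])
  let ?Q = "ennreal (mehler_mass TYPE('m) t)"
  let ?m = "\<lambda>\<xi> :: real^'n. mehler t (norm \<xi>) :: real^'m \<Rightarrow> _"
  have bound: "nsq (mehler_apply t P (x, \<xi>)) \<le> ?Q * (\<integral>\<^sup>+y. ennreal (?m \<xi> x y * (cmod (P (y, \<xi>)))\<^sup>2) \<partial>lborel)" for x \<xi>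
  proof -
    have "nsq (mehler_apply t P (x, \<xi>))
        = nsq (LINT y|lborel. complex_of_real (sqrt (?m \<xi> x y)) * (complex_of_real (sqrt (?m \<xi> x y)) * P (y, \<xi>)))"
      by (simp add: mehler_apply_def mult.assoc[symmetric] mehler_nonneg flip: of_real_mult)
    also have "\<dots> \<le> (\<integral>\<^sup>+y. nsq (complex_of_real (sqrt (?m \<xi> x y))) \<partial>lborel) *
        (\<integral>\<^sup>+y. nsq (complex_of_real (sqrt (?m \<xi> x y)) * P (y, \<xi>)) \<partial>lborel)"
      by (intro norm_integral_mult_le) measurable
    also have "\<dots> = (\<integral>\<^sup>+y. ennreal (?m \<xi> x y) \<partial>lborel) * (\<integral>\<^sup>+y. ennreal (?m \<xi> x y * (cmod (P (y, \<xi>)))\<^sup>2) \<partial>lborel)"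
      by (simp add: norm_mult power_mult_distrib mehler_nonneg)
    also have "\<dots> \<le> ?Q * (\<integral>\<^sup>+y. ennreal (?m \<xi> x y * (cmod (P (y, \<xi>)))\<^sup>2) \<partial>lborel)"
      by (intro mult_right_mono nn_integral_mehler_le t) auto
    finally show ?thesis .
  qed
  have "(\<integral>\<^sup>+x. (\<integral>\<^sup>+\<xi>. nsq (mehler_apply t P (x, \<xi>)) \<partial>lborel) \<partial>lborel)
      \<le> (\<integral>\<^sup>+x. (\<integral>\<^sup>+\<xi>. ?Q * (\<integral>\<^sup>+y. ennreal (?m \<xi> x y * (cmod (P (y, \<xi>)))\<^sup>2) \<partial>lborel) \<partial>lborel) \<partial>lborel)"
    by (intro nn_integral_mono bound)
  also have "\<dots> = (\<integral>\<^sup>+\<xi>. (\<integral>\<^sup>+x. ?Q * (\<integral>\<^sup>+y. ennreal (?m \<xi> x y * (cmod (P (y, \<xi>)))\<^sup>2) \<partial>lborel) \<partial>lborel) \<partial>lborel)"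
    by (rule lborel_pair.Fubini') measurable
  also have "\<dots> = (\<integral>\<^sup>+\<xi>. ?Q * (\<integral>\<^sup>+x. (\<integral>\<^sup>+y. ennreal (?m \<xi> x y * (cmod (P (y, \<xi>)))\<^sup>2) \<partial>lborel) \<partial>lborel) \<partial>lborel)"
    by (intro nn_integral_cong nn_integral_cmult) measurable
  also have "\<dots> = (\<integral>\<^sup>+\<xi>. ?Q * (\<integral>\<^sup>+y. (\<integral>\<^sup>+x. ennreal (?m \<xi> x y * (cmod (P (y, \<xi>)))\<^sup>2) \<partial>lborel) \<partial>lborel) \<partial>lborel)"
    by (intro nn_integral_cong arg_cong2[where f=times] refl lborel_pair.Fubini') measurable
  also have "\<dots> \<le> (\<integral>\<^sup>+\<xi>. ?Q * (\<integral>\<^sup>+y. ?Q * nsq (P (y, \<xi>)) \<partial>lborel) \<partial>lborel)"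
  proof (intro nn_integral_mono mult_left_mono)
    fix \<xi> y
    \<comment> \<open>The kernel is symmetric, so its mass in the first variable obeys the same
      bound.\<close>
    have "(\<integral>\<^sup>+x. ennreal (?m \<xi> x y * (cmod (P (y, \<xi>)))\<^sup>2) \<partial>lborel) = (\<integral>\<^sup>+x. ennreal (?m \<xi> y x) \<partial>lborel) * nsq (P (y, \<xi>))"
      by (subst nn_integral_multc[symmetric]) (auto simp: ennreal_mult mehler_nonneg mehler_commute[of t _ y])
    also have "\<dots> \<le> ?Q * nsq (P (y, \<xi>))"
      by (intro mult_right_mono nn_integral_mehler_le t) auto
    finally show "(\<integral>\<^sup>+x. ennreal (?m \<xi> x y * (cmod (P (y, \<xi>)))\<^sup>2) \<partial>lborel) \<le> ?Q * nsq (P (y, \<xi>))" .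
  qed auto
  also have "\<dots> = ?Q * (?Q * (\<integral>\<^sup>+\<xi>. (\<integral>\<^sup>+y. nsq (P (y, \<xi>)) \<partial>lborel) \<partial>lborel))"
    by (simp add: nn_integral_cmult)
  also have "(\<integral>\<^sup>+\<xi>. (\<integral>\<^sup>+y. nsq (P (y, \<xi>)) \<partial>lborel) \<partial>lborel) = (\<integral>\<^sup>+p. nsq (P p) \<partial>lborel)"
    unfolding L2_pair_nn_integral[OF P_meas] by (rule lborel_pair.Fubini'[symmetric]) measurable
  also have "?Q * (?Q * (\<integral>\<^sup>+p. nsq (P p) \<partial>lborel)) < \<infinity>"
    using P by (simp add: L2_iff_nn_integral ennreal_mult_less_top)
  finally show "(\<integral>\<^sup>+x. (\<integral>\<^sup>+\<xi>. nsq (mehler_apply t P (x, \<xi>)) \<partial>lborel) \<partial>lborel) < \<infinity>" .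
qed

section \<open>The heat kernel as a Fourier transform\<close>

text \<open>As a function of \<xi>, the function whose Fourier transform is the heat kernel in the
  variable y''; it plays the role of v in the multiplication formula.\<close>

definition kernel_symbol :: "real \<Rightarrow> (real^'m) \<times> (real^'n) \<Rightarrow> (real^'m) \<times> (real^'n) \<Rightarrow> complex" where
  "kernel_symbol t x = (\<lambda>(y, \<xi>). complex_of_real ((2 * pi) powr (- real CARD('n) / 2) * mehler t (norm \<xi>) (fst x) y) *
     exp (\<i> * complex_of_real (\<xi> \<bullet> snd x)))"

lemma borel_measurable_kernel_symbol: "kernel_symbol t (x :: (real^'m) \<times> (real^'n)) \<in> borel_measurable borel"
proof -
  have "kernel_symbol t x \<in> borel_measurable (borel \<Otimes>\<^sub>M borel)"
    unfolding kernel_symbol_def by measurable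
  then show ?thesis by (simp add: borel_prod)
qed

lemma cmod_kernel_symbol_le:
  fixes x :: "(real^'m) \<times> (real^'n)"
  assumes t: "0 < t"
  shows "cmod (kernel_symbol t x (y, \<xi>)) \<le> (2 * pi) powr (- real CARD('n) / 2) * (mehler_const TYPE('m) t *
    exp (- mehler_rate TYPE('m) t * norm \<xi>) * exp (- ((norm (fst x - y))\<^sup>2 / (4 * t))))"
  using mehler_le[OF t norm_ge_zero[of \<xi>], of "fst x" y] mehler_nonneg[of t "norm \<xi>" "fst x" y]
  by (simp add: kernel_symbol_def norm_mult abs_mult mult_left_mono)

text \<open>A Gaussian in y times an exponential in \<xi> dominates, and a bounded integrable
  function is in L2. The slices are good for every y, as the slicewise multiplication formula
  requires.\<close>

lemma
  fixes x :: "(real^'m) \<times> (real^'n)"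
  assumes t: "0 < t"
  shows L2_kernel_symbol: "kernel_symbol t x \<in> L2 lborel"
    and integrable_kernel_symbol_slice: "integrable lborel (\<lambda>\<xi>. kernel_symbol t x (y, \<xi>))"
    and L2_kernel_symbol_slice: "(\<lambda>\<xi>. kernel_symbol t x (y, \<xi>)) \<in> L2 lborel"
proof -
  let ?c = "(2 * pi) powr (- real CARD('n) / 2)" and ?C = "mehler_const TYPE('m) t" and ?r = "mehler_rate TYPE('m) t"
  note [measurable] = borel_measurable_kernel_symbol[of t x] borel_measurable_slice(1)[OF borel_measurable_kernel_symbol[of t x]]
  have E: "integrable lborel (\<lambda>\<xi> :: real^'n. exp (- ?r * norm \<xi>))"
    by (rule integrable_exp_norm[OF mehler_rate_pos[OF t]])
  have "integrable (lborel \<Otimes>\<^sub>M lborel) (\<lambda>(y :: real^'m, \<xi> :: real^'n). ?c * ?C * exp (- ((norm (fst x - y))\<^sup>2 / (4 * t))) * exp (- ?r * norm \<xi>))"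
    by (intro integrable_mult_fst_snd E integrable_mult_right integrable_heat_gauss t sigma_finite_lborel)
  then have dom: "integrable lborel (\<lambda>p :: (real^'m) \<times> (real^'n). ?c * ?C * exp (- ((norm (fst x - fst p))\<^sup>2 / (4 * t))) * exp (- ?r * norm (snd p)))"
    by (simp add: lborel_prod case_prod_unfold)
  have le: "cmod (kernel_symbol t x p) \<le> ?c * ?C * exp (- ((norm (fst x - fst p))\<^sup>2 / (4 * t))) * exp (- ?r * norm (snd p))" for p
    using cmod_kernel_symbol_le[OF t, of x "fst p" "snd p"] by (simp add: mult_ac)
  have pos: "0 \<le> ?c * ?C * exp (- ((norm (fst x - fst p))\<^sup>2 / (4 * t))) * exp (- ?r * norm (snd p))" for p :: "(real^'m) \<times> (real^'n)"
    by (simp add: mehler_const_nonneg)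
  have bounded: "cmod (kernel_symbol t x p) \<le> ?c * ?C" for p
  proof -
    have "?c * ?C * exp (- ((norm (fst x - fst p))\<^sup>2 / (4 * t))) * exp (- ?r * norm (snd p)) \<le> ?c * ?C * 1 * 1"
      using t mehler_rate_pos[OF t, where 'm='m] mehler_const_nonneg[where 'm='m and t=t] by (intro mult_mono) auto
    then show ?thesis using le[of p] by linarith
  qed
  have "integrable lborel (kernel_symbol t x)"
    by (rule Bochner_Integration.integrable_bound[OF dom]) (use le pos in \<open>auto intro!: AE_I2 order_trans[OF le]\<close>)
  then show "kernel_symbol t x \<in> L2 lborel" by (rule L2_bounded_integrable) (rule bounded)
  have "integrable lborel (\<lambda>\<xi> :: real^'n. ?c * ?C * exp (- ?r * norm \<xi>))"
    using E by (rule integrable_mult_right)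
  then show 1: "integrable lborel (\<lambda>\<xi>. kernel_symbol t x (y, \<xi>))"
  proof (rule Bochner_Integration.integrable_bound)
    have "cmod (kernel_symbol t x (y, \<xi>)) \<le> ?c * ?C * exp (- ?r * norm \<xi>)" for \<xi>
    proof -
      have "?c * ?C * exp (- ((norm (fst x - y))\<^sup>2 / (4 * t))) * exp (- ?r * norm \<xi>) \<le> ?c * ?C * 1 * exp (- ?r * norm \<xi>)"
        using t mehler_const_nonneg[where 'm='m and t=t] by (intro mult_right_mono mult_left_mono) auto
      from order_trans[OF le[of "(y, \<xi>)", unfolded fst_conv snd_conv] this] show ?thesis
        by (simp only: mult_1_right)
    qed
    then show "AE \<xi> in lborel. norm (kernel_symbol t x (y, \<xi>)) \<le> norm (?c * ?C * exp (- ?r * norm \<xi>))"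
      by (intro AE_I2) (simp add: mehler_const_nonneg abs_mult)
  qed measurable
  show "(\<lambda>\<xi>. kernel_symbol t x (y, \<xi>)) \<in> L2 lborel"
    by (rule L2_bounded_integrable[OF 1]) (rule bounded)
qed

text \<open>Replacing \<xi> by t \<xi> cancels 1 / t in the phase and in the Gaussian and puts t
  |\<xi>| into the hyperbolic functions, as in \<open>mehler\<close>.\<close>

lemma heat_kernel_integrand_scaled:
  fixes x y :: "(real^'m) \<times> (real^'n)"
  assumes t: "0 < t"
  shows "heat_kernel_integrand t x y (t *\<^sub>R \<xi>) =
    complex_of_real ((2 * pi * t) powr (real CARD('m) / 2) * (2 * pi) powr (real CARD('n) / 2)) *
    (kernel_symbol t x (fst y, \<xi>) * osc (snd y \<bullet> \<xi>))"
proof -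
  have p: "(t * norm \<xi> / sinh (2 * (t * norm \<xi>))) powr (real CARD('m) / 2)
      = (2 * pi * t) powr (real CARD('m) / 2) * (norm \<xi> / (2 * pi * sinh (2 * (t * norm \<xi>)))) powr (real CARD('m) / 2)"
  proof -
    have "t * norm \<xi> / sinh (2 * (t * norm \<xi>)) = (2 * pi * t) * (norm \<xi> / (2 * pi * sinh (2 * (t * norm \<xi>))))"
      by (simp add: field_simps)
    then show ?thesis using t by (simp only:) (subst powr_mult; simp)
  qed
  \<comment> \<open>A factor 1, inserted below to make the Fourier normalisation of
    \<open>kernel_symbol\<close> appear.\<close>
  have c: "(2 * pi) powr (real CARD('n) / 2) * (2 * pi) powr (- real CARD('n) / 2) = 1"
    by (simp add: powr_minus)
  have e: "exp (\<i> / complex_of_real t * complex_of_real ((snd x - snd y) \<bullet> (t *\<^sub>R \<xi>)))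
      = exp (\<i> * complex_of_real (\<xi> \<bullet> snd x)) * osc (snd y \<bullet> \<xi>)"
    using t by (simp add: exp_add[symmetric] inner_diff_left inner_commute algebra_simps)
  have "heat_kernel_integrand t x y (t *\<^sub>R \<xi>)
      = exp (\<i> / complex_of_real t * complex_of_real ((snd x - snd y) \<bullet> (t *\<^sub>R \<xi>))) *
        complex_of_real ((2 * pi * t) powr (real CARD('m) / 2) * mehler t (norm \<xi>) (fst x) (fst y))"
    using t p unfolding heat_kernel_integrand_def mehler_def
    by (simp add: case_prod_unfold)
  also have "\<dots> = complex_of_real ((2 * pi * t) powr (real CARD('m) / 2) * ((2 * pi) powr (real CARD('n) / 2) * (2 * pi) powr (- real CARD('n) / 2)) *
      mehler t (norm \<xi>) (fst x) (fst y)) * (exp (\<i> * complex_of_real (\<xi> \<bullet> snd x)) * osc (snd y \<bullet> \<xi>))"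
    unfolding c e by (simp add: mult_ac)
  finally show ?thesis by (simp add: kernel_symbol_def mult_ac)
qed

lemma integrable_heat_kernel_integrand:
  fixes x y :: "(real^'m) \<times> (real^'n)"
  assumes t: "0 < t"
  shows "integrable lborel (heat_kernel_integrand t x y)"
proof -
  have "integrable lborel (\<lambda>\<xi>. heat_kernel_integrand t x y (t *\<^sub>R \<xi>))"
    unfolding heat_kernel_integrand_scaled[OF t]
    by (intro integrable_mult_right integrable_fourier integrable_kernel_symbol_slice t)
  then show ?thesis
    using lborel_integrable_affine_iff[of t "heat_kernel_integrand t x y" 0] t by simp
qed

text \<open>The powers of t cancel: (2 pi t)^(-(d' + 2 d'') / 2) times the (2 pi t)^(d' / 2) taken
  out of Mehler's prefactor is (2 pi t)^(-d''), and the substitution contributes t^d''.\<close>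

lemma heat_kernel_eq_fourier:
  fixes x y :: "(real^'m) \<times> (real^'n)"
  assumes t: "0 < t"
  shows "heat_kernel t x y = fourier_integral (\<lambda>\<xi>. kernel_symbol t x (fst y, \<xi>)) (snd y)"
proof -
  let ?J = "LINT \<xi>|lborel. kernel_symbol t x (fst y, \<xi>) * osc (snd y \<bullet> \<xi>)"
  let ?a = "(2 * pi * t) powr (- real (CARD('m) + 2 * CARD('n)) / 2)" and ?b = "(2 * pi * t) powr (real CARD('m) / 2)" and ?c = "(2 * pi) powr (real CARD('n) / 2)"
  have "(LINT \<xi>|lborel. heat_kernel_integrand t x y \<xi>) = t ^ CARD('n) *\<^sub>R (LINT \<xi>|lborel. heat_kernel_integrand t x y (t *\<^sub>R \<xi>))"
    using lborel_integral_affine[of t "heat_kernel_integrand t x y" 0] t by simp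
  also have "(LINT \<xi>|lborel. heat_kernel_integrand t x y (t *\<^sub>R \<xi>)) =
      complex_of_real (?b * ?c) * ?J"
    unfolding heat_kernel_integrand_scaled[OF t] by (rule integral_mult_right_zero)
  finally have "heat_kernel t x y = complex_of_real (?a *
      (t ^ CARD('n) * (?b * ?c))) * ?J"
    unfolding heat_kernel_def by (simp add: scaleR_conv_of_real mult.assoc)
  also have "?a *
      (t ^ CARD('n) * (?b * ?c))
    = (2 * pi) powr (- real CARD('n) / 2)"
  proof -
    have "?a * ?b = (2 * pi * t) powr (- real CARD('n))"
      unfolding powr_add[symmetric] by (simp add: field_simps)
    also have "\<dots> = (2 * pi) powr (- real CARD('n)) * t powr (- real CARD('n))"
      using t by (simp add: powr_mult)
    finally have 1: "?a * ?b
      = (2 * pi) powr (- real CARD('n)) * t powr (- real CARD('n))" .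
    have 2: "t ^ CARD('n) * t powr (- real CARD('n)) = 1"
      using t by (simp add: powr_minus powr_realpow)
    have 3: "(2 * pi) powr (- real CARD('n)) * ?c = (2 * pi) powr (- real CARD('n) / 2)"
      unfolding powr_add[symmetric] by (simp add: field_simps)
    have "?a *
      (t ^ CARD('n) * (?b * ?c))
      = (?a * ?b) *
        t ^ CARD('n) * ?c" by (simp only: mult_ac)
    also have "\<dots> = (t ^ CARD('n) * t powr (- real CARD('n))) * ((2 * pi) powr (- real CARD('n)) * ?c)"
      unfolding 1 by (simp only: mult_ac)
    finally show ?thesis unfolding 2 3 by simp
  qed
  finally show ?thesis unfolding fourier_integral_def .
qed

text \<open>Evaluation at minus x'' makes this the inverse Fourier transform. The slices are
  integrable for every x', so this is an explicit function and not merely a class.\<close>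

definition heat_solution :: "real \<Rightarrow> ((real^'m) \<times> (real^'n) \<Rightarrow> complex) \<Rightarrow> (real^'m) \<times> (real^'n) \<Rightarrow> complex" where
  "heat_solution t f x = fourier_integral (\<lambda>\<xi>. mehler_apply t (partial_fourier f) (fst x, \<xi>)) (- snd x)"

lemma L2_heat_solution:
  fixes f :: "(real^'m) \<times> (real^'n) \<Rightarrow> complex"
  assumes t: "0 < t" and f: "f \<in> L2 lborel"
  shows "heat_solution t f \<in> L2 lborel"
proof (rule L2_pairI)
  let ?P = "partial_fourier f"
  have P: "?P \<in> L2 lborel" by (rule partial_fourier_pair(1)[OF f])
  define H where "H p = fourier_integral (\<lambda>\<xi>. mehler_apply t ?P (fst p, \<xi>)) (snd p)" for p
  have H: "H \<in> L2 lborel"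
    unfolding H_def[abs_def]
    by (rule Plancherel_le_slices[OF L2_mehler_apply[OF t P]]) (simp add: mehler_apply_slice[OF t P])
  have H_meas: "H \<in> borel_measurable borel" using L2_borel_measurable[OF H] by simp
  then have [measurable]: "H \<in> borel_measurable (borel \<Otimes>\<^sub>M borel)" by (simp add: borel_prod)
  have eq: "heat_solution t f x = H (fst x, - snd x)" for x by (simp add: heat_solution_def H_def)
  have "(\<lambda>x :: (real^'m) \<times> (real^'n). H (fst x, - snd x)) \<in> borel_measurable (borel \<Otimes>\<^sub>M borel)" by measurable
  then show "heat_solution t f \<in> borel_measurable borel" by (simp add: eq[abs_def] borel_prod)
  have refl: "(\<integral>\<^sup>+y. nsq (H (x, - y)) \<partial>lborel) = (\<integral>\<^sup>+y. nsq (H (x, y)) \<partial>lborel)" for x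
    using nn_integral_lborel_affine[of "\<lambda>y. nsq (H (x, y))" "-1" 0] by simp
  have "(\<integral>\<^sup>+x. (\<integral>\<^sup>+y. nsq (heat_solution t f (x, y)) \<partial>lborel) \<partial>lborel) = (\<integral>\<^sup>+p. nsq (H p) \<partial>lborel)"
    by (simp add: eq refl L2_pair_nn_integral[OF H_meas])
  also have "\<dots> < \<infinity>" using H by (simp add: L2_iff_nn_integral)
  finally show "(\<integral>\<^sup>+x. (\<integral>\<^sup>+y. nsq (heat_solution t f (x, y)) \<partial>lborel) \<partial>lborel) < \<infinity>" .
qed

text \<open>The multiplication formula replaces kernel and f by symbol and partial Fourier transform
  on almost every slice. In both pairs each member is in L2 of the product space, so Fubini applies
  before and after, for every x.\<close>

lemma heat_kernel_integral:
  fixes f :: "(real^'m) \<times> (real^'n) \<Rightarrow> complex"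
  assumes t: "0 < t" and f: "f \<in> L2 lborel"
  shows "integrable lborel (\<lambda>y. heat_kernel t x y * f y)"
    and "(LINT y|lborel. heat_kernel t x y * f y) = heat_solution t f x"
proof -
  let ?P = "partial_fourier f" and ?k = "kernel_symbol t x"
  let ?c = "(2 * pi) powr (- real CARD('n) / 2)"
  have P: "?P \<in> L2 lborel" by (rule partial_fourier_pair(1)[OF f])
  have "heat_kernel t x \<in> L2 lborel"
    unfolding heat_kernel_eq_fourier[OF t, abs_def]
    by (rule Plancherel_le_slices[OF L2_kernel_symbol[OF t]]) (simp add: integrable_kernel_symbol_slice[OF t])
  then show int: "integrable lborel (\<lambda>y. heat_kernel t x y * f y)" by (rule L2_mult_integrable[OF _ f])
  have "integrable (lborel \<Otimes>\<^sub>M lborel) (\<lambda>p. ?P p * ?k p)"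
    using L2_mult_integrable[OF P L2_kernel_symbol[OF t]] by (simp add: lborel_prod)
  then have int2: "integrable (lborel \<Otimes>\<^sub>M lborel) (\<lambda>(y, \<xi>). ?P (y, \<xi>) * ?k (y, \<xi>))"
    by (simp add: case_prod_unfold)
  have int1: "integrable (lborel \<Otimes>\<^sub>M lborel) (\<lambda>y. heat_kernel t x y * f y)" using int by (simp add: lborel_prod)
  have "(LINT y|lborel. heat_kernel t x y * f y) = (LINT y|lborel. (LINT z|lborel. heat_kernel t x (y, z) * f (y, z)))"
    using lborel_pair.integral_fst'[OF int1] by (simp add: lborel_prod)
  also have "\<dots> = (LINT y|lborel. (LINT \<xi>|lborel. ?P (y, \<xi>) * ?k (y, \<xi>)))"
  proof (rule integral_cong_AE)
    show "(\<lambda>y. LINT z|lborel. heat_kernel t x (y, z) * f (y, z)) \<in> borel_measurable lborel"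
      by (rule borel_measurable_integrable[OF lborel_pair.integrable_fst'[OF int1]])
    show "(\<lambda>y. LINT \<xi>|lborel. ?P (y, \<xi>) * ?k (y, \<xi>)) \<in> borel_measurable lborel"
      by (rule borel_measurable_integrable[OF lborel_pair.integrable_fst[OF int2]])
    show "AE y in lborel. (LINT z|lborel. heat_kernel t x (y, z) * f (y, z)) = (LINT \<xi>|lborel. ?P (y, \<xi>) * ?k (y, \<xi>))"
      using partial_fourier_pair(2)[OF f]
    proof eventually_elim
      case (elim y)
      show ?case
        using fourier_pairD[OF elim integrable_kernel_symbol_slice[OF t] L2_kernel_symbol_slice[OF t], of x y]
        by (simp add: heat_kernel_eq_fourier[OF t] mult.commute)
    qed
  qed
  also have "\<dots> = (LINT \<xi>|lborel. (LINT y|lborel. ?P (y, \<xi>) * ?k (y, \<xi>)))"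
    using int2 by (rule lborel_pair.Fubini_integral[symmetric])
  also have "\<dots> = (LINT \<xi>|lborel. complex_of_real ?c * (mehler_apply t ?P (fst x, \<xi>) * osc (- snd x \<bullet> \<xi>)))"
  proof (rule Bochner_Integration.integral_cong[OF refl])
    fix \<xi>
    have eq: "?P (y, \<xi>) * ?k (y, \<xi>) = complex_of_real ?c * osc (- snd x \<bullet> \<xi>) *
        (complex_of_real (mehler t (norm \<xi>) (fst x) y) * ?P (y, \<xi>))" for y
      by (simp add: kernel_symbol_def inner_commute mult_ac)
    show "(LINT y|lborel. ?P (y, \<xi>) * ?k (y, \<xi>)) = complex_of_real ?c * (mehler_apply t ?P (fst x, \<xi>) * osc (- snd x \<bullet> \<xi>))"
      unfolding eq integral_mult_right_zero mehler_apply_def fst_conv snd_conv by (simp only: mult_ac)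
  qed
  finally show "(LINT y|lborel. heat_kernel t x y * f y) = heat_solution t f x"
    by (simp add: heat_solution_def fourier_integral_def)
qed

text \<open>The exceptional set is Borel, so Fubini allows its slices to be taken in either
  order.\<close>

lemma AE_slices_eq_commute:
  fixes f h :: "(real^'m) \<times> (real^'n) \<Rightarrow> complex"
  assumes f: "f \<in> borel_measurable borel" and h: "h \<in> borel_measurable borel"
    and ae: "AE x in lborel. AE \<xi> in lborel. f (x, \<xi>) = h (x, \<xi>)"
  shows "AE \<xi> in lborel. AE x in lborel. f (x, \<xi>) = h (x, \<xi>)"
proof -
  have [measurable]: "f \<in> borel_measurable (borel \<Otimes>\<^sub>M borel)" "h \<in> borel_measurable (borel \<Otimes>\<^sub>M borel)"
    using f h by (simp_all add: borel_prod)
  have "{p \<in> space (lborel \<Otimes>\<^sub>M lborel). f (fst p, snd p) = h (fst p, snd p)} \<in> sets (lborel \<Otimes>\<^sub>M lborel)"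
    by measurable
  from lborel_pair.AE_commute[OF this] ae show ?thesis by simp
qed

text \<open>Inversion works at fixed x' with \<xi> varying, while the Hermite transform integrates
  over x' at fixed \<xi>; hence the exchange of the two quantifiers.\<close>

lemma partial_fourier_heat_solution:
  fixes f :: "(real^'m) \<times> (real^'n) \<Rightarrow> complex"
  assumes t: "0 < t" and f: "f \<in> L2 lborel"
  shows "AE \<xi> in lborel. AE x in lborel. partial_fourier (heat_solution t f) (x, \<xi>) = mehler_apply t (partial_fourier f) (x, \<xi>)"
proof (rule AE_slices_eq_commute)
  let ?P = "partial_fourier f" and ?F = "heat_solution t f"
  have P: "?P \<in> L2 lborel" by (rule partial_fourier_pair(1)[OF f])
  have F: "?F \<in> L2 lborel" by (rule L2_heat_solution[OF t f])
  show "partial_fourier ?F \<in> borel_measurable borel" "mehler_apply t ?P \<in> borel_measurable borel"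
    using L2_borel_measurable[OF partial_fourier_pair(1)[OF F]] L2_borel_measurable[OF L2_mehler_apply[OF t P]] by simp_all
  show "AE x in lborel. AE \<xi> in lborel. partial_fourier ?F (x, \<xi>) = mehler_apply t ?P (x, \<xi>)"
    using partial_fourier_pair(2)[OF F]
  proof eventually_elim
    case (elim x)
    then show ?case
      by (intro fourier_pair_inverse mehler_apply_slice[OF t P]) (simp add: heat_solution_def)
  qed
qed

section \<open>The transform \<open>\<G>\<close>\<close>

lemma L2_scaled_hermite_fun:
  assumes \<tau>: "0 < \<tau>"
  shows "(\<lambda>x :: real^'m. complex_of_real (scaled_hermite_fun k \<tau> x)) \<in> L2 lborel"
proof -
  have "(\<lambda>s. complex_of_real (hermite_gauss n (sqrt \<tau> * s))) \<in> L2 lborel" for n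
  proof -
    obtain C where C: "\<And>u. \<bar>hermite_gauss n u\<bar> \<le> C * exp (- (u\<^sup>2 / 4))"
      using hermite_gauss_bound by blast
    show ?thesis
      using C[of "sqrt \<tau> * _"] \<tau>
      by (intro gaussian_bounded_L2[of _ "\<tau> / 4" C]) (auto simp: power_mult_distrib)
  qed
  then have "(\<lambda>x :: real^'m. \<Prod>j\<in>UNIV. complex_of_real (hermite_gauss (k $ j) (sqrt \<tau> * x $ j))) \<in> L2 lborel"
    by (rule L2_vec_prod)
  moreover define c where "c = \<tau> powr (real CARD('m) / 4) * (\<Prod>j\<in>UNIV. (2 ^ (k $ j) * fact (k $ j) * sqrt pi) powr (- 1 / 2))"
  have "complex_of_real (scaled_hermite_fun k \<tau> x) = complex_of_real c *
      (\<Prod>j\<in>UNIV. complex_of_real (hermite_gauss (k $ j) (sqrt \<tau> * x $ j)))" for x :: "real^'m"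
    unfolding scaled_hermite_fun_eq[OF \<tau>] c_def by (simp only: of_real_mult of_real_prod)
  ultimately show ?thesis by (simp only: L2_cmult)
qed

lemma countable_UNIV_nat_vec: "countable (UNIV :: (nat^'m) set)"
proof -
  have "inj (vec_nth :: nat^'m \<Rightarrow> 'm \<Rightarrow> nat)" by (simp add: inj_def vec_eq_iff fun_eq_iff)
  moreover have "countable (range (vec_nth :: nat^'m \<Rightarrow> 'm \<Rightarrow> nat))" by (rule countableI_type)
  ultimately show ?thesis by (rule countable_image_inj_on[rotated])
qed

lemma sigma_finite_count_nat_vec: "sigma_finite_measure (count_space (UNIV :: (nat^'m) set))"
  by (rule sigma_finite_measure_count_space_countable[OF countable_UNIV_nat_vec])

text \<open>The index k ranges over a countable set, so the exceptional sets in \<xi> for the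
  individual k unite to a single null set.\<close>

lemma AE_Gamma_measure:
  "(AE \<gamma> in (Gamma_measure :: ((nat^'m) \<times> (real^'n)) measure). Q \<gamma>) \<longleftrightarrow> (AE \<xi> in lborel. \<forall>k. Q (k, \<xi>))"
proof
  interpret pair_sigma_finite "count_space (UNIV :: (nat^'m) set)" "lborel :: (real^'n) measure"
    by (intro pair_sigma_finite.intro sigma_finite_count_nat_vec sigma_finite_lborel)
  assume "AE \<gamma> in (Gamma_measure :: ((nat^'m) \<times> (real^'n)) measure). Q \<gamma>"
  then have "\<forall>k. AE \<xi> in lborel. Q (k, \<xi>)"
    unfolding Gamma_measure_def by (auto dest: AE_pair simp: AE_count_space)
  then show "AE \<xi> in lborel. \<forall>k. Q (k, \<xi>)"
    using AE_ball_countable[OF countable_UNIV_nat_vec, of "\<lambda>\<xi> k. Q (k, \<xi>)" lborel] by simp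
next
  assume "AE \<xi> in lborel. \<forall>k :: nat^'m. Q (k, \<xi> :: real^'n)"
  then obtain N where N: "{\<xi> \<in> space lborel. \<not> (\<forall>k :: nat^'m. Q (k, \<xi>))} \<subseteq> N" "emeasure lborel N = 0" "N \<in> sets lborel"
    by (rule AE_E)
  show "AE \<gamma> in (Gamma_measure :: ((nat^'m) \<times> (real^'n)) measure). Q \<gamma>"
    unfolding Gamma_measure_def
  proof (rule AE_I')
    \<comment> \<open>The first factor has infinite measure; the product is null because \<infinity>
      * 0 = 0 in \<open>ennreal\<close>.\<close>
    show "UNIV \<times> N \<in> null_sets (count_space (UNIV :: (nat^'m) set) \<Otimes>\<^sub>M lborel)"
      using N by (auto simp: null_sets_def lborel.emeasure_pair_measure_Times)
    show "{\<gamma> \<in> space (count_space (UNIV :: (nat^'m) set) \<Otimes>\<^sub>M lborel). \<not> Q \<gamma>} \<subseteq> UNIV \<times> N"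
      using N(1) by auto
  qed
qed

lemma grushin_transform_eq:
  fixes f :: "(real^'m) \<times> (real^'n) \<Rightarrow> complex"
  shows "grushin_transform f (k, \<xi>) = (LINT x|lborel. partial_fourier f (x, \<xi>) * complex_of_real (scaled_hermite_fun k (norm \<xi>) x))"
  by (simp add: grushin_transform_def scaled_hermite_transform_def L2_inner_def)

text \<open>Hermite completeness works at fixed \<xi> with x' varying, and Fourier injectivity at
  fixed x' with \<xi> varying; exchanging the almost-everywhere quantifiers joins the two.\<close>

theorem grushin_transform_inj:
  fixes f h :: "(real^'m) \<times> (real^'n) \<Rightarrow> complex"
  assumes f: "f \<in> L2 lborel" and h: "h \<in> L2 lborel"
    and eq: "AE \<gamma> in Gamma_measure. grushin_transform f \<gamma> = grushin_transform h \<gamma>"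
  shows "AE x in lborel. f x = h x"
proof -
  let ?P = "partial_fourier f" and ?R = "partial_fourier h"
  have P: "?P \<in> L2 lborel" and R: "?R \<in> L2 lborel"
    using partial_fourier_pair(1) f h by auto
  have [measurable]: "?P \<in> borel_measurable (lborel \<Otimes>\<^sub>M lborel)" "?R \<in> borel_measurable (lborel \<Otimes>\<^sub>M lborel)"
    "f \<in> borel_measurable (lborel \<Otimes>\<^sub>M lborel)" "h \<in> borel_measurable (lborel \<Otimes>\<^sub>M lborel)"
    using L2_borel_measurable[OF P] L2_borel_measurable[OF R] L2_borel_measurable[OF f] L2_borel_measurable[OF h]
    by (simp_all add: lborel_prod)
  have "AE \<xi> in lborel. \<forall>k. grushin_transform f (k, \<xi>) = grushin_transform h (k, \<xi>)"
    using eq by (simp add: AE_Gamma_measure)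
  then have "AE \<xi> in lborel. AE x in lborel. ?P (x, \<xi>) = ?R (x, \<xi>)"
    using AE_L2_slice_snd[OF P] AE_L2_slice_snd[OF R] AE_lborel_singleton[of 0]
  proof eventually_elim
    case (elim \<xi>)
    \<comment> \<open>At \<xi> = 0 the scaled Hermite functions vanish identically, so this null set
      is excluded.\<close>
    then have \<xi>: "0 < norm \<xi>" by simp
    have "AE x in lborel. ?P (x, \<xi>) - ?R (x, \<xi>) = 0"
    proof (rule scaled_hermite_complete[OF L2_diff \<xi>])
      fix k
      note sc = L2_scaled_hermite_fun[OF \<xi>, of k]
      show "(LINT x|lborel. (?P (x, \<xi>) - ?R (x, \<xi>)) * complex_of_real (scaled_hermite_fun k (norm \<xi>) x)) = 0"
        using elim(1)[rule_format, of k] L2_mult_integrable[OF elim(2) sc] L2_mult_integrable[OF elim(3) sc]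
        unfolding grushin_transform_eq by (simp add: left_diff_distrib)
    qed (use elim in auto)
    then show ?case by simp
  qed
  moreover have "{p \<in> space (lborel \<Otimes>\<^sub>M lborel). ?P (fst p, snd p) = ?R (fst p, snd p)} \<in> sets (lborel \<Otimes>\<^sub>M lborel)"
    by measurable
  ultimately have "AE x in lborel. AE \<xi> in lborel. ?P (x, \<xi>) = ?R (x, \<xi>)"
    using lborel_pair.AE_commute[of "\<lambda>x \<xi>. ?P (x, \<xi>) = ?R (x, \<xi>)"] by simp
  then have ae: "AE x in lborel. AE y in lborel. f (x, y) = h (x, y)"
    using partial_fourier_pair(2)[OF f] partial_fourier_pair(2)[OF h]
    by eventually_elim (rule fourier_pair_inj)
  have "{p \<in> space (lborel \<Otimes>\<^sub>M lborel). f p = h p} \<in> sets (lborel \<Otimes>\<^sub>M lborel)" by measurable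
  from lborel_pair.AE_pair_measure[OF this ae] show ?thesis unfolding lborel_prod .
qed

text \<open>Fubini moves Mehler's kernel from the partial Fourier transform of f onto the Hermite
  function, which is an eigenfunction with eigenvalue exp (- t \<Theta>).\<close>

lemma grushin_transform_heat_solution:
  fixes f :: "(real^'m) \<times> (real^'n) \<Rightarrow> complex"
  assumes t: "0 < t" and f: "f \<in> L2 lborel"
  shows "AE \<gamma> in Gamma_measure. grushin_transform (heat_solution t f) \<gamma> = complex_of_real (exp (- t * Theta \<gamma>)) * grushin_transform f \<gamma>"
  unfolding AE_Gamma_measure
proof -
  let ?P = "partial_fourier f" and ?R = "partial_fourier (heat_solution t f)"
  have P: "?P \<in> L2 lborel" by (rule partial_fourier_pair(1)[OF f])
  have R: "?R \<in> L2 lborel" by (rule partial_fourier_pair(1)[OF L2_heat_solution[OF t f]])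
  have ME: "mehler_apply t ?P \<in> L2 lborel" by (rule L2_mehler_apply[OF t P])
  show "AE \<xi> in lborel. \<forall>k. grushin_transform (heat_solution t f) (k, \<xi>) = complex_of_real (exp (- t * Theta (k, \<xi>))) * grushin_transform f (k, \<xi>)"
    using partial_fourier_heat_solution[OF t f] AE_L2_slice_snd[OF P] AE_L2_slice_snd[OF R] AE_L2_slice_snd[OF ME] AE_lborel_singleton[of 0]
  proof (eventually_elim, intro allI)
    fix \<xi> :: "real^'n" and k :: "nat^'m"
    assume R_eq: "AE x in lborel. ?R (x, \<xi>) = mehler_apply t ?P (x, \<xi>)"
      and P\<xi>: "(\<lambda>x. ?P (x, \<xi>)) \<in> L2 lborel" and R\<xi>: "(\<lambda>x. ?R (x, \<xi>)) \<in> L2 lborel"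
      and M\<xi>: "(\<lambda>x. mehler_apply t ?P (x, \<xi>)) \<in> L2 lborel" and "\<xi> \<noteq> 0"
    then have \<xi>: "0 < norm \<xi>" by simp
    let ?s = "\<lambda>x. complex_of_real (scaled_hermite_fun k (norm \<xi>) x)"
    let ?m = "\<lambda>x y. complex_of_real (mehler t (norm \<xi>) x y)"
    let ?\<theta> = "exp (- t * Theta (k, \<xi>))"
    note s = L2_scaled_hermite_fun[OF \<xi>, of k]
    note [measurable] = L2_borel_measurable[OF s] L2_borel_measurable[OF P\<xi>] L2_borel_measurable[OF R\<xi>] L2_borel_measurable[OF M\<xi>]
    have int: "integrable (lborel \<Otimes>\<^sub>M lborel) (\<lambda>(x, y). ?m x y * ?P (y, \<xi>) * ?s x)"
    proof -
      \<comment> \<open>With parameter 2 t the Gaussian of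
        \<open>integral_gaussian_convolution\<close> is the majorant of
        \<open>mehler_le_gauss\<close>. The sum of the two squared moduli bounds the remaining
        product.\<close>
      let ?G = "\<lambda>p :: (real^'m) \<times> (real^'m). exp (- ((norm (fst p - snd p))\<^sup>2 / (2 * (2 * t))))"
      let ?D = "\<lambda>p. mehler_const TYPE('m) t * ((cmod (?P (snd p, \<xi>)))\<^sup>2 * ?G p + (cmod (?s (fst p)))\<^sup>2 * ?G p)" and ?k = "\<lambda>p. ?m (fst p) (snd p) * ?P (snd p, \<xi>) * ?s (fst p)"
      have t2: "0 < 2 * t" using t by simp
      have 1: "integrable (lborel \<Otimes>\<^sub>M lborel) (\<lambda>p. (cmod (?s (fst p)))\<^sup>2 * ?G p)"
        using integral_gaussian_convolution(1)[OF s t2] by (simp add: case_prod_unfold)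
      have 2: "integrable (lborel \<Otimes>\<^sub>M lborel) (\<lambda>p. (cmod (?P (snd p, \<xi>)))\<^sup>2 * ?G p)"
        using lborel_pair.integrable_product_swap[OF integral_gaussian_convolution(1)[OF P\<xi> t2]]
        by (simp add: case_prod_unfold norm_minus_commute)
      have "integrable (lborel \<Otimes>\<^sub>M lborel) (\<lambda>p. ?D p)"
        using 1 2 by simp
      then have "integrable (lborel \<Otimes>\<^sub>M lborel) (\<lambda>p. ?k p)"
      proof (rule Bochner_Integration.integrable_bound)
        show "AE p in lborel \<Otimes>\<^sub>M lborel. norm (?k p)
          \<le> norm (?D p)"
        proof (rule AE_I2)
          fix p :: "(real^'m) \<times> (real^'m)"
          have "norm (?k p) = mehler t (norm \<xi>) (fst p) (snd p) * cmod (?P (snd p, \<xi>) * ?s (fst p))"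
            by (simp add: norm_mult mehler_nonneg mult.assoc)
          also have "\<dots> \<le> (mehler_const TYPE('m) t * ?G p) * ((cmod (?P (snd p, \<xi>)))\<^sup>2 + (cmod (?s (fst p)))\<^sup>2)"
          proof (intro mult_mono)
            show "mehler t (norm \<xi>) (fst p) (snd p) \<le> mehler_const TYPE('m) t * ?G p"
              using mehler_le_gauss[OF t norm_ge_zero[of \<xi>], of "fst p" "snd p"] by simp
            show "cmod (?P (snd p, \<xi>) * ?s (fst p)) \<le> (cmod (?P (snd p, \<xi>)))\<^sup>2 + (cmod (?s (fst p)))\<^sup>2"
              by (rule order_trans[OF norm_mult_le_half_sum_squares]) simp
          qed (auto simp: mehler_const_nonneg)
          also have "\<dots> = ?D p"
            by (simp add: algebra_simps)
          finally show "norm (?k p)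
            \<le> norm (?D p)"
            by (rule order_trans) simp
        qed
      qed measurable
      then show ?thesis by (simp add: case_prod_unfold)
    qed
    have "grushin_transform (heat_solution t f) (k, \<xi>) = (LINT x|lborel. mehler_apply t ?P (x, \<xi>) * ?s x)"
      unfolding grushin_transform_eq using R_eq by (intro integral_cong_AE) auto
    also have "\<dots> = (LINT x|lborel. (LINT y|lborel. ?m x y * ?P (y, \<xi>) * ?s x))"
      by (simp add: mehler_apply_def)
    also have "\<dots> = (LINT y|lborel. (LINT x|lborel. ?m x y * ?P (y, \<xi>) * ?s x))"
      using int by (rule lborel_pair.Fubini_integral[symmetric])
    also have "\<dots> = (LINT y|lborel. complex_of_real ?\<theta> * (?P (y, \<xi>) * ?s y))"
    proof (rule Bochner_Integration.integral_cong[OF refl])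
      fix y :: "real^'m"
      have "(LINT x|lborel. ?m x y * ?P (y, \<xi>) * ?s x) = (LINT x|lborel. ?P (y, \<xi>) * complex_of_real (mehler t (norm \<xi>) x y * scaled_hermite_fun k (norm \<xi>) x))"
        by (simp add: mult_ac)
      also have "\<dots> = ?P (y, \<xi>) * complex_of_real (LINT x|lborel. mehler t (norm \<xi>) x y * scaled_hermite_fun k (norm \<xi>) x)"
        by (simp only: integral_mult_right_zero integral_complex_of_real)
      also have "\<dots> = complex_of_real ?\<theta> * (?P (y, \<xi>) * ?s y)"
        unfolding integral_mehler_scaled_hermite_fun[OF t \<xi>] Theta_def by (simp add: mult_ac)
      finally show "(LINT x|lborel. ?m x y * ?P (y, \<xi>) * ?s x) = complex_of_real ?\<theta> * (?P (y, \<xi>) * ?s y)" .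
    qed
    also have "\<dots> = complex_of_real ?\<theta> * grushin_transform f (k, \<xi>)"
      unfolding grushin_transform_eq by (rule integral_mult_right_zero)
    finally show "grushin_transform (heat_solution t f) (k, \<xi>) = complex_of_real ?\<theta> * grushin_transform f (k, \<xi>)" .
  qed
qed

text \<open>Integrability is asserted for both integrals because a Bochner integral of a
  non-integrable function is 0 by convention.\<close>

theorem theorem5p1:
  fixes t :: real
  assumes "t > 0"
  shows "(\<forall>x y :: (real^'m) \<times> (real^'n). integrable lborel (heat_kernel_integrand t x y)) \<and>
    (\<forall>f :: (real^'m) \<times> (real^'n) \<Rightarrow> complex. f \<in> L2 lborel \<longrightarrow>
       (AE x in lborel.
          integrable lborel (\<lambda>y. heat_kernel t x y * f y) \<and>
          grushin_semigroup t f x = (LINT y|lborel. heat_kernel t x y * f y)))"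
proof (intro conjI allI impI)
  show "integrable lborel (heat_kernel_integrand t x y)" for x y :: "(real^'m) \<times> (real^'n)"
    by (rule integrable_heat_kernel_integrand[OF assms])
next
  fix f :: "(real^'m) \<times> (real^'n) \<Rightarrow> complex" assume f: "f \<in> L2 lborel"
  let ?F = "\<lambda>\<gamma>. complex_of_real (exp (- t * Theta \<gamma>)) * grushin_transform f \<gamma>"
  \<comment> \<open>The explicit solution is a witness for the choice in
    \<open>inv_grushin_transform\<close>; the chosen function then has the same transform, and
    injectivity identifies the two almost everywhere.\<close>
  have sol: "heat_solution t f \<in> L2 lborel \<and> (AE \<gamma> in Gamma_measure. grushin_transform (heat_solution t f) \<gamma> = ?F \<gamma>)"
    using L2_heat_solution[OF assms f] grushin_transform_heat_solution[OF assms f] by simp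
  have semi: "grushin_semigroup t f = (SOME g. g \<in> L2 lborel \<and> (AE \<gamma> in Gamma_measure. grushin_transform g \<gamma> = ?F \<gamma>))"
    by (simp add: grushin_semigroup_def grushin_calculus_def inv_grushin_transform_def)
  have w: "grushin_semigroup t f \<in> L2 lborel" "AE \<gamma> in Gamma_measure. grushin_transform (grushin_semigroup t f) \<gamma> = ?F \<gamma>"
    using someI[of "\<lambda>g. g \<in> L2 lborel \<and> (AE \<gamma> in Gamma_measure. grushin_transform g \<gamma> = ?F \<gamma>)", OF sol]
    unfolding semi[symmetric] by auto
  have "AE \<gamma> in Gamma_measure. grushin_transform (grushin_semigroup t f) \<gamma> = grushin_transform (heat_solution t f) \<gamma>"
    using w(2) sol[THEN conjunct2] by eventually_elim simp
  then have "AE x in lborel. grushin_semigroup t f x = heat_solution t f x"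
    by (rule grushin_transform_inj[OF w(1) sol[THEN conjunct1]])
  then show "AE x in lborel. integrable lborel (\<lambda>y. heat_kernel t x y * f y) \<and>
      grushin_semigroup t f x = (LINT y|lborel. heat_kernel t x y * f y)"
    by eventually_elim (simp add: heat_kernel_integral[OF assms f])
qed

end
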